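(* Let $\mathbb{K}$ be a field of characteristic not $2$ and let $V$ be a finite-dimensional $\mathbb{K}$-vector space equipped with a nondegenerate symmetric bilinear form $\langle\cdot,\cdot\rangle$ of maximal Witt index $p=\lfloor\frac{\dim V}{2}\rfloor$. Assume $\dim V>8$ and let $\omega\in\bigwedge^p V$. If for every nonzero isotropic vector $v\in V$ the image $\Phi_v(\omega)$ of $\omega$ under the map $\Phi_v:\bigwedge^p V\to\bigwedge^{p-1}V_v$ lies in $\hat{Gr}_{\mathrm{iso}}(p-1,V_v)$, then $\omega$ lies in $\hat{Gr}_{\mathrm{iso}}(p,V)$.
   Context: A vector $v$ is isotropic if $\langle v,v\rangle=0$; a subspace $L$ is isotropic if $\langle u,w\rangle=0$ for all $u,w\in L$. The Witt index is the common dimension of all maximal isotropic subspaces. For a space $U$ with a nondegenerate symmetric bilinear form, the isotropic Grassmann cone is $$\hat{Gr}_{\mathrm{iso}}(k,U)=\{v_1\wedge\cdots\wedge v_k\mid v_i\in U,\ \langle v_i,v_j\rangle=0\text{ for all }i,j\}\subset\bigwedge\nolimits^kU.$$ For a nonzero isotropic $v\in V$, put $V_v=v^\perp/\mathrm{span}\{v\}$, with the induced nondegenerate bilinear form $\langle\bar v_1,\bar v_2\rangle=\langle v_1,v_2\rangle$. The linear map $\Phi_v:\bigwedge^kV\to\bigwedge^{k-1}V_v$ is the composition of the contraction $\varphi_v:\bigwedge^kV\to\bigwedge^{k-1}v^\perp$, $$v_1\wedge\cdots\wedge v_k\mapsto\sum_{i=1}^k(-1)^{i-1}\langle v,v_i\rangle\,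 v_1\wedge\cdots\wedge\widehat{v_i}\wedge\cdots\wedge v_k$$ (which takes values in $\bigwedge^{k-1}v^\perp$), with the map $\bigwedge^{k-1}\pi_v:\bigwedge^{k-1}v^\perp\to\bigwedge^{k-1}V_v$ induced by the projection $\pi_v:v^\perp\to V_v$. *)

theory Defs
  imports "HOL-Library.Poly_Mapping" "HOL-Computational_Algebra.Computational_Algebra"
begin

section \<open>Vector spaces with an explicit carrier\<close>

text \<open>The exterior powers are needed both for spaces whose carrier is a full type (or a subspace of
  one) and for the quotients \<open>V\<^sub>v\<close>, whose elements are cosets and which depend on the
  vector \<open>v\<close>. This record makes it possible to treat them uniformly.\<close>

record ('k, 'w) vspace =
  vecs :: "'w set"
  vadd :: "'w \<Rightarrow> 'w \<Rightarrow> 'w"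
  vscale :: "'k \<Rightarrow> 'w \<Rightarrow> 'w"

definition subspace_vs ::
  "('k::field \<Rightarrow> 'v::ab_group_add \<Rightarrow> 'v) \<Rightarrow> 'v set \<Rightarrow> ('k, 'v) vspace" where
  "subspace_vs scale S = \<lparr>vecs = S, vadd = (+), vscale = scale\<rparr>"

definition coset :: "'v::ab_group_add set \<Rightarrow> 'v \<Rightarrow> 'v set" where
  "coset N x = {x + n | n. n \<in> N}"

text \<open>The quotient \<open>S / N\<close>, for subspaces \<open>N \<subseteq> S\<close>. In the scalar
  multiplication the summand from \<open>N\<close> only matters for the scalar 0.\<close>

definition quotient_vs ::
  "('k::field \<Rightarrow> 'v::ab_group_add \<Rightarrow> 'v) \<Rightarrow> 'v set \<Rightarrow> 'v set \<Rightarrow> ('k, 'v set) vspace" where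
  "quotient_vs scale S N =
    \<lparr>vecs = coset N ` S,
     vadd = (\<lambda>X Y. {x + y | x y. x \<in> X \<and> y \<in> Y}),
     vscale = (\<lambda>c X. {scale c x + n | x n. x \<in> X \<and> n \<in> N})\<rparr>"


section \<open>Exterior powers\<close>

text \<open>The \<open>k\<close>-th exterior power of \<open>W\<close> is the free vector space on the
  \<open>k\<close>-tuples of vectors of \<open>W\<close> modulo the relations making tuples multilinear and
  alternating; its elements are cosets of formal linear combinations of tuples.\<close>

definition free_scale :: "'k::field \<Rightarrow> ('b \<Rightarrow>\<^sub>0 'k) \<Rightarrow> ('b \<Rightarrow>\<^sub>0 'k)" where
  "free_scale c p = Poly_Mapping.map ((*) c) p"

lemma lookup_free_scale: "Poly_Mapping.lookup (free_scale c p) x = c * Poly_Mapping.lookup p x"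
  by (simp add: free_scale_def Poly_Mapping.map.rep_eq when_def)

lemma vector_space_free_scale:
  "vector_space (free_scale :: 'k::field \<Rightarrow> ('b \<Rightarrow>\<^sub>0 'k) \<Rightarrow> _)"
  by unfold_locales (auto intro!: poly_mapping_eqI simp: lookup_free_scale lookup_add algebra_simps)

abbreviation generator :: "'w list \<Rightarrow> ('w list \<Rightarrow>\<^sub>0 'k::field)" where
  "generator xs \<equiv> Poly_Mapping.single xs 1"

definition tuples :: "nat \<Rightarrow> ('k, 'w) vspace \<Rightarrow> 'w list set" where
  "tuples k W = {xs. length xs = k \<and> set xs \<subseteq> vecs W}"

definition free_on_tuples :: "nat \<Rightarrow> ('k::field, 'w) vspace \<Rightarrow> ('w list \<Rightarrow>\<^sub>0 'k) set" where
  "free_on_tuples k W = {p. Poly_Mapping.keys p \<subseteq> tuples k W}"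

definition ext_relators :: "nat \<Rightarrow> ('k::field, 'w) vspace \<Rightarrow> ('w list \<Rightarrow>\<^sub>0 'k) set" where
  "ext_relators k W =
     {generator (xs[i := vadd W a b]) - generator (xs[i := a]) - generator (xs[i := b])
        | xs i a b. xs \<in> tuples k W \<and> i < k \<and> a \<in> vecs W \<and> b \<in> vecs W} \<union>
     {generator (xs[i := vscale W c a]) - free_scale c (generator (xs[i := a]))
        | xs i c a. xs \<in> tuples k W \<and> i < k \<and> a \<in> vecs W} \<union>
     {generator xs
        | xs i j. xs \<in> tuples k W \<and> i < k \<and> j < k \<and> i \<noteq> j \<and> xs ! i = xs ! j}"

definition ext_null :: "nat \<Rightarrow> ('k::field, 'w) vspace \<Rightarrow> ('w list \<Rightarrow>\<^sub>0 'k) set" where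
  "ext_null k W = module.span free_scale (ext_relators k W)"

definition ext_power ::
  "nat \<Rightarrow> ('k::field, 'w) vspace \<Rightarrow> ('k, ('w list \<Rightarrow>\<^sub>0 'k) set) vspace" where
  "ext_power k W = quotient_vs free_scale (free_on_tuples k W) (ext_null k W)"

definition wedge :: "('k::field, 'w) vspace \<Rightarrow> 'w list \<Rightarrow> ('w list \<Rightarrow>\<^sub>0 'k) set" where
  "wedge W xs = coset (ext_null (length xs) W) (generator xs)"

text \<open>\<open>ext_lift k W g\<close> is the linear map from an exterior power to
  \<open>ext_power k W\<close> which sends \<open>w\<^sub>1 \<and> \<dots> \<and> w\<^sub>m\<close> to the class of
  \<open>g [w\<^sub>1, \<dots>, w\<^sub>m]\<close>, provided that this class is multilinear and alternating in
  \<open>w\<^sub>1, \<dots>, w\<^sub>m\<close>. In that case all the cosets in the union below are equal.\<close>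

definition free_extend ::
  "('w list \<Rightarrow> ('u list \<Rightarrow>\<^sub>0 'k::field)) \<Rightarrow> ('w list \<Rightarrow>\<^sub>0 'k) \<Rightarrow> ('u list \<Rightarrow>\<^sub>0 'k)" where
  "free_extend g p =
     (\<Sum>xs\<in>Poly_Mapping.keys p. free_scale (Poly_Mapping.lookup p xs) (g xs))"

definition ext_lift ::
  "nat \<Rightarrow> ('k::field, 'u) vspace \<Rightarrow> ('w list \<Rightarrow> ('u list \<Rightarrow>\<^sub>0 'k)) \<Rightarrow>
    ('w list \<Rightarrow>\<^sub>0 'k) set \<Rightarrow> ('u list \<Rightarrow>\<^sub>0 'k) set" where
  "ext_lift k W g X = (\<Union>p\<in>X. coset (ext_null k W) (free_extend g p))"

text \<open>The map between \<open>k\<close>-th exterior powers induced by a linear map \<open>f\<close>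
  into \<open>W\<close>.\<close>

definition ext_map ::
  "nat \<Rightarrow> ('k::field, 'u) vspace \<Rightarrow> ('w \<Rightarrow> 'u) \<Rightarrow>
    ('w list \<Rightarrow>\<^sub>0 'k) set \<Rightarrow> ('u list \<Rightarrow>\<^sub>0 'k) set" where
  "ext_map k W f = ext_lift k W (\<lambda>xs. generator (map f xs))"


section \<open>Symmetric bilinear forms\<close>

definition symmetric_bilinear_form ::
  "('k::field \<Rightarrow> 'v::ab_group_add \<Rightarrow> 'v) \<Rightarrow> ('v \<Rightarrow> 'v \<Rightarrow> 'k) \<Rightarrow> bool" where
  "symmetric_bilinear_form scale B \<longleftrightarrow>
     (\<forall>x. Vector_Spaces.linear scale (*) (B x)) \<and> (\<forall>x y. B x y = B y x)"

definition nondegenerate_form :: "('v::zero \<Rightarrow> 'v \<Rightarrow> 'k::zero) \<Rightarrow> bool" where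
  "nondegenerate_form B \<longleftrightarrow> (\<forall>x. (\<forall>y. B x y = 0) \<longrightarrow> x = 0)"

definition isotropic_vector :: "('v \<Rightarrow> 'v \<Rightarrow> 'k::zero) \<Rightarrow> 'v \<Rightarrow> bool" where
  "isotropic_vector B v \<longleftrightarrow> B v v = 0"

definition isotropic_subspace ::
  "('k::field \<Rightarrow> 'v::ab_group_add \<Rightarrow> 'v) \<Rightarrow> ('v \<Rightarrow> 'v \<Rightarrow> 'k) \<Rightarrow> 'v set \<Rightarrow> bool" where
  "isotropic_subspace scale B L \<longleftrightarrow>
     module.subspace scale L \<and> (\<forall>u\<in>L. \<forall>w\<in>L. B u w = 0)"

definition maximal_isotropic_subspace ::
  "('k::field \<Rightarrow> 'v::ab_group_add \<Rightarrow> 'v) \<Rightarrow> ('v \<Rightarrow> 'v \<Rightarrow> 'k) \<Rightarrow> 'v set \<Rightarrow> bool" where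
  "maximal_isotropic_subspace scale B L \<longleftrightarrow>
     isotropic_subspace scale B L \<and>
     (\<forall>M. isotropic_subspace scale B M \<and> L \<subseteq> M \<longrightarrow> M = L)"

definition has_witt_index ::
  "('k::field \<Rightarrow> 'v::ab_group_add \<Rightarrow> 'v) \<Rightarrow> ('v \<Rightarrow> 'v \<Rightarrow> 'k) \<Rightarrow> nat \<Rightarrow> bool" where
  "has_witt_index scale B n \<longleftrightarrow>
     (\<exists>L. maximal_isotropic_subspace scale B L) \<and>
     (\<forall>L. maximal_isotropic_subspace scale B L \<longrightarrow> vector_space.dim scale L = n)"

definition Gr_iso ::
  "nat \<Rightarrow> ('k::field, 'w) vspace \<Rightarrow> ('w \<Rightarrow> 'w \<Rightarrow> 'k) \<Rightarrow> ('w list \<Rightarrow>\<^sub>0 'k) set set" where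
  "Gr_iso k U B =
     {wedge U xs | xs. xs \<in> tuples k U \<and> (\<forall>x\<in>set xs. \<forall>y\<in>set xs. B x y = 0)}"


section \<open>The maps \<open>\<Phi>\<^sub>v\<close>\<close>

definition perp :: "('v \<Rightarrow> 'v \<Rightarrow> 'k::zero) \<Rightarrow> 'v \<Rightarrow> 'v set" where
  "perp B v = {x. B v x = 0}"

definition perp_quotient ::
  "('k::field \<Rightarrow> 'v::ab_group_add \<Rightarrow> 'v) \<Rightarrow> ('v \<Rightarrow> 'v \<Rightarrow> 'k) \<Rightarrow> 'v \<Rightarrow> ('k, 'v set) vspace" where
  "perp_quotient scale B v = quotient_vs scale (perp B v) (module.span scale {v})"

definition perp_proj ::
  "('k::field \<Rightarrow> 'v::ab_group_add \<Rightarrow> 'v) \<Rightarrow> 'v \<Rightarrow> 'v \<Rightarrow> 'v set" where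
  "perp_proj scale v = coset (module.span scale {v})"

definition quotient_form :: "('v \<Rightarrow> 'v \<Rightarrow> 'k) \<Rightarrow> 'v set \<Rightarrow> 'v set \<Rightarrow> 'k" where
  "quotient_form B X Y = (THE c. \<forall>x\<in>X. \<forall>y\<in>Y. B x y = c)"

text \<open>The contraction with \<open>v\<close>, with values in the exterior power of the whole space.
  The sign is \<open>(-1)\<^sup>i\<close> because positions are counted from 0.\<close>

definition contraction ::
  "('k::field \<Rightarrow> 'v::ab_group_add \<Rightarrow> 'v) \<Rightarrow> ('v \<Rightarrow> 'v \<Rightarrow> 'k) \<Rightarrow> 'v \<Rightarrow> nat \<Rightarrow>
    ('v list \<Rightarrow>\<^sub>0 'k) set \<Rightarrow> ('v list \<Rightarrow>\<^sub>0 'k) set" where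
  "contraction scale B v k =
     ext_lift (k - 1) (subspace_vs scale UNIV)
       (\<lambda>xs. \<Sum>i<length xs.
          free_scale ((- 1) ^ i * B v (xs ! i)) (generator (take i xs @ drop (Suc i) xs)))"

text \<open>The contraction takes values in the exterior power of \<open>v\<^sup>\<bottom>\<close>, seen inside that of
  the whole space by the injective map induced by the inclusion; the individual summands in its
  definition need not lie there. Inverting this map gives an element of the exterior power of
  \<open>v\<^sup>\<bottom>\<close>, to which the map induced by the projection to \<open>V\<^sub>v\<close> applies.\<close>

definition perp_contraction ::
  "('k::field \<Rightarrow> 'v::ab_group_add \<Rightarrow> 'v) \<Rightarrow> ('v \<Rightarrow> 'v \<Rightarrow> 'k) \<Rightarrow> 'v \<Rightarrow> nat \<Rightarrow>
    ('v list \<Rightarrow>\<^sub>0 'k) set \<Rightarrow> ('v list \<Rightarrow>\<^sub>0 'k) set" where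
  "perp_contraction scale B v k \<omega> =
     the_inv_into (vecs (ext_power (k - 1) (subspace_vs scale (perp B v))))
       (ext_map (k - 1) (subspace_vs scale UNIV) (\<lambda>x. x))
       (contraction scale B v k \<omega>)"

definition Phi ::
  "('k::field \<Rightarrow> 'v::ab_group_add \<Rightarrow> 'v) \<Rightarrow> ('v \<Rightarrow> 'v \<Rightarrow> 'k) \<Rightarrow> 'v \<Rightarrow> nat \<Rightarrow>
    ('v list \<Rightarrow>\<^sub>0 'k) set \<Rightarrow> ('v set list \<Rightarrow>\<^sub>0 'k) set" where
  "Phi scale B v k \<omega> =
     ext_map (k - 1) (perp_quotient scale B v) (perp_proj scale v)
       (perp_contraction scale B v k \<omega>)"

end

theory Submission
  imports Defs "HOL-Library.Function_Algebras"
begin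

text \<open>For isotropic \<open>v\<close>, wedging with \<open>v\<close> embeds the exterior power of \<open>V\<^sub>v\<close> into that of \<open>V\<close>,
  so the hypothesis says that \<open>A\<^sub>v \<omega> = v \<and> (v \<lrcorner> \<omega>)\<close> is zero or represents a maximal isotropic
  subspace \<open>M\<^sub>v\<close> for every isotropic \<open>v\<close>. If all \<open>A\<^sub>v \<omega>\<close> vanish, then \<open>\<omega> = 0\<close>. Otherwise choose \<open>v\<close>
  with \<open>A\<^sub>v \<omega> \<noteq> 0\<close> and a hyperbolic frame \<open>e\<^sub>i\<close>, \<open>f\<^sub>i\<close> such that \<open>v\<close> is one of the \<open>f\<^sub>i\<close> and \<open>M\<^sub>v\<close> is
  spanned by \<open>v\<close> and the other \<open>e\<^sub>i\<close>. For orthogonal \<open>v\<close>, \<open>w\<close> the operators \<open>A\<^sub>v\<close>, \<open>A\<^sub>w\<close> commute,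
  which relates \<open>M\<^sub>v\<close> and \<open>M\<^sub>w\<close>. Hence the frame can be corrected so that \<open>A\<^sub>v \<omega> = A\<^sub>v \<phi>\<close> for
  \<open>\<phi> = e\<^sub>1 \<and> \<dots> \<and> e\<^sub>p\<close> and all \<open>v = f\<^sub>i\<close>, and then the same follows for \<open>v = f\<^sub>i + f\<^sub>j\<close> and
  \<open>v = e\<^sub>i \<plusminus> f\<^sub>j\<close>. These vectors are enough to conclude \<open>\<omega> - \<phi> = 0\<close>.\<close>

section \<open>The exterior algebra as alternating functions\<close>

text \<open>The form identifies \<open>V\<close> with its dual, so elements of the exterior algebra
  become functions on lists of vectors, on which wedging and contracting both act; they anticommute
  up to the scalar \<open>B x y\<close>, and the geometric arguments are computations with this
  relation. Cosets and quotients enter only through \<open>lin_ext wedges\<close>, which is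
  injective modulo the relations.

  For orthogonal \<open>a\<close> and \<open>v\<close>, agreement of \<open>act a\<close> on
  \<open>\<omega>\<close> and \<open>\<phi>\<close> determines only
  \<open>act a (act v \<omega>)\<close>, hence the vectors annihilating
  \<open>act v \<omega>\<close> up to an unknown multiple of \<open>a\<close>. Removing this
  ambiguity takes a second vector \<open>b\<close>, orthogonal to \<open>a\<close> or pairing
  nontrivially with it, and the bound on the dimension provides the room for \<open>b\<close>. The
  critical case is \<open>v = e i + s f j\<close> with candidate \<open>e m\<close>: two indices
  outside \<open>i\<close>, \<open>j\<close>, \<open>m\<close> exist if \<open>p \<ge> 5\<close>,
  while for \<open>p = 4\<close> the dimension is 9 and a nonisotropic vector orthogonal to the
  frame makes up for the missing index.

  Annihilating vectors fix \<open>act v \<omega>\<close> only up to a scalar; that it is 1 follows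
  by comparing \<open>act a (act v \<omega>)\<close> with
  \<open>act a (act v \<phi>)\<close>.\<close>

definition smult_fun :: "'k::field \<Rightarrow> ('a \<Rightarrow> 'k) \<Rightarrow> 'a \<Rightarrow> 'k" where
  "smult_fun c \<phi> = (\<lambda>x. c * \<phi> x)"

lemma smult_fun_apply: "smult_fun c \<phi> x = c * \<phi> x"
  by (simp add: smult_fun_def)

text \<open>As default simplification rules, the pointwise equations would also rewrite eta-expanded
  functions that are not applied to an argument.\<close>

declare zero_fun_apply [simp del] plus_fun_apply [simp del]

named_theorems pointwise

declare smult_fun_apply [pointwise] zero_fun_apply [pointwise] plus_fun_apply [pointwise]
  fun_diff_def [pointwise] fun_Compl_def [pointwise]

lemma smult_fun_simps [simp]:
  "smult_fun 1 \<phi> = \<phi>" "smult_fun 0 \<phi> = 0" "smult_fun c 0 = 0"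
  "smult_fun c (smult_fun d \<phi>) = smult_fun (c * d) \<phi>"
  by (auto simp: fun_eq_iff pointwise)

lemma smult_fun_eq_0_iff: "smult_fun c \<phi> = 0 \<longleftrightarrow> c = 0 \<or> \<phi> = 0"
  by (auto simp: fun_eq_iff pointwise)

text \<open>Interior multiplication, for elements of the exterior algebra regarded as alternating
  multilinear functions on tuples of vectors of arbitrary length.\<close>

definition contr :: "'v \<Rightarrow> ('v list \<Rightarrow> 'k) \<Rightarrow> 'v list \<Rightarrow> 'k" where
  "contr x \<phi> = (\<lambda>ys. \<phi> (x # ys))"

lemma contr_apply [pointwise]: "contr x \<phi> ys = \<phi> (x # ys)"
  by (simp add: contr_def)

lemma contr_linear [simp]:
  "contr x (\<phi> + \<psi>) = contr x \<phi> + contr x \<psi>"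
  "contr x (\<phi> - \<psi>) = contr x \<phi> - contr x \<psi>"
  "contr x (- \<phi>) = - contr x \<phi>"
  "contr x 0 = 0"
  "contr x (smult_fun c \<phi>) = smult_fun c (contr x \<phi>)"
  by (auto simp: fun_eq_iff pointwise)

definition vacuum :: "'v list \<Rightarrow> 'k::field" where
  "vacuum xs = (if xs = [] then 1 else 0)"

lemma contr_vacuum [simp]: "contr x vacuum = 0"
  by (auto simp: vacuum_def fun_eq_iff pointwise)

lemma vacuum_nonzero: "vacuum \<noteq> 0"
  by (metis vacuum_def zero_fun_apply zero_neq_one)

locale bilinear_space = finite_dimensional_vector_space scale Basis
  for scale :: "'k::field \<Rightarrow> 'v::ab_group_add \<Rightarrow> 'v" and Basis :: "'v set" +
  fixes B :: "'v \<Rightarrow> 'v \<Rightarrow> 'k"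
  assumes form: "symmetric_bilinear_form scale B"
    and nondegenerate: "nondegenerate_form B"
    and two_nonzero: "(2::'k) \<noteq> 0"
begin

section \<open>Bilinearity, and dual vectors for a nondegenerate form\<close>

lemma B_add_right [simp]: "B x (y + z) = B x y + B x z"
  and B_scale_right [simp]: "B x (scale c y) = c * B x y"
  using form linear_iff by (auto simp: symmetric_bilinear_form_def Vector_Spaces.linear_iff)

lemma B_commute: "B x y = B y x"
  using form by (auto simp: symmetric_bilinear_form_def)

lemma B_add_left [simp]: "B (x + y) z = B x z + B y z"
  and B_scale_left [simp]: "B (scale c x) y = c * B x y"
  by (metis B_commute B_add_right, metis B_commute B_scale_right)

lemma B_zero_right [simp]: "B x 0 = 0"
  using B_scale_right[of x 0 0] by simp

lemma B_zero_left [simp]: "B 0 x = 0"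
  by (metis B_commute B_zero_right)

lemma B_minus_right [simp]: "B x (- y) = - B x y"
  using B_add_right[of x y "- y"] by (simp add: minus_unique)

lemma B_minus_left [simp]: "B (- x) y = - B x y"
  by (metis B_commute B_minus_right)

lemma B_diff_right [simp]: "B x (y - z) = B x y - B x z"
  using B_add_right[of x y "- z"] by simp

lemma B_diff_left [simp]: "B (x - y) z = B x z - B y z"
  by (metis B_commute B_diff_right)

lemma B_sum_right: "B x (\<Sum>i\<in>A. g i) = (\<Sum>i\<in>A. B x (g i))"
  by (induction A rule: infinite_finite_induct) auto

lemma B_sum_left: "B (\<Sum>i\<in>A. g i) x = (\<Sum>i\<in>A. B (g i) x)"
  by (induction A rule: infinite_finite_induct) auto

lemma B_span_right: "y \<in> span S \<Longrightarrow> (\<And>s. s \<in> S \<Longrightarrow> B x s = 0) \<Longrightarrow> B x y = 0"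
  by (induction rule: span_induct_alt) auto

lemma B_span_span:
  assumes "\<And>s t. s \<in> S \<Longrightarrow> t \<in> T \<Longrightarrow> B s t = 0" "x \<in> span S" "y \<in> span T"
  shows "B x y = 0"
  by (metis assms B_commute B_span_right)

text \<open>Nondegeneracy makes \<open>F\<close> injective and finite dimension makes it surjective.
  The pairings are recorded as coefficients of \<open>S\<close> itself, so that \<open>F\<close> is
  an endomorphism.\<close>

lemma exists_dual_family:
  assumes "independent S" "span S = UNIV"
  shows "\<exists>d. \<forall>s\<in>S. B d s = g s"
proof -
  have fin: "finite S"
    using assms(1) finiteI_independent by blast
  define F where "F d = (\<Sum>s\<in>S. scale (B d s) s)" for d
  have lin: "Vector_Spaces.linear scale scale F"
    by unfold_locales
      (auto simp: F_def algebra_simps sum.distrib scale_sum_right)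
  have "F d = 0 \<Longrightarrow> d = 0" for d
  proof -
    assume "F d = 0"
    then have "\<forall>s\<in>S. B d s = 0"
      using assms(1) fin independentD[of S S "B d"] by (auto simp: F_def)
    then have "B d y = 0" for y
      using B_span_right[of y S d] assms(2) by auto
    then show "d = 0"
      using nondegenerate by (auto simp: nondegenerate_form_def)
  qed
  then have "inj F"
    by (metis (no_types, lifting) injI right_minus_eq module_hom.diff[OF Vector_Spaces.linear.axioms(3)[OF lin]])
  then obtain d where d: "F d = (\<Sum>s\<in>S. scale (g s) s)"
    using linear_inj_imp_surj[OF lin] by (metis surjD)
  have "(\<Sum>s\<in>S. scale (B d s - g s) s) = 0"
    using d by (simp add: F_def algebra_simps sum_subtractf)
  then show ?thesis
    using assms(1) fin independentD[of S S "\<lambda>s. B d s - g s"] by auto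
qed

text \<open>The main device for proving membership in a span: a vector outside is detected by some
  \<open>d\<close> orthogonal to the span, and contraction with \<open>d\<close> kills every product
  of vectors from it.\<close>

lemma exists_dual_vector:
  assumes "x \<notin> span S"
  shows "\<exists>d. B d x = 1 \<and> (\<forall>s\<in>S. B d s = 0)"
proof -
  obtain T where T: "T \<subseteq> S" "independent T" "S \<subseteq> span T"
    using maximal_independent_subset by blast
  have "x \<notin> span T"
    using assms T span_mono by blast
  then have ind: "independent (insert x T)"
    using T by (simp add: independent_insertI)
  have ind': "independent (extend_basis (insert x T))"
    and span': "span (extend_basis (insert x T)) = UNIV"
    and sub: "insert x T \<subseteq> extend_basis (insert x T)"
    using independent_extend_basis[OF ind] span_extend_basis[OF ind] extend_basis_superset[OF ind]
    by auto
  obtain d where d: "\<forall>s\<in>extend_basis (insert x T). B d s = (if s = x then 1 else 0)"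
    using exists_dual_family[OF ind' span', of "\<lambda>s. if s = x then 1 else 0"] by auto
  have "x \<notin> T"
    using \<open>x \<notin> span T\<close> span_base by blast
  then have "\<forall>s\<in>T. B d s = 0"
    using d sub by auto
  then have "\<forall>s\<in>S. B d s = 0"
    using B_span_right T by blast
  moreover have "B d x = 1"
    using d sub by auto
  ultimately show ?thesis
    by blast
qed

lemma independent_if_dual:
  assumes "\<And>a. a \<in> S \<Longrightarrow> \<exists>d. B d a \<noteq> 0 \<and> (\<forall>s\<in>S - {a}. B d s = 0)"
  shows "independent S"
  unfolding dependent_def using assms B_span_right by blast


text \<open>The recursion is the relation \<open>contr x \<circ> wdg y + wdg y \<circ> contr x = B x y\<close>.\<close>

fun wdg :: "'v \<Rightarrow> ('v list \<Rightarrow> 'k) \<Rightarrow> 'v list \<Rightarrow> 'k" where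
  "wdg y \<phi> [] = 0"
| "wdg y \<phi> (x # xs) = B y x * \<phi> xs - wdg y (contr x \<phi>) xs"

lemma contr_wdg: "contr x (wdg y \<phi>) = smult_fun (B x y) \<phi> - wdg y (contr x \<phi>)"
  by (auto simp: fun_eq_iff pointwise B_commute)

lemma wdg_add [simp]: "wdg y (\<phi> + \<psi>) = wdg y \<phi> + wdg y \<psi>"
proof
  show "wdg y (\<phi> + \<psi>) xs = (wdg y \<phi> + wdg y \<psi>) xs" for xs
    by (induction xs arbitrary: \<phi> \<psi>) (auto simp: algebra_simps pointwise)
qed

lemma wdg_smult [simp]: "wdg y (smult_fun c \<phi>) = smult_fun c (wdg y \<phi>)"
proof
  show "wdg y (smult_fun c \<phi>) xs = smult_fun c (wdg y \<phi>) xs" for xs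
    by (induction xs arbitrary: \<phi>) (auto simp: algebra_simps pointwise)
qed

lemma wdg_zero [simp]: "wdg y 0 = 0"
  using wdg_smult[of y 0 0] by simp

lemma wdg_uminus [simp]: "wdg y (- \<phi>) = - wdg y \<phi>"
  using wdg_add[of y \<phi> "- \<phi>"] by (metis add.right_inverse add_left_imp_eq wdg_zero)

lemma wdg_diff [simp]: "wdg y (\<phi> - \<psi>) = wdg y \<phi> - wdg y \<psi>"
  using wdg_add[of y \<phi> "- \<psi>"] by simp

lemma wdg_add_left [simp]: "wdg (x + y) \<phi> = wdg x \<phi> + wdg y \<phi>"
proof
  show "wdg (x + y) \<phi> xs = (wdg x \<phi> + wdg y \<phi>) xs" for xs
    by (induction xs arbitrary: \<phi>) (auto simp: algebra_simps pointwise)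
qed

lemma wdg_scale_left [simp]: "wdg (scale c x) \<phi> = smult_fun c (wdg x \<phi>)"
proof
  show "wdg (scale c x) \<phi> xs = smult_fun c (wdg x \<phi>) xs" for xs
    by (induction xs arbitrary: \<phi>) (auto simp: algebra_simps pointwise)
qed

lemma wdg_zero_left [simp]: "wdg 0 \<phi> = 0"
  using wdg_scale_left[of 0 0 \<phi>] by simp

lemma wdg_minus_left [simp]: "wdg (- x) \<phi> = - wdg x \<phi>"
  using wdg_add_left[of x "- x" \<phi>] by (metis add.right_inverse add_left_imp_eq wdg_zero_left)

lemma wdg_diff_left [simp]: "wdg (x - y) \<phi> = wdg x \<phi> - wdg y \<phi>"
  using wdg_add_left[of x "- y" \<phi>] by simp

lemma wdg_wdg_self [simp]: "wdg x (wdg x \<phi>) = 0"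
proof
  show "wdg x (wdg x \<phi>) ys = 0 ys" for ys
    by (induction ys arbitrary: \<phi>) (simp_all add: contr_wdg, simp_all add: pointwise B_commute)
qed

lemma wdg_anticommute: "wdg x (wdg y \<phi>) = - wdg y (wdg x \<phi>)"
proof -
  have "wdg (x + y) (wdg (x + y) \<phi>) = 0"
    by (rule wdg_wdg_self)
  then have "wdg x (wdg y \<phi>) + wdg y (wdg x \<phi>) = 0"
    by (simp add: add.commute)
  then show ?thesis
    by (rule eq_neg_iff_add_eq_0[THEN iffD2])
qed

lemma wdg_eq_0_if_perp: "(\<And>x. x \<in> set xs \<Longrightarrow> B y x = 0) \<Longrightarrow> wdg y \<phi> xs = 0"
  by (induction xs arbitrary: \<phi>) auto

section \<open>Annihilators and products of vectors\<close>

definition ann :: "('v list \<Rightarrow> 'k) \<Rightarrow> 'v set" where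
  "ann \<phi> = {x. wdg x \<phi> = 0}"

lemma subspace_ann: "subspace (ann \<phi>)"
  by (auto simp: subspace_def ann_def)

lemma ann_wdg: "x \<in> ann \<phi> \<Longrightarrow> x \<in> ann (wdg y \<phi>)"
  by (simp add: ann_def wdg_anticommute[of x y])

text \<open>In the anticommutation relation the term with \<open>wdg x \<phi>\<close> is gone. With
  \<open>B d x = 1\<close> this rebuilds \<open>\<phi>\<close> from its contraction, which drives
  most of the uniqueness and nonvanishing arguments.\<close>

lemma wdg_contr_if_ann: "x \<in> ann \<phi> \<Longrightarrow> wdg x (contr d \<phi>) = smult_fun (B d x) \<phi>"
  using contr_wdg[of d x \<phi>] by (simp add: ann_def)

lemma ann_contr: "x \<in> ann \<phi> \<Longrightarrow> B d x = 0 \<Longrightarrow> x \<in> ann (contr d \<phi>)"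
  by (auto simp: wdg_contr_if_ann ann_def)

definition wedges :: "'v list \<Rightarrow> 'v list \<Rightarrow> 'k" where
  "wedges xs = foldr wdg xs vacuum"

lemma wedges_Nil [simp]: "wedges [] = vacuum"
  and wedges_Cons [simp]: "wedges (x # xs) = wdg x (wedges xs)"
  by (simp_all add: wedges_def)

lemma set_subset_ann_wedges: "set xs \<subseteq> ann (wedges xs)"
  by (induction xs) (auto simp: ann_wdg, auto simp: ann_def)

lemma span_subset_ann_wedges: "span (set xs) \<subseteq> ann (wedges xs)"
  by (simp add: set_subset_ann_wedges span_minimal subspace_ann)

lemma contr_wedges_perp: "(\<And>y. y \<in> set ys \<Longrightarrow> B x y = 0) \<Longrightarrow> contr x (wedges ys) = 0"
  by (induction ys) (auto simp: contr_wdg)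

text \<open>For an annihilating \<open>x\<close> outside the span, a dual vector \<open>d\<close>
  orthogonal to all factors contracts the product to 0, but wedging the result with \<open>x\<close>
  restores the product.\<close>

lemma ann_wedges:
  assumes "wedges xs \<noteq> 0"
  shows "ann (wedges xs) = span (set xs)"
proof (rule antisym[OF subsetI span_subset_ann_wedges], rule ccontr)
  fix x assume x: "x \<in> ann (wedges xs)" "x \<notin> span (set xs)"
  then obtain d where d: "B d x = 1" "\<forall>s\<in>set xs. B d s = 0"
    using exists_dual_vector by blast
  then show False
    using wdg_contr_if_ann[OF x(1), of d] contr_wedges_perp[of xs d] assms by simp
qed

lemma wedges_nonzero_ConsI:
  assumes "wedges xs \<noteq> 0" "B d x \<noteq> 0" "\<And>y. y \<in> set xs \<Longrightarrow> B d y = 0"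
  shows "wedges (x # xs) \<noteq> 0"
proof
  assume "wedges (x # xs) = 0"
  then have "smult_fun (B d x) (wedges xs) = 0"
    using contr_wdg[of d x "wedges xs"] contr_wedges_perp[of xs d] assms(3) by auto
  then show False
    using assms by (simp add: smult_fun_eq_0_iff)
qed

lemma wedges_nonzero_imp_independent:
  "wedges xs \<noteq> 0 \<Longrightarrow> distinct xs \<and> independent (set xs)"
proof (induction xs)
  case (Cons x xs)
  have "wedges xs \<noteq> 0"
    using Cons.prems by auto
  moreover have "x \<notin> span (set xs)"
    using Cons.prems span_subset_ann_wedges[of xs] by (auto simp: ann_def)
  moreover have "x \<notin> set xs"
    using \<open>x \<notin> span (set xs)\<close> span_base by blast
  ultimately show ?case
    using Cons.IH[OF \<open>wedges xs \<noteq> 0\<close>] independent_insertI[of x "set xs"] by simp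
qed (simp add: independent_empty)

text \<open>A wedge with \<open>v\<close> hides multiples of \<open>v\<close> in the other factors.
  This is used both for correcting frame vectors by multiples of \<open>f 0\<close> and for the
  independence of representatives in \<open>V\<^sub>v\<close>.\<close>

lemma wdg_wedges_cong:
  assumes "list_all2 (\<lambda>x y. \<exists>c. x - y = scale c v) xs ys"
  shows "wdg v (wedges xs) = wdg v (wedges ys)"
  using assms
proof (induction rule: list_all2_induct)
  case (Cons x xs y ys)
  then obtain c where "x = y + scale c v"
    by (metis diff_add_cancel add.commute)
  then have "wdg v (wdg x (wedges xs)) = - wdg y (wdg v (wedges xs))"
    using wdg_anticommute[of y v] by (simp add: wdg_anticommute[of v y])
  then show ?case
    using Cons wdg_anticommute[of y v] by simp
qed simp


text \<open>The part of degree \<open>k\<close>: multilinear alternating functions that vanish on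
  lists of any other length. In the recursive form an induction on the degree splits off the first
  argument. Only equal adjacent arguments are required to give 0; the general case is
  \<open>alt_not_distinct\<close>.\<close>

primrec alt :: "nat \<Rightarrow> ('v list \<Rightarrow> 'k) set" where
  "alt 0 = {\<phi>. \<forall>x. contr x \<phi> = 0}"
| "alt (Suc k) = {\<phi>. \<phi> [] = 0 \<and> (\<forall>x. contr x \<phi> \<in> alt k \<and> contr x (contr x \<phi>) = 0) \<and>
     (\<forall>x y. contr (x + y) \<phi> = contr x \<phi> + contr y \<phi>) \<and>
     (\<forall>c x. contr (scale c x) \<phi> = smult_fun c (contr x \<phi>))}"

lemma alt_0_iff: "\<phi> \<in> alt 0 \<longleftrightarrow> (\<forall>x. contr x \<phi> = 0)"
  by (simp only: alt.simps mem_Collect_eq)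

lemma alt_Suc_iff:
  "\<phi> \<in> alt (Suc k) \<longleftrightarrow> \<phi> [] = 0 \<and> (\<forall>x. contr x \<phi> \<in> alt k \<and> contr x (contr x \<phi>) = 0) \<and>
     (\<forall>x y. contr (x + y) \<phi> = contr x \<phi> + contr y \<phi>) \<and>
     (\<forall>c x. contr (scale c x) \<phi> = smult_fun c (contr x \<phi>))"
  by (simp only: alt.simps mem_Collect_eq)

declare alt.simps [simp del] alt_0_iff [simp] alt_Suc_iff [simp]

lemma alt_zero [simp]: "0 \<in> alt k"
  by (induction k) (simp_all, simp add: zero_fun_apply)

lemma alt_add [intro]: "\<phi> \<in> alt k \<Longrightarrow> \<psi> \<in> alt k \<Longrightarrow> \<phi> + \<psi> \<in> alt k"
  by (induction k arbitrary: \<phi> \<psi>) (simp_all, simp add: fun_eq_iff pointwise algebra_simps)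

lemma alt_smult [intro]: "\<phi> \<in> alt k \<Longrightarrow> smult_fun c \<phi> \<in> alt k"
  by (induction k arbitrary: \<phi>) (simp_all, simp add: fun_eq_iff pointwise algebra_simps)

lemma alt_diff [intro]: "\<phi> \<in> alt k \<Longrightarrow> \<psi> \<in> alt k \<Longrightarrow> \<phi> - \<psi> \<in> alt k"
proof -
  assume "\<phi> \<in> alt k" "\<psi> \<in> alt k"
  then have "\<phi> + smult_fun (- 1) \<psi> \<in> alt k"
    by blast
  moreover have "\<phi> + smult_fun (- 1) \<psi> = \<phi> - \<psi>"
    by (auto simp: fun_eq_iff pointwise)
  ultimately show ?thesis
    by simp
qed

lemma alt_contr: "\<phi> \<in> alt (Suc k) \<Longrightarrow> contr x \<phi> \<in> alt k"
  by auto

lemma alt_contr_add: "\<phi> \<in> alt k \<Longrightarrow> contr (x + y) \<phi> = contr x \<phi> + contr y \<phi>"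
  by (cases k) auto

lemma alt_contr_scale: "\<phi> \<in> alt k \<Longrightarrow> contr (scale c x) \<phi> = smult_fun c (contr x \<phi>)"
  by (cases k) auto

lemma alt_contr_self: "\<phi> \<in> alt k \<Longrightarrow> contr x (contr x \<phi>) = 0"
  by (cases k) auto

lemma alt_contr_zero: "\<phi> \<in> alt k \<Longrightarrow> contr 0 \<phi> = 0"
  using alt_contr_scale[of \<phi> k 0 0] by simp

lemma alt_contr_anticommute:
  assumes "\<phi> \<in> alt k"
  shows "contr x (contr y \<phi>) = - contr y (contr x \<phi>)"
proof -
  have "contr (x + y) (contr z \<phi>) = contr x (contr z \<phi>) + contr y (contr z \<phi>)" for z
    using assms by (cases k) (auto intro!: alt_contr_add)
  then have "contr x (contr y \<phi>) + contr y (contr x \<phi>) = 0"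
    using alt_contr_self[OF assms, of "x + y"] alt_contr_self[OF assms, of x]
      alt_contr_self[OF assms, of y] alt_contr_add[OF assms]
    by (simp add: algebra_simps)
  then show ?thesis
    by (rule eq_neg_iff_add_eq_0[THEN iffD2])
qed

lemma alt_wdg: "\<phi> \<in> alt k \<Longrightarrow> wdg y \<phi> \<in> alt (Suc k)"
proof (induction k arbitrary: \<phi>)
  case 0
  then have "contr x (wdg y \<phi>) = smult_fun (B x y) \<phi>" for x
    using 0 by (simp add: contr_wdg)
  then show ?case
    using 0 by simp (simp add: fun_eq_iff pointwise algebra_simps)
next
  case (Suc k)
  have "contr x (wdg y \<phi>) \<in> alt (Suc k)" for x
    unfolding contr_wdg using Suc.prems Suc.IH[OF alt_contr[OF Suc.prems]]
    by (intro alt_diff alt_smult)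
  moreover have "contr x (contr x (wdg y \<phi>)) = 0" for x
    using alt_contr_self[OF Suc.prems] by (simp add: contr_wdg)
  moreover have "contr (x + z) (wdg y \<phi>) = contr x (wdg y \<phi>) + contr z (wdg y \<phi>)" for x z
    using alt_contr_add[OF Suc.prems]
    by (simp add: contr_wdg) (auto simp: fun_eq_iff pointwise algebra_simps)
  moreover have "contr (scale c x) (wdg y \<phi>) = smult_fun c (contr x (wdg y \<phi>))" for x c
    using alt_contr_scale[OF Suc.prems]
    by (simp add: contr_wdg) (auto simp: fun_eq_iff pointwise algebra_simps)
  ultimately show ?case
    unfolding alt_Suc_iff[of _ "Suc k"] by simp
qed

lemma alt_vacuum: "vacuum \<in> alt 0"
  by simp

lemma alt_wedges: "wedges xs \<in> alt (length xs)"
  by (induction xs) (auto intro: alt_wdg simp del: alt_Suc_iff alt_0_iff simp: alt_vacuum)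

text \<open>Contraction with a dual vector of the first factor lowers the degree while the other
  factors still annihilate the result, and wedging with that factor undoes the contraction. In
  degree 0 the scalar is the value on the empty list.\<close>

lemma alt_eq_smult_wedges:
  assumes "wedges xs \<noteq> 0" "\<phi> \<in> alt (length xs)" "set xs \<subseteq> ann \<phi>"
  shows "\<exists>c. \<phi> = smult_fun c (wedges xs)"
  using assms
proof (induction xs arbitrary: \<phi>)
  case Nil
  then have "\<phi> xs = smult_fun (\<phi> []) (wedges []) xs" for xs
    by (cases xs) (auto simp: vacuum_def fun_eq_iff pointwise)
  then show ?case
    by blast
next
  case (Cons x xs)
  have nz: "wedges xs \<noteq> 0"
    using Cons.prems by auto
  have "x \<notin> span (set xs)"
    using Cons.prems(1) span_subset_ann_wedges[of xs] by (auto simp: ann_def)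
  then obtain d where d: "B d x = 1" "\<forall>s\<in>set xs. B d s = 0"
    using exists_dual_vector by blast
  have "contr d \<phi> \<in> alt (length xs)"
    using Cons.prems(2) alt_contr by simp
  moreover have "set xs \<subseteq> ann (contr d \<phi>)"
    using Cons.prems(3) d by (auto intro: ann_contr)
  ultimately obtain c where "contr d \<phi> = smult_fun c (wedges xs)"
    using Cons.IH nz by blast
  moreover have "\<phi> = wdg x (contr d \<phi>)"
    using wdg_contr_if_ann[of x \<phi> d] Cons.prems(3) d by simp
  ultimately show ?case
    by auto
qed

lemma alt_vanish_on_span:
  assumes "\<phi> \<in> alt k"
    and "\<And>xs. set xs \<subseteq> S \<Longrightarrow> length xs = k \<Longrightarrow> \<phi> xs = 0"
    and "span S = UNIV"
  shows "\<phi> = 0"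
  using assms(1,2)
proof (induction k arbitrary: \<phi>)
  case 0
  then have "\<phi> xs = 0" for xs
    by (cases xs) (auto simp: fun_eq_iff pointwise)
  then show ?case
    by (simp add: fun_eq_iff pointwise)
next
  case (Suc k)
  have "contr x \<phi> = 0" for x
  proof -
    have "x \<in> span S"
      using assms(3) by simp
    then show ?thesis
    proof (induction rule: span_induct_alt)
      case base
      then show ?case
        using Suc.prems(1) by (rule alt_contr_zero)
    next
      case (step c x y)
      have "contr x \<phi> = 0"
      proof (rule Suc.IH)
        show "contr x \<phi> \<in> alt k"
          using Suc.prems(1) by (rule alt_contr)
        show "contr x \<phi> xs = 0" if "set xs \<subseteq> S" "length xs = k" for xs
          using Suc.prems(2)[of "x # xs"] step(1) that by (simp add: contr_apply)
      qed
      then show ?case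
        using step(2) by (simp add: alt_contr_add[OF Suc.prems(1)] alt_contr_scale[OF Suc.prems(1)])
    qed
  qed
  then have "\<phi> xs = 0" for xs
    using Suc.prems(1) by (cases xs) (auto simp: fun_eq_iff pointwise)
  then show ?case
    by (simp add: fun_eq_iff pointwise)
qed

text \<open>The factor \<open>s\<close> is a sign. It is left unspecified because the lemma only
  serves to show that values vanish.\<close>

lemma alt_move_to_front:
  "\<phi> \<in> alt k \<Longrightarrow> x \<in> set xs \<Longrightarrow> \<exists>s. \<phi> xs = s * \<phi> (x # remove1 x xs)"
proof (induction xs arbitrary: \<phi> k)
  case (Cons y ys)
  show ?case
  proof (cases "x = y")
    case True
    then show ?thesis
      by (auto intro!: exI[of _ 1])
  next
    case False
    have "contr y \<phi> \<in> alt (k - 1)"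
      using Cons.prems(1) by (cases k) auto
    then obtain s where "contr y \<phi> ys = s * contr y \<phi> (x # remove1 x ys)"
      using Cons False by (metis set_ConsD)
    moreover have "contr x (contr y \<phi>) (remove1 x ys) = - contr y (contr x \<phi>) (remove1 x ys)"
      by (simp only: alt_contr_anticommute[OF Cons.prems(1), of x y] fun_Compl_def)
    ultimately have "\<phi> (y # ys) = - s * \<phi> (x # y # remove1 x ys)"
      by (simp add: pointwise)
    then show ?thesis
      using False by (auto intro: exI[of _ "- s"])
  qed
qed simp

lemma alt_not_distinct:
  "\<phi> \<in> alt k \<Longrightarrow> \<not> distinct xs \<Longrightarrow> \<phi> xs = 0"
proof (induction xs arbitrary: \<phi> k)
  case (Cons y ys)
  have alt': "contr y \<phi> \<in> alt (k - 1)"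
    using Cons.prems(1) by (cases k) auto
  show ?case
  proof (cases "y \<in> set ys")
    case True
    then obtain s where "contr y \<phi> ys = s * contr y \<phi> (y # remove1 y ys)"
      using alt_move_to_front[OF alt'] by blast
    moreover have "contr y (contr y \<phi>) (remove1 y ys) = 0"
      using alt_contr_self[OF Cons.prems(1), of y] by (simp add: zero_fun_apply)
    ultimately show ?thesis
      by (simp add: contr_apply)
  next
    case False
    then show ?thesis
      using Cons.IH[OF alt'] Cons.prems by (auto simp: contr_apply)
  qed
qed simp


subsection \<open>The operators for isotropic vectors\<close>

definition act :: "'v \<Rightarrow> ('v list \<Rightarrow> 'k) \<Rightarrow> 'v list \<Rightarrow> 'k" where
  "act v \<phi> = wdg v (contr v \<phi>)"

lemma act_linear [simp]:
  "act v (\<phi> + \<psi>) = act v \<phi> + act v \<psi>"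
  "act v (\<phi> - \<psi>) = act v \<phi> - act v \<psi>"
  "act v (smult_fun c \<phi>) = smult_fun c (act v \<phi>)"
  "act v 0 = 0"
  by (simp_all add: act_def)

lemma act_zero_left [simp]: "act 0 \<phi> = 0"
  by (simp add: act_def)

text \<open>As a function of the vector, \<open>act\<close> is quadratic; the last summand is its
  polarisation.\<close>

lemma act_add_left:
  assumes "\<phi> \<in> alt k"
  shows "act (a + b) \<phi> = act a \<phi> + act b \<phi> + (wdg a (contr b \<phi>) + wdg b (contr a \<phi>))"
  using alt_contr_add[OF assms] by (simp add: act_def algebra_simps)

lemma act_scale_left:
  assumes "\<phi> \<in> alt k"
  shows "act (scale c a) \<phi> = smult_fun (c * c) (act a \<phi>)"
  using alt_contr_scale[OF assms] by (simp add: act_def)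

lemma alt_act:
  assumes "\<phi> \<in> alt k"
  shows "act v \<phi> \<in> alt k"
proof (cases k)
  case 0
  then have "contr v \<phi> = 0"
    using assms by simp
  then show ?thesis
    by (simp add: act_def)
next
  case (Suc n)
  then show ?thesis
    using assms alt_wdg[OF alt_contr, of \<phi> n v v] by (simp add: act_def del: alt_Suc_iff)
qed

text \<open>Since \<open>B a b = 0\<close>, wedging and contracting with \<open>a\<close>
  anticommute with wedging and contracting with \<open>b\<close>, so the products of two such
  operators commute.\<close>

lemma act_commute:
  assumes "\<phi> \<in> alt k" "B a b = 0"
  shows "act a (act b \<phi>) = act b (act a \<phi>)"
  using assms(2) wdg_anticommute[of a b] alt_contr_anticommute[OF assms(1), of a b]
  by (simp add: act_def contr_wdg B_commute[of b a])

lemma ann_act_self: "v \<in> ann (act v \<phi>)"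
  by (simp add: ann_def act_def)

lemma ann_act: "x \<in> ann \<phi> \<Longrightarrow> B x v = 0 \<Longrightarrow> x \<in> ann (act v \<phi>)"
  unfolding act_def by (intro ann_wdg ann_contr) (auto simp: B_commute)

lemma act_eq_0_if_ann: "v \<in> ann \<phi> \<Longrightarrow> B v v = 0 \<Longrightarrow> act v \<phi> = 0"
  by (simp add: act_def wdg_contr_if_ann)

text \<open>For a product of pairwise orthogonal vectors this contains their span. The condition on
  the contraction carries the orthogonality along, so that later arguments do not depend on
  \<open>\<phi>\<close> being a product.\<close>

definition iso_ann :: "('v list \<Rightarrow> 'k) \<Rightarrow> 'v set" where
  "iso_ann \<phi> = {x. x \<in> ann \<phi> \<and> contr x \<phi> = 0}"

lemma subspace_iso_ann:
  assumes "\<phi> \<in> alt k"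
  shows "subspace (iso_ann \<phi>)"
  using subspace_ann[of \<phi>] alt_contr_zero[OF assms] alt_contr_add[OF assms]
    alt_contr_scale[OF assms]
  by (auto simp: subspace_def iso_ann_def)

lemma iso_ann_act:
  assumes "\<phi> \<in> alt k" "x \<in> iso_ann \<phi>" "B x v = 0"
  shows "x \<in> iso_ann (act v \<phi>)"
  using assms ann_act[of x \<phi> v] alt_contr_anticommute[OF assms(1), of x v]
  by (simp add: iso_ann_def act_def contr_wdg)

text \<open>Contracting \<open>act v \<phi>\<close> with \<open>x\<close> leaves
  \<open>B x v\<close> times \<open>contr v \<phi>\<close>, and wedging that with \<open>x\<close>
  leads back to a nonzero multiple of \<open>\<phi>\<close>.\<close>

lemma act_nonzero:
  assumes "\<phi> \<in> alt k" "\<phi> \<noteq> 0" "x \<in> iso_ann \<phi>" "B x v \<noteq> 0"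
  shows "act v \<phi> \<noteq> 0"
proof
  assume "act v \<phi> = 0"
  then have "contr x (act v \<phi>) = 0"
    by simp
  then have "smult_fun (B x v) (contr v \<phi>) = 0"
    using alt_contr_anticommute[OF assms(1), of x v] assms(3)
    by (simp add: act_def contr_wdg iso_ann_def)
  then have "contr v \<phi> = 0"
    using assms(4) by (simp add: smult_fun_eq_0_iff)
  then have "smult_fun (B v x) \<phi> = 0"
    using wdg_contr_if_ann[of x \<phi> v] assms(3) by (simp add: iso_ann_def)
  then show False
    using assms by (simp add: smult_fun_eq_0_iff B_commute)
qed

text \<open>The isotropic Grassmann cone in the function model. For \<open>k > 0\<close> it contains
  0, as the factors may be dependent, and the annihilator describes a subspace of dimension
  \<open>k\<close> only for nonzero elements.\<close>

definition pure_isotropic :: "nat \<Rightarrow> ('v list \<Rightarrow> 'k) \<Rightarrow> bool" where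
  "pure_isotropic k \<phi> \<longleftrightarrow>
     (\<exists>ys. length ys = k \<and> (\<forall>x\<in>set ys. \<forall>y\<in>set ys. B x y = 0) \<and> \<phi> = wedges ys)"

lemma pure_isotropic_ann:
  assumes "pure_isotropic k \<phi>" "\<phi> \<noteq> 0" "x \<in> ann \<phi>" "y \<in> ann \<phi>"
  shows "B x y = 0"
proof -
  obtain ys where ys: "\<forall>x\<in>set ys. \<forall>y\<in>set ys. B x y = 0" "\<phi> = wedges ys"
    using assms(1) by (auto simp: pure_isotropic_def)
  then show ?thesis
    using assms ann_wedges B_span_span[of "set ys" "set ys" x y] by auto
qed

lemma pure_isotropic_exists_ann:
  assumes "pure_isotropic k \<phi>" "contr v \<phi> \<noteq> 0"
  shows "\<exists>z\<in>ann \<phi>. B v z = 1"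
proof -
  obtain ys where ys: "\<phi> = wedges ys"
    using assms(1) by (auto simp: pure_isotropic_def)
  then obtain y where y: "y \<in> set ys" "B v y \<noteq> 0"
    using assms(2) contr_wedges_perp by blast
  then have "scale (1 / B v y) y \<in> ann \<phi>"
    using ys set_subset_ann_wedges subspace_ann subspace_scale by blast
  then show ?thesis
    using y by (intro bexI[of _ "scale (1 / B v y) y"]) auto
qed

text \<open>A vector outside the span of \<open>v\<close> and the factors of \<open>\<phi>\<close>
  is detected by some \<open>d\<close> orthogonal to all of these, and contraction with
  \<open>d\<close> kills \<open>act v \<phi>\<close>. The lemma leads back from
  \<open>act a (act v \<omega>)\<close> to \<open>act v \<omega>\<close>, at the price of an unknown
  multiple of \<open>a\<close>.\<close>

lemma pure_isotropic_ann_act: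
  assumes "pure_isotropic k \<phi>" "act v \<phi> \<noteq> 0" "x \<in> ann (act v \<phi>)"
  shows "\<exists>c. x - scale c v \<in> ann \<phi>"
proof -
  obtain ys where ys: "\<phi> = wedges ys"
    using assms(1) by (auto simp: pure_isotropic_def)
  have "x \<in> span (insert v (set ys))"
  proof (rule ccontr)
    assume "x \<notin> span (insert v (set ys))"
    then obtain d where d: "B d x = 1" "B d v = 0" "\<forall>y\<in>set ys. B d y = 0"
      using exists_dual_vector by blast
    have "contr d \<phi> = 0"
      using d contr_wedges_perp ys by blast
    then have "contr d (act v \<phi>) = 0"
      using d alt_contr_anticommute[OF alt_wedges[of ys], of d v] ys by (simp add: act_def contr_wdg)
    then have "act v \<phi> = 0"
      using wdg_contr_if_ann[OF assms(3), of d] d by simp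
    then show False
      using assms(2) by blast
  qed
  then show ?thesis
    using span_subset_ann_wedges[of ys] ys by (auto simp: span_insert)
qed


subsection \<open>Hyperbolic frames\<close>

definition frame :: "nat \<Rightarrow> (nat \<Rightarrow> 'v) \<Rightarrow> (nat \<Rightarrow> 'v) \<Rightarrow> bool" where
  "frame n e f \<longleftrightarrow> (\<forall>i<n. \<forall>j<n. B (e i) (e j) = 0 \<and> B (f i) (f j) = 0 \<and>
     B (e i) (f j) = (if i = j then 1 else 0))"

lemma frameD:
  assumes "frame n e f" "i < n" "j < n"
  shows "B (e i) (e j) = 0" "B (f i) (f j) = 0"
    "B (e i) (f j) = (if i = j then 1 else 0)" "B (f i) (e j) = (if i = j then 1 else 0)"
  using assms B_commute[of "f i" "e j"] by (auto simp: frame_def)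

lemma wedges_frame_nonzero:
  assumes "frame n e f" "distinct js" "set js \<subseteq> {..<n}"
  shows "wedges (map e js) \<noteq> 0"
  using assms(2,3)
proof (induction js)
  case (Cons j js)
  have "wedges (e j # map e js) \<noteq> 0"
    using Cons frameD[OF assms(1)]
    by (intro wedges_nonzero_ConsI[where d = "f j"]) auto
  then show ?case
    by simp
qed (simp add: vacuum_nonzero)

lemma frame_iso_ann:
  assumes "frame n e f" "i < n"
  shows "e i \<in> iso_ann (wedges (map e [0..<n]))"
proof -
  have "e i \<in> ann (wedges (map e [0..<n]))"
    using assms(2) set_subset_ann_wedges[of "map e [0..<n]"] by auto
  moreover have "contr (e i) (wedges (map e [0..<n])) = 0"
    using assms frameD by (intro contr_wedges_perp) auto
  ultimately show ?thesis
    by (simp add: iso_ann_def)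
qed

text \<open>The corrected vectors form a basis of the hyperplane of the span of the
  \<open>e m\<close> that is orthogonal to \<open>v\<close>. Together with \<open>v\<close> they are
  \<open>n\<close> independent vectors annihilating both elements, which leaves a one-dimensional
  space. Independence from \<open>v\<close> is seen by pairing with \<open>e j\<close>.\<close>

lemma frame_act_determined:
  assumes fr: "frame n e f" and j: "j < n" "B v (e j) \<noteq> 0" and v: "v \<in> ann \<phi>" and \<phi>: "\<phi> \<in> alt n"
    and ann: "\<And>m. m < n \<Longrightarrow> m \<noteq> j \<Longrightarrow> e m - scale (B v (e m) / B v (e j)) (e j) \<in> ann \<phi>"
    and \<psi>: "\<psi> \<in> alt n" "v \<in> ann \<psi>" "\<psi> \<noteq> 0"
      "\<And>m. m < n \<Longrightarrow> m \<noteq> j \<Longrightarrow> e m - scale (B v (e m) / B v (e j)) (e j) \<in> ann \<psi>"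
  shows "\<exists>c. \<phi> = smult_fun c \<psi>"
proof -
  define x where "x m = e m - scale (B v (e m) / B v (e j)) (e j)" for m
  define js where "js = filter (\<lambda>m. m \<noteq> j) [0..<n]"
  have js: "distinct js" "set js = {..<n} - {j}"
    by (auto simp: js_def)
  have nz: "wedges (map x ks) \<noteq> 0" if "distinct ks" "set ks \<subseteq> {..<n} - {j}" for ks
    using that
  proof (induction ks)
    case (Cons k ks)
    have dual: "B (f k) (x m) = (if m = k then 1 else 0)" if "m < n" for m
      using frameD[OF fr] j that Cons.prems by (simp add: x_def)
    have "wedges (x k # map x ks) \<noteq> 0"
    proof (rule wedges_nonzero_ConsI[where d = "f k"])
      show "wedges (map x ks) \<noteq> 0"
        using Cons by simp
      show "B (f k) y = 0" if y: "y \<in> set (map x ks)" for y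
      proof -
        obtain m where "m \<in> set ks" "y = x m"
          using y by auto
        moreover from this have "m < n" "m \<noteq> k"
          using Cons.prems by auto
        ultimately show ?thesis
          using dual by simp
      qed
      have "k < n"
        using Cons.prems by simp
      then show "B (f k) (x k) \<noteq> 0"
        by (simp add: dual)
    qed
    then show ?case
      by simp
  qed (simp add: vacuum_nonzero)
  have "wedges (v # map x js) \<noteq> 0"
    using nz[of js] js j frameD[OF fr]
    by (intro wedges_nonzero_ConsI[where d = "e j"]) (auto simp: x_def B_commute)
  moreover have "length (v # map x js) = n"
    using distinct_card[OF js(1)] js(2) j(1) by simp
  ultimately have ex: "\<exists>c. \<chi> = smult_fun c (wedges (v # map x js))"
    if "\<chi> \<in> alt n" "v \<in> ann \<chi>" "\<And>m. m < n \<Longrightarrow> m \<noteq> j \<Longrightarrow> x m \<in> ann \<chi>" for \<chi>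
    using that js by (intro alt_eq_smult_wedges) auto
  obtain c where c: "\<phi> = smult_fun c (wedges (v # map x js))"
    using ex[OF \<phi> v ann[folded x_def]] by blast
  obtain d where d: "\<psi> = smult_fun d (wedges (v # map x js))"
    using ex[OF \<psi>(1,2) \<psi>(4)[folded x_def]] by blast
  have "d \<noteq> 0"
    using d \<psi>(3) by auto
  then have "\<phi> = smult_fun (c / d) \<psi>"
    using c d by simp
  then show ?thesis
    by blast
qed

lemma frame_inj:
  assumes "frame n e f"
  shows "inj_on e {..<n}" "inj_on f {..<n}" "e ` {..<n} \<inter> f ` {..<n} = {}"
proof -
  show "inj_on e {..<n}"
    using frameD[OF assms] by (intro inj_onI) (metis lessThan_iff zero_neq_one)
  show "inj_on f {..<n}"
    using frameD[OF assms] by (intro inj_onI) (metis lessThan_iff zero_neq_one)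
  have "e i \<noteq> f j" if "i < n" "j < n" for i j
    using frameD[OF assms] that by (metis zero_neq_one)
  then show "e ` {..<n} \<inter> f ` {..<n} = {}"
    by auto
qed

lemma frame_card:
  assumes "frame n e f"
  shows "card (e ` {..<n} \<union> f ` {..<n}) = 2 * n"
  using frame_inj[OF assms] by (simp add: card_Un_disjoint card_image)

text \<open>Evaluation at \<open>y # xs\<close> isolates the value in question, since every other
  term has a factor \<open>B a x\<close> with \<open>x\<close> from \<open>xs\<close>.\<close>

lemma act_eq_0_eval:
  assumes "act a \<phi> = 0" "B a y = 1" "\<And>x. x \<in> set xs \<Longrightarrow> B a x = 0"
  shows "\<phi> (a # xs) = 0"
proof -
  have "act a \<phi> (y # xs) = 0"
    using assms(1) by (simp add: zero_fun_apply)
  then show ?thesis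
    using assms(2) wdg_eq_0_if_perp[OF assms(3)] by (simp add: act_def contr_apply)
qed

text \<open>The polarisation of \<open>act\<close> vanishes at \<open>a\<close> and
  \<open>b\<close>. Evaluated at \<open>x # y # xs\<close>, each of its two halves leaves one value,
  with opposite signs.\<close>

lemma act_eq_0_eval2:
  assumes "\<phi> \<in> alt k" "act a \<phi> = 0" "act b \<phi> = 0" "act (a + b) \<phi> = 0"
    and "B a x = 1" "B b x = 0" "B a y = 0" "B b y = 1"
    and "\<And>z. z \<in> set xs \<Longrightarrow> B a z = 0" "\<And>z. z \<in> set xs \<Longrightarrow> B b z = 0"
  shows "\<phi> (b # y # xs) = \<phi> (a # x # xs)"
proof -
  have "(wdg a (contr b \<phi>) + wdg b (contr a \<phi>)) (x # y # xs) = 0"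
    using act_add_left[OF assms(1), of a b] assms(2-4) by (simp add: zero_fun_apply)
  then show ?thesis
    using assms(5-8) wdg_eq_0_if_perp[OF assms(9)] wdg_eq_0_if_perp[OF assms(10)]
    by (simp add: plus_fun_apply contr_apply)
qed

text \<open>On lists of vectors from the frame and \<open>h\<close>, vanishing at the
  \<open>e i\<close> and \<open>f i\<close> forces these to occur in pairs. Among \<open>n\<close>
  distinct entries some pair \<open>i\<close> occurs and some pair \<open>j\<close> does not. The
  vectors \<open>f i + f j\<close> and \<open>e i + f j\<close> exchange pair \<open>i\<close> for
  pair \<open>j\<close> in two ways, so the value is the same for both orders of \<open>e i\<close>
  and \<open>f i\<close>; being alternating, it is 0.\<close>

lemma act_eq_0_imp_zero:
  assumes fr: "frame n e f" and n: "n \<ge> 2" and \<phi>: "\<phi> \<in> alt n"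
    and h: "\<And>i. i < n \<Longrightarrow> B h (e i) = 0 \<and> B h (f i) = 0"
    and span: "span (insert h (e ` {..<n} \<union> f ` {..<n})) = UNIV"
    and act_e: "\<And>i. i < n \<Longrightarrow> act (e i) \<phi> = 0" and act_f: "\<And>i. i < n \<Longrightarrow> act (f i) \<phi> = 0"
    and act_ff: "\<And>i j. i < n \<Longrightarrow> j < n \<Longrightarrow> i \<noteq> j \<Longrightarrow> act (f i + f j) \<phi> = 0"
    and act_ef: "\<And>i j. i < n \<Longrightarrow> j < n \<Longrightarrow> i \<noteq> j \<Longrightarrow> act (e i + f j) \<phi> = 0"
  shows "\<phi> = 0"
proof (rule alt_vanish_on_span[OF \<phi> _ span], rule ccontr)
  define S where "S = insert h (e ` {..<n} \<union> f ` {..<n})"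
  fix xs assume xs: "set xs \<subseteq> insert h (e ` {..<n} \<union> f ` {..<n})" "length xs = n"
    and nz: "\<phi> xs \<noteq> 0"
  note fd = frameD[OF fr]
  have xsS: "set xs \<subseteq> S"
    using xs by (simp add: S_def)
  have dist: "distinct xs"
    using alt_not_distinct[OF \<phi>] nz by blast
  then have card: "card (set xs) = n"
    using distinct_card xs(2) by blast
  have perp_e: "B (e i) y = 0" if "i < n" "y \<in> S" "y \<noteq> f i" for i y
    using that fd h by (auto simp: S_def B_commute[of "e i" h])
  have perp_f: "B (f i) y = 0" if "i < n" "y \<in> S" "y \<noteq> e i" for i y
    using that fd h by (auto simp: S_def B_commute[of "f i" h])
  have f_mem: "f i \<in> set xs" if i: "i < n" "e i \<in> set xs" for i
  proof (rule ccontr)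
    assume nf: "f i \<notin> set xs"
    obtain s where s: "\<phi> xs = s * \<phi> (e i # remove1 (e i) xs)"
      using alt_move_to_front[OF \<phi> i(2)] by blast
    have "\<phi> (e i # remove1 (e i) xs) = 0"
    proof (rule act_eq_0_eval[OF act_e, where y = "f i"])
      show "B (e i) x = 0" if "x \<in> set (remove1 (e i) xs)" for x
        using that set_remove1_subset[of "e i" xs] xsS nf i by (intro perp_e) auto
    qed (use fd i in auto)
    then show False
      using s nz by simp
  qed
  have e_mem: "e i \<in> set xs" if i: "i < n" "f i \<in> set xs" for i
  proof (rule ccontr)
    assume ne: "e i \<notin> set xs"
    obtain s where s: "\<phi> xs = s * \<phi> (f i # remove1 (f i) xs)"
      using alt_move_to_front[OF \<phi> i(2)] by blast
    have "\<phi> (f i # remove1 (f i) xs) = 0"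
    proof (rule act_eq_0_eval[OF act_f, where y = "e i"])
      show "B (f i) x = 0" if "x \<in> set (remove1 (f i) xs)" for x
        using that set_remove1_subset[of "f i" xs] xsS ne i by (intro perp_f) auto
    qed (use fd i in auto)
    then show False
      using s nz by simp
  qed
  have "\<exists>i<n. e i \<in> set xs"
  proof (rule ccontr)
    assume "\<not> (\<exists>i<n. e i \<in> set xs)"
    then have "set xs \<subseteq> {h}"
      using xsS e_mem by (auto simp: S_def)
    then have "card (set xs) \<le> 1"
      using card_mono[of "{h}" "set xs"] by simp
    then show False
      using card n by simp
  qed
  then obtain i where i: "i < n" "e i \<in> set xs"
    by blast
  have "\<exists>j<n. e j \<notin> set xs"
  proof (rule ccontr)
    assume "\<not> (\<exists>j<n. e j \<notin> set xs)"
    then have "e ` {..<n} \<union> f ` {..<n} \<subseteq> set xs"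
      using f_mem by auto
    then have "2 * n \<le> card (set xs)"
      using frame_card[OF fr] card_mono[of "set xs"] by (metis List.finite_set)
    then show False
      using card n by simp
  qed
  then obtain j where j: "j < n" "e j \<notin> set xs" "f j \<notin> set xs"
    using e_mem by blast
  have ij: "i \<noteq> j"
    using i j by blast
  have ef: "e i \<noteq> f i"
    using frame_inj(3)[OF fr] i(1) by blast
  define ys where "ys = remove1 (f i) (remove1 (e i) xs)"
  obtain s where s: "\<phi> xs = s * \<phi> (e i # remove1 (e i) xs)"
    using alt_move_to_front[OF \<phi> i(2)] by blast
  have "contr (e i) \<phi> \<in> alt (n - 1)"
    using \<phi> n by (cases n) auto
  moreover have "f i \<in> set (remove1 (e i) xs)"
    using f_mem[OF i] ef by simp
  ultimately obtain t where "contr (e i) \<phi> (remove1 (e i) xs) = t * contr (e i) \<phi> (f i # ys)"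
    using alt_move_to_front unfolding ys_def by blast
  then have xs_eq: "\<phi> xs = s * t * \<phi> (e i # f i # ys)"
    using s by (simp add: contr_apply)
  have ys: "set ys \<subseteq> S - {e i, f i, e j, f j}"
    using dist xsS j by (auto simp: ys_def)
  have perp: "B (e i) z = 0" "B (f i) z = 0" "B (f j) z = 0" if "z \<in> set ys" for z
    using ys that i(1) j(1) perp_e perp_f by auto
  have "\<phi> (f j # e j # ys) = \<phi> (f i # e i # ys)"
    using act_f act_ff i(1) j(1) ij fd perp by (intro act_eq_0_eval2[OF \<phi>]) auto
  moreover have "\<phi> (f j # e j # ys) = \<phi> (e i # f i # ys)"
    using act_f act_e act_ef i(1) j(1) ij fd perp by (intro act_eq_0_eval2[OF \<phi>]) auto
  moreover have "\<phi> (f i # e i # ys) = - \<phi> (e i # f i # ys)"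
    using fun_cong[OF alt_contr_anticommute[OF \<phi>, of "e i" "f i"], of ys]
    by (simp add: contr_apply fun_Compl_def)
  ultimately have "2 * \<phi> (e i # f i # ys) = 0"
    by (simp only: mult_2) simp
  then show False
    using xs_eq nz two_nonzero by simp
qed


lemma act_act_nonzero:
  assumes "\<phi> \<in> alt k" "\<phi> \<noteq> 0" "x \<in> iso_ann \<phi>" "B x v \<noteq> 0"
    and "y \<in> iso_ann \<phi>" "B y v = 0" "B y w \<noteq> 0"
  shows "act w (act v \<phi>) \<noteq> 0"
  using assms by (intro act_nonzero[where x = y and k = k] alt_act iso_ann_act[where k = k]
      act_nonzero[where x = x and k = k])

lemma contr_act_perp:
  assumes "\<phi> \<in> alt k" "B d v = 0"
  shows "contr d (act v \<phi>) = act v (contr d \<phi>)"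
  using assms alt_contr_anticommute[OF assms(1), of d v] by (simp add: act_def contr_wdg)

text \<open>A dual family \<open>d\<close> already pairs correctly with \<open>xs\<close>.
  Subtracting combinations of the isotropic \<open>xs\<close> keeps these pairings, and
  \<open>f i\<close> and \<open>f k\<close> each contribute one half of \<open>B (d i) (d k)\<close>
  to the cancellation.\<close>

lemma exists_dual_frame:
  assumes "distinct xs" "independent (set xs)" "\<And>x y. x \<in> set xs \<Longrightarrow> y \<in> set xs \<Longrightarrow> B x y = 0"
  shows "\<exists>f. frame (length xs) ((!) xs) f"
proof -
  define n where "n = length xs"
  have "\<exists>d. \<forall>j<n. B d (xs ! j) = (if i = j then 1 else 0)" if "i < n" for i
  proof -
    have "xs ! i \<notin> span (set xs - {xs ! i})"
      using assms(2) that unfolding dependent_def n_def by (metis nth_mem)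
    then obtain d where "B d (xs ! i) = 1" "\<forall>s\<in>set xs - {xs ! i}. B d s = 0"
      using exists_dual_vector by blast
    then show ?thesis
      using assms(1) that unfolding n_def
      by (intro exI[of _ d]) (auto simp: nth_eq_iff_index_eq)
  qed
  then obtain d where d: "\<And>i j. i < n \<Longrightarrow> j < n \<Longrightarrow> B (d i) (xs ! j) = (if i = j then 1 else 0)"
    by metis
  have iso: "B (xs ! i) (xs ! j) = 0" if "i < n" "j < n" for i j
    using assms(3) that by (simp add: n_def)
  define f where "f i = d i - (\<Sum>j<n. scale (B (d i) (d j) / 2) (xs ! j))" for i
  have B_f: "B (xs ! i) (f k) = (if i = k then 1 else 0)" if "i < n" "k < n" for i k
    using that d iso by (simp add: f_def B_sum_right B_commute[of "xs ! i" "d k"])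
  moreover have "B (f i) (f k) = 0" if ik: "i < n" "k < n" for i k
  proof -
    have "B (f i) (f k) = B (d i) (f k) - (\<Sum>j<n. B (d i) (d j) / 2 * B (xs ! j) (f k))"
      by (simp add: f_def[of i] B_sum_left)
    also have "(\<Sum>j<n. B (d i) (d j) / 2 * B (xs ! j) (f k)) = (\<Sum>j<n. if j = k then B (d i) (d k) / 2 else 0)"
      using ik B_f by (intro sum.cong) auto
    also have "\<dots> = B (d i) (d k) / 2"
      using ik by simp
    also have "B (d i) (f k) = B (d i) (d k) - (\<Sum>j<n. if j = i then B (d k) (d i) / 2 else 0)"
    proof -
      have "(\<Sum>j<n. B (d k) (d j) / 2 * B (d i) (xs ! j)) = (\<Sum>j<n. if j = i then B (d k) (d i) / 2 else 0)"
        using ik d by (intro sum.cong) auto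
      then show ?thesis
        by (simp add: f_def B_sum_right)
    qed
    also have "(\<Sum>j<n. if j = i then B (d k) (d i) / 2 else 0) = B (d i) (d k) / 2"
      using ik by (simp add: B_commute)
    finally show ?thesis
      using two_nonzero by (simp add: field_simps)
  qed
  ultimately have "frame n ((!) xs) f"
    using iso by (simp add: frame_def)
  then show ?thesis
    unfolding n_def by blast
qed

text \<open>\<open>P\<close> is the orthogonal projection to the complement of the hyperbolic planes
  indexed by \<open>J\<close>. The index set is arbitrary because the projection is also needed with
  index 0 left out.\<close>

lemma frame_projection:
  assumes "\<And>i j. i \<in> J \<Longrightarrow> j \<in> J \<Longrightarrow> B (e i) (e j) = 0"
    and "\<And>i j. i \<in> J \<Longrightarrow> j \<in> J \<Longrightarrow> B (f i) (f j) = 0"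
    and "\<And>i j. i \<in> J \<Longrightarrow> j \<in> J \<Longrightarrow> B (e i) (f j) = (if i = j then 1 else 0)"
    and "finite J"
  defines "P \<equiv> \<lambda>x. x - (\<Sum>j\<in>J. scale (B x (f j)) (e j) + scale (B x (e j)) (f j))"
  shows "i \<in> J \<Longrightarrow> B (P x) (e i) = 0" "i \<in> J \<Longrightarrow> B (P x) (f i) = 0"
    "(\<And>j. j \<in> J \<Longrightarrow> B (e j) y = 0 \<and> B (f j) y = 0) \<Longrightarrow> B (P x) y = B x y"
proof -
  have fe: "B (f i) (e j) = (if j = i then 1 else 0)" if "i \<in> J" "j \<in> J" for i j
    using assms(3) that B_commute by auto
  have P: "B (P x) y = B x y - (\<Sum>j\<in>J. B x (f j) * B (e j) y + B x (e j) * B (f j) y)" for x y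
    by (simp add: P_def B_sum_left)
  show "B (P x) (e i) = 0" if "i \<in> J"
  proof -
    have "(\<Sum>j\<in>J. B x (f j) * B (e j) (e i) + B x (e j) * B (f j) (e i)) =
        (\<Sum>j\<in>J. if j = i then B x (e i) else 0)"
      using that assms(1) fe by (intro sum.cong) auto
    then show ?thesis
      using that assms(4) by (simp add: P)
  qed
  show "B (P x) (f i) = 0" if "i \<in> J"
  proof -
    have "(\<Sum>j\<in>J. B x (f j) * B (e j) (f i) + B x (e j) * B (f j) (f i)) =
        (\<Sum>j\<in>J. if j = i then B x (f i) else 0)"
      using that assms(2,3) by (intro sum.cong) auto
    then show ?thesis
      using that assms(4) by (simp add: P)
  qed
  show "B (P x) y = B x y" if "\<And>j. j \<in> J \<Longrightarrow> B (e j) y = 0 \<and> B (f j) y = 0"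
    using that by (simp add: P)
qed

text \<open>The frame vectors are independent, and the dimension exceeds their number by at most 1.
  In the odd case \<open>h\<close> is the projection of a vector outside their span; if it were
  isotropic, it would be orthogonal to everything. In the even case \<open>h = 0\<close> keeps the
  statement uniform.\<close>

lemma frame_spans:
  assumes fr: "frame n e f" and dim: "n = dim (UNIV :: 'v set) div 2"
  shows "\<exists>h. (\<forall>i<n. B h (e i) = 0 \<and> B h (f i) = 0) \<and>
    span (insert h (e ` {..<n} \<union> f ` {..<n})) = UNIV \<and> (dim (UNIV :: 'v set) \<noteq> 2 * n \<longrightarrow> B h h \<noteq> 0)"
proof -
  define F where "F = e ` {..<n} \<union> f ` {..<n}"
  note fd = frameD[OF fr]
  have "\<exists>d. B d a \<noteq> 0 \<and> (\<forall>s\<in>F - {a}. B d s = 0)" if a: "a \<in> F" for a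
  proof -
    consider i where "i < n" "a = e i" | i where "i < n" "a = f i"
      using a unfolding F_def by blast
    then show ?thesis
    proof cases
      case 1
      have "B (f i) s = 0" if s: "s \<in> F - {e i}" for s
      proof -
        obtain j where j: "j < n" "s = e j \<or> s = f j" "s \<noteq> e i"
          using s unfolding F_def by blast
        then show ?thesis
          using fd[OF 1(1) j(1)] by (cases "i = j") auto
      qed
      then show ?thesis
        using fd[OF 1(1) 1(1)] 1(2) by (intro exI[of _ "f i"]) auto
    next
      case 2
      have "B (e i) s = 0" if s: "s \<in> F - {f i}" for s
      proof -
        obtain j where j: "j < n" "s = e j \<or> s = f j" "s \<noteq> f i"
          using s unfolding F_def by blast
        then show ?thesis
          using fd[OF 2(1) j(1)] by (cases "i = j") auto
      qed
      then show ?thesis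
        using fd[OF 2(1) 2(1)] 2(2) by (intro exI[of _ "e i"]) auto
    qed
  qed
  then have ind: "independent F"
    by (rule independent_if_dual)
  have card: "card F = 2 * n"
    unfolding F_def by (rule frame_card[OF fr])
  have fin: "finite F"
    by (simp add: F_def)
  show ?thesis
  proof (cases "dim (UNIV :: 'v set) = 2 * n")
    case True
    then have "span F = UNIV"
      using card_ge_dim_independent[of F UNIV] ind card by auto
    then have "span (insert 0 F) = UNIV"
      by (simp add: span_insert_0)
    then show ?thesis
      using True by (intro exI[of _ 0]) (simp add: F_def)
  next
    case False
    then have dim': "dim (UNIV :: 'v set) = Suc (2 * n)"
      using dim by presburger
    have "span F \<noteq> UNIV"
    proof
      assume "span F = UNIV"
      then have "dim (UNIV :: 'v set) = card F"
        using dim_span_eq_card_independent[OF ind] by simp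
      then show False
        using dim' card by simp
    qed
    then obtain x where x: "x \<notin> span F"
      by blast
    define h where "h = x - (\<Sum>j<n. scale (B x (f j)) (e j) + scale (B x (e j)) (f j))"
    have perp: "B h (e i) = 0" "B h (f i) = 0" if "i < n" for i
      using frame_projection(1,2)[of "{..<n}" e f i x] fd that unfolding h_def by auto
    have proj: "(\<Sum>j<n. scale (B x (f j)) (e j) + scale (B x (e j)) (f j)) \<in> span F"
      by (intro span_sum span_add span_scale span_base) (auto simp: F_def)
    have h: "h \<notin> span F"
    proof
      assume "h \<in> span F"
      from span_add[OF this proj] show False
        using x by (simp add: h_def)
    qed
    then have "independent (insert h F)"
      using ind by (rule independent_insertI)
    moreover have "card (insert h F) = Suc (2 * n)"
      using card fin h span_base[of h F] by (subst card_insert_disjoint) auto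
    ultimately have sp: "span (insert h F) = UNIV"
      using card_ge_dim_independent[of "insert h F" UNIV] dim' by auto
    have "B h h \<noteq> 0"
    proof
      assume "B h h = 0"
      then have "B h y = 0" for y
        using B_span_right[of y "insert h F" h] sp perp by (auto simp: F_def)
      then have "h = 0"
        using nondegenerate by (auto simp: nondegenerate_form_def)
      then show False
        using h span_zero by simp
    qed
    then show ?thesis
      using perp sp by (intro exI[of _ h]) (auto simp: F_def)
  qed
qed

end


section \<open>Reconstruction of the isotropic subspace\<close>

text \<open>The hypothesis on \<open>\<Phi>\<^sub>v\<close> in the function model. The list
  \<open>v # ys\<close> may be dependent, which covers the case
  \<open>act v \<omega> = 0\<close>.\<close>

locale isotropic_actions = bilinear_space scale Basis B
  for scale :: "'k::field \<Rightarrow> 'v::ab_group_add \<Rightarrow> 'v" and Basis :: "'v set"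
    and B :: "'v \<Rightarrow> 'v \<Rightarrow> 'k" +
  fixes p :: nat and \<omega> :: "'v list \<Rightarrow> 'k"
  assumes alt_\<omega>: "\<omega> \<in> alt p"
    and act_\<omega>: "\<And>v. v \<noteq> 0 \<Longrightarrow> B v v = 0 \<Longrightarrow> \<exists>ys. length (v # ys) = p \<and>
      (\<forall>x\<in>set (v # ys). \<forall>y\<in>set (v # ys). B x y = 0) \<and> act v \<omega> = wedges (v # ys)"
begin

lemma pure_act:
  assumes "v \<noteq> 0" "B v v = 0"
  shows "pure_isotropic p (act v \<omega>)"
  unfolding pure_isotropic_def using act_\<omega>[OF assms] by blast

lemma ann_act_isotropic:
  assumes "B v v = 0" "act v \<omega> \<noteq> 0" "x \<in> ann (act v \<omega>)" "y \<in> ann (act v \<omega>)"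
  shows "B x y = 0"
  using assms pure_isotropic_ann[OF pure_act] by (metis act_zero_left)

section \<open>Transfer of annihilators between orthogonal vectors\<close>

text \<open>From here on, \<open>\<phi>\<close> is the candidate for \<open>\<omega>\<close>: from vectors \<open>a\<close> with
  \<open>act a \<omega> = act a \<phi>\<close>, information is transferred to further vectors \<open>v\<close>.\<close>

lemma act_act_agree:
  assumes "\<phi> \<in> alt p" "act a \<omega> = act a \<phi>" "B a v = 0"
  shows "act a (act v \<omega>) = act a (act v \<phi>)"
  using act_commute[OF alt_\<omega> assms(3)] act_commute[OF assms(1,3)] assms(2) by simp

text \<open>\<open>x\<close> annihilates \<open>act a (act v \<phi>)\<close>, which equals
  \<open>act a (act v \<omega>)\<close>; stripping off \<open>act a\<close> costs the multiple of
  \<open>a\<close>.\<close>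

lemma ann_modulo:
  assumes "\<phi> \<in> alt p" "B v v = 0" "act a \<omega> = act a \<phi>" "B a v = 0" "act a (act v \<phi>) \<noteq> 0"
    and "x \<in> iso_ann \<phi>" "B x a = 0" "B x v = 0"
  shows "\<exists>c. x - scale c a \<in> ann (act v \<omega>)"
proof (rule pure_isotropic_ann_act)
  have eq: "act a (act v \<omega>) = act a (act v \<phi>)"
    using assms act_act_agree by blast
  then show "act a (act v \<omega>) \<noteq> 0"
    using assms by simp
  then have "v \<noteq> 0"
    by auto
  then show "pure_isotropic p (act v \<omega>)"
    using assms(2) by (rule pure_act)
  show "x \<in> ann (act a (act v \<omega>))"
    unfolding eq using assms by (intro ann_act) (auto simp: iso_ann_def)
qed

text \<open>After applying \<open>act b\<close>, both \<open>x\<close> and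
  \<open>x - scale c a\<close> annihilate \<open>\<psi>\<close>, hence so does
  \<open>scale c a\<close>; but an isotropic \<open>a\<close> annihilating \<open>\<psi>\<close>
  would give \<open>act a \<psi> = 0\<close>. The vectors \<open>y1\<close>, \<open>y2\<close>,
  \<open>y3\<close> certify that nothing vanishes when \<open>v\<close>, \<open>b\<close>,
  \<open>a\<close> are applied in this order: each pairs with its own vector and is orthogonal to
  the earlier ones.\<close>

lemma ann_if_orthogonal_pair:
  assumes \<phi>: "\<phi> \<in> alt p" "\<phi> \<noteq> 0" and v: "B v v = 0"
    and agree: "act a \<omega> = act a \<phi>" "act b \<omega> = act b \<phi>"
    and perp: "B a a = 0" "B a v = 0" "B b v = 0" "B a b = 0"
    and y: "y1 \<in> iso_ann \<phi>" "B y1 v \<noteq> 0" "y2 \<in> iso_ann \<phi>" "B y2 v = 0" "B y2 b \<noteq> 0"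
      "y3 \<in> iso_ann \<phi>" "B y3 v = 0" "B y3 b = 0" "B y3 a \<noteq> 0"
    and x: "x \<in> iso_ann \<phi>" "B x a = 0" "B x b = 0" "B x v = 0"
  shows "x \<in> ann (act v \<omega>)"
proof -
  define \<psi> where "\<psi> = act b (act v \<phi>)"
  have \<psi>: "\<psi> = act b (act v \<omega>)"
    unfolding \<psi>_def using act_act_agree[OF \<phi>(1) agree(2) perp(3)] by simp
  have "\<psi> \<noteq> 0"
    unfolding \<psi>_def using act_act_nonzero[OF \<phi> y(1-5)] .
  moreover have "\<psi> \<in> alt p"
    unfolding \<psi>_def using \<phi> by (intro alt_act)
  moreover have "y3 \<in> iso_ann \<psi>"
    unfolding \<psi>_def using \<phi> y by (intro iso_ann_act[where k = p] alt_act)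
  ultimately have nz: "act a \<psi> \<noteq> 0"
    using y(9) act_nonzero by blast
  have "act a \<psi> = act b (act a (act v \<phi>))"
    unfolding \<psi>_def by (intro act_commute[OF alt_act[OF \<phi>(1)] perp(4)])
  then have "act a (act v \<phi>) \<noteq> 0"
    using nz by auto
  then obtain c where c: "x - scale c a \<in> ann (act v \<omega>)"
    using ann_modulo[OF \<phi>(1) v agree(1) perp(2)] x by blast
  have "x - scale c a \<in> ann \<psi>"
    unfolding \<psi> using x(3) perp(4) by (auto intro: ann_act[OF c])
  moreover have "x \<in> ann \<psi>"
    unfolding \<psi>_def using x by (intro ann_act) (auto simp: iso_ann_def)
  ultimately have "scale c a \<in> ann \<psi>"
    using subspace_diff[OF subspace_ann, of x \<psi> "x - scale c a"] by simp
  then have "c = 0"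
    using act_eq_0_if_ann[of a \<psi>] nz perp(1) subspace_scale[OF subspace_ann, of "scale c a" \<psi> "1 / c"]
    by (cases "c = 0") auto
  then show ?thesis
    using c by simp
qed

text \<open>Here isotropy removes the ambiguity: \<open>x - scale r a\<close> and
  \<open>x - scale s b\<close> lie in one isotropic subspace, and their pairing is
  \<open>r * s * B a b\<close>.\<close>

lemma ann_if_hyperbolic_pair:
  assumes \<phi>: "\<phi> \<in> alt p" "\<phi> \<noteq> 0" and v: "B v v = 0"
    and agree: "act a \<omega> = act a \<phi>" "act b \<omega> = act b \<phi>"
    and perp: "B a v = 0" "B b v = 0" "B a b \<noteq> 0"
    and y: "y1 \<in> iso_ann \<phi>" "B y1 v \<noteq> 0" "y2 \<in> iso_ann \<phi>" "B y2 v = 0" "B y2 a \<noteq> 0" "B y2 b \<noteq> 0"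
    and x: "x \<in> iso_ann \<phi>" "B x a = 0" "B x b = 0" "B x v = 0" "B x x = 0"
  shows "x \<in> ann (act v \<omega>)"
proof -
  have nz: "act a (act v \<phi>) \<noteq> 0" "act b (act v \<phi>) \<noteq> 0"
    using act_act_nonzero[OF \<phi> y(1-4)] y by auto
  obtain r where r: "x - scale r a \<in> ann (act v \<omega>)"
    using ann_modulo[OF \<phi>(1) v agree(1) perp(1) nz(1)] x by blast
  obtain s where s: "x - scale s b \<in> ann (act v \<omega>)"
    using ann_modulo[OF \<phi>(1) v agree(2) perp(2) nz(2)] x by blast
  have "act v \<omega> \<noteq> 0"
    using act_act_agree[OF \<phi>(1) agree(1) perp(1)] nz(1) by auto
  then have "B (x - scale r a) (x - scale s b) = 0"
    using ann_act_isotropic[OF v] r s by blast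
  then have "r = 0 \<or> s = 0"
    using x perp by (auto simp: B_commute[of a x])
  then show ?thesis
    using r s by auto
qed

text \<open>The annihilating vectors determine \<open>act v \<omega>\<close> up to a scalar.
  Applying \<open>act a\<close> shows that the scalar is 1, because both sides then agree and are
  nonzero.\<close>

lemma frame_agree_if_ann:
  assumes fr: "frame p e f" and v: "B v v = 0" and j: "j < p" "B v (e j) \<noteq> 0"
    and a: "act a \<omega> = act a (wedges (map e [0..<p]))" "B a v = 0"
      "act a (act v (wedges (map e [0..<p]))) \<noteq> 0"
    and ann: "\<And>m. m < p \<Longrightarrow> m \<noteq> j \<Longrightarrow>
      e m - scale (B v (e m) / B v (e j)) (e j) \<in> ann (act v \<omega>)"
  shows "act v \<omega> = act v (wedges (map e [0..<p]))"
proof -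
  let ?\<phi> = "wedges (map e [0..<p])"
  have \<phi>: "?\<phi> \<in> alt p"
    using alt_wedges[of "map e [0..<p]"] by simp
  have "e m - scale (B v (e m) / B v (e j)) (e j) \<in> ann (act v ?\<phi>)" if "m < p" for m
  proof (rule ann_act)
    show "e m - scale (B v (e m) / B v (e j)) (e j) \<in> ann ?\<phi>"
      using frame_iso_ann[OF fr] that j(1) subspace_ann
      by (intro subspace_diff subspace_scale) (auto simp: iso_ann_def)
  qed (use j in \<open>simp add: B_commute[of _ v]\<close>)
  then obtain c where c: "act v \<omega> = smult_fun c (act v ?\<phi>)"
    using frame_act_determined[OF fr j ann_act_self alt_act[OF alt_\<omega>] ann alt_act[OF \<phi>] ann_act_self] a(3)
    by (metis act_linear(4))
  then have "act a (act v ?\<phi>) = smult_fun c (act a (act v ?\<phi>))"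
    using act_act_agree[OF \<phi> a(1,2)] by simp
  then have "smult_fun (c - 1) (act a (act v ?\<phi>)) = 0"
    by (simp add: fun_eq_iff pointwise left_diff_distrib)
  then have "c = 1"
    using a(3) by (simp add: smult_fun_eq_0_iff)
  then show ?thesis
    using c by simp
qed


section \<open>Correction of the frame at the vectors \<open>f i\<close>\<close>

lemma frame_act_f0:
  assumes "frame n e f" "0 < n"
  shows "act (f 0) (wedges (map e [0..<n])) = wdg (f 0) (wedges (map e [1..<n]))"
proof -
  have "contr (f 0) (wedges (map e [1..<n])) = 0"
    using frameD[OF assms(1)] assms(2) by (intro contr_wedges_perp) auto
  then show ?thesis
    using frameD[OF assms(1), of 0 0] assms(2)
    by (simp add: upt_conv_Cons act_def contr_wdg)
qed

text \<open>\<open>act (f 0) \<omega>\<close> determines the \<open>e j\<close> with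
  \<open>j > 0\<close> only modulo \<open>f 0\<close>, and does not determine \<open>e 0\<close>.
  Both are corrected by means of the elements \<open>act (f i) \<omega>\<close> with
  \<open>i > 0\<close>; the point is that different \<open>i\<close> yield the same
  corrections.\<close>

lemma exists_adapted_frame:
  assumes fr: "frame p e f" and p: "p \<ge> 4"
    and base: "act (f 0) \<omega> = wdg (f 0) (wedges (map e [1..<p]))"
  shows "\<exists>e'. frame p e' f \<and> (\<forall>i<p. act (f i) \<omega> = act (f i) (wedges (map e' [0..<p])))"
proof -
  define \<phi> where "\<phi> = wedges (map e [0..<p])"
  note fd = frameD[OF fr]
  have alt_\<phi>: "\<phi> \<in> alt p"
    using alt_wedges[of "map e [0..<p]"] by (simp add: \<phi>_def)
  have \<phi>_nz: "\<phi> \<noteq> 0"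
    unfolding \<phi>_def by (rule wedges_frame_nonzero[OF fr]) auto
  have e_iso: "e i \<in> iso_ann \<phi>" if "i < p" for i
    unfolding \<phi>_def using fr that by (rule frame_iso_ann)
  have agree0: "act (f 0) \<omega> = act (f 0) \<phi>"
    using frame_act_f0[OF fr] p base by (simp add: \<phi>_def)
  have nz: "act (f 0) (act (f i) \<phi>) \<noteq> 0" if "0 < i" "i < p" for i
    by (rule act_act_nonzero[OF alt_\<phi> \<phi>_nz e_iso[of i] _ e_iso[of 0]]) (use that fd in auto)
  have eq: "act (f 0) (act (f i) \<omega>) = act (f 0) (act (f i) \<phi>)" if "0 < i" "i < p" for i
    using act_act_agree[OF alt_\<phi> agree0] fd that by simp
  have nz\<omega>: "act (f i) \<omega> \<noteq> 0" if "0 < i" "i < p" for i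
    using nz[OF that] eq[OF that] by (metis act_linear(4))
  have "\<exists>c. e j - scale c (f 0) \<in> ann (act (f i) \<omega>)"
    if "0 < i" "i < p" "0 < j" "j < p" "i \<noteq> j" for i j
    by (rule ann_modulo[OF alt_\<phi> _ agree0 _ nz e_iso]) (use that fd in auto)
  then obtain C where C: "\<And>i j. 0 < i \<Longrightarrow> i < p \<Longrightarrow> 0 < j \<Longrightarrow> j < p \<Longrightarrow> i \<noteq> j \<Longrightarrow>
      e j - scale (C i j) (f 0) \<in> ann (act (f i) \<omega>)"
    by metis
  define \<psi> where "\<psi> i k = act (f k) (act (f i) \<omega>)" for i k
  have \<psi>_sym: "\<psi> i k = \<psi> k i" if "0 < i" "i < p" "0 < k" "k < p" for i k
    unfolding \<psi>_def using fd that by (intro act_commute[OF alt_\<omega>]) auto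
  have act\<psi>: "act (f 0) (\<psi> i k) = act (f k) (act (f i) (act (f 0) \<omega>))"
    if "0 < i" "i < p" "0 < k" "k < p" for i k
    using that fd act_commute[OF alt_act[OF alt_\<omega>], of "f 0" "f k" "f i"]
      act_commute[OF alt_\<omega>, of "f 0" "f i"] by (simp add: \<psi>_def)
  have nz3: "act (f 0) (\<psi> i k) \<noteq> 0" if ik: "0 < i" "i < p" "0 < k" "k < p" "i \<noteq> k" for i k
  proof -
    have "e k \<in> iso_ann (act (f 0) \<phi>)" "e i \<in> iso_ann (act (f 0) \<phi>)"
      using fd ik by (auto intro!: iso_ann_act[OF alt_\<phi> e_iso])
    moreover have "act (f 0) \<phi> \<noteq> 0"
      by (rule act_nonzero[OF alt_\<phi> \<phi>_nz e_iso[of 0]]) (use fd ik in auto)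
    ultimately have "act (f k) (act (f i) (act (f 0) \<phi>)) \<noteq> 0"
      using fd ik by (intro act_act_nonzero[OF alt_act[OF alt_\<phi>], of "f 0" "e i" _ "e k"]) auto
    then show ?thesis
      using act\<psi> ik agree0 by simp
  qed
  txt \<open>If \<open>C i j\<close> depended on \<open>i\<close>, then \<open>f 0\<close> would annihilate \<open>\<psi> i k\<close>.\<close>
  have C_indep: "C i j = C k j"
    if "0 < i" "i < p" "0 < k" "k < p" "0 < j" "j < p" "i \<noteq> k" "i \<noteq> j" "k \<noteq> j" for i j k
  proof (rule ccontr)
    assume ne: "C i j \<noteq> C k j"
    have "e j - scale (C i j) (f 0) \<in> ann (\<psi> i k)"
      unfolding \<psi>_def using fd that by (intro ann_act[OF C]) auto
    moreover have "e j - scale (C k j) (f 0) \<in> ann (\<psi> k i)"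
      unfolding \<psi>_def using fd that by (intro ann_act[OF C]) auto
    ultimately have "(e j - scale (C i j) (f 0)) - (e j - scale (C k j) (f 0)) \<in> ann (\<psi> i k)"
      using \<psi>_sym that subspace_diff[OF subspace_ann] by metis
    then have "scale (C k j - C i j) (f 0) \<in> ann (\<psi> i k)"
      by (simp add: scale_left_diff_distrib)
    then have "f 0 \<in> ann (\<psi> i k)"
      using ne subspace_scale[OF subspace_ann, of "scale (C k j - C i j) (f 0)" _ "1 / (C k j - C i j)"]
      by simp
    then show False
      using nz3[of i k] that act_eq_0_if_ann[of "f 0" "\<psi> i k"] fd[of 0 0] by simp
  qed
  \<comment> \<open>Any positive first index other than \<open>j\<close> gives the same value; 1 is
    chosen unless \<open>j = 1\<close>.\<close>
  define g where "g j = C (if j = 1 then 2 else 1) j" for j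
  have g: "C i j = g j" if "0 < i" "i < p" "0 < j" "j < p" "i \<noteq> j" for i j
    using C_indep[of i "if j = 1 then 2 else 1" j] that p unfolding g_def
    by (cases "i = (if j = 1 then 2 else 1)") (auto split: if_splits)
  define e1 where "e1 j = e j - scale (g j) (f 0)" for j
  have e1_ann: "e1 j \<in> ann (act (f i) \<omega>)" if "0 < i" "i < p" "0 < j" "j < p" "i \<noteq> j" for i j
    using C g that by (simp add: e1_def)
  have e1_e1: "B (e1 i) (e1 j) = 0" if "0 < i" "i < p" "0 < j" "j < p" for i j
    using that fd by (auto simp: e1_def)
  have e1_f: "B (e1 i) (f k) = (if i = k then 1 else 0)" if "0 < i" "i < p" "k < p" for i k
    using that fd by (auto simp: e1_def)
  note e1 = e1_e1 e1_f
  txt \<open>The remaining direction \<open>z i\<close> of \<open>ann (act (f i) \<omega>)\<close>, made orthogonal to the other frame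
    vectors, is independent of \<open>i\<close> and becomes the new \<open>e 0\<close>.\<close>
  define J where "J = {0<..<p}"
  define P where "P x = x - (\<Sum>j\<in>J. scale (B x (f j)) (e1 j) + scale (B x (e1 j)) (f j))" for x
  have P: "i \<in> J \<Longrightarrow> B (P x) (e1 i) = 0" "i \<in> J \<Longrightarrow> B (P x) (f i) = 0"
    "(\<And>j. j \<in> J \<Longrightarrow> B (e1 j) y = 0 \<and> B (f j) y = 0) \<Longrightarrow> B (P x) y = B x y" for x y i
    unfolding P_def
    by (rule frame_projection; use fd e1 in \<open>auto simp: J_def\<close>)+
  have "\<exists>z. z \<in> ann (act (f i) \<omega>) \<and> B z (f 0) = 1 \<and>
      (\<forall>j\<in>J. B z (e1 j) = 0 \<and> B z (f j) = 0)" if i: "i \<in> J" for i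
  proof -
    have ip: "0 < i" "i < p"
      using i by (auto simp: J_def)
    have fi: "f i \<noteq> 0"
      using nz\<omega>[OF ip] by auto
    have "act (f 0) (act (f i) \<omega>) \<noteq> 0"
      using eq nz ip by simp
    then have "contr (f 0) (act (f i) \<omega>) \<noteq> 0"
      by (auto simp: act_def)
    then obtain y where y: "y \<in> ann (act (f i) \<omega>)" "B (f 0) y = 1"
      using pure_isotropic_exists_ann[OF pure_act[OF fi]] fd ip by metis
    have iso: "B y x = 0" if "x \<in> ann (act (f i) \<omega>)" for x
      using ann_act_isotropic[OF _ nz\<omega>[OF ip] y(1) that] fd ip by simp
    \<comment> \<open>In each summand of the projection one term lies in the annihilator and the
      other has coefficient 0 by isotropy: for \<open>j = i\<close> it contains \<open>f i\<close>,
      otherwise it contains \<open>e1 j\<close>.\<close>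
    have "scale (B y (f j)) (e1 j) + scale (B y (e1 j)) (f j) \<in> ann (act (f i) \<omega>)" if "j \<in> J" for j
    proof (cases "j = i")
      case True
      then show ?thesis
        using iso[OF ann_act_self] subspace_scale[OF subspace_ann ann_act_self] by simp
    next
      case False
      then have "e1 j \<in> ann (act (f i) \<omega>)"
        using e1_ann ip that by (simp add: J_def)
      then show ?thesis
        using iso subspace_scale[OF subspace_ann] by simp
    qed
    then have "P y \<in> ann (act (f i) \<omega>)"
      unfolding P_def using y(1) by (intro subspace_diff[OF subspace_ann] subspace_sum[OF subspace_ann])
    moreover have "B (P y) (f 0) = 1"
      using P(3)[of "f 0" y] y(2) e1 fd p by (auto simp: J_def B_commute)
    ultimately show ?thesis
      using P(1,2) by (intro exI[of _ "P y"]) simp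
  qed
  then obtain z where z: "\<And>i. i \<in> J \<Longrightarrow> z i \<in> ann (act (f i) \<omega>)" "\<And>i. i \<in> J \<Longrightarrow> B (z i) (f 0) = 1"
    and z_perp: "\<And>i j. i \<in> J \<Longrightarrow> j \<in> J \<Longrightarrow> B (z i) (e1 j) = 0 \<and> B (z i) (f j) = 0"
    by metis
  have z_iso: "B (z i) (z i) = 0" if "i \<in> J" for i
    using ann_act_isotropic[of "f i"] z(1)[OF that] nz\<omega> fd that by (simp add: J_def)
  have W1: "act (f 0) \<omega> = wdg (f 0) (wedges (map e1 [1..<p]))"
    unfolding base
  proof (rule wdg_wedges_cong)
    show "list_all2 (\<lambda>x y. \<exists>c. x - y = scale c (f 0)) (map e [1..<p]) (map e1 [1..<p])"
      by (auto simp: list_all2_conv_all_nth e1_def)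
  qed
  have z_eq: "z i = z k" if ik: "i \<in> J" "k \<in> J" "i \<noteq> k" for i k
  proof -
    define y where "y = z i - z k"
    define \<Omega> where "\<Omega> = act (f 0) (\<psi> i k)"
    have ikp: "0 < i" "i < p" "0 < k" "k < p"
      using ik by (auto simp: J_def)
    have "z i \<in> ann (\<psi> i k)" "z k \<in> ann (\<psi> k i)"
      unfolding \<psi>_def using ann_act[OF z(1)] z_perp ik by auto
    then have "y \<in> ann (\<psi> i k)"
      unfolding y_def using \<psi>_sym ikp subspace_diff[OF subspace_ann] by metis
    moreover have y0: "B y (f 0) = 0"
      using z(2) ik by (simp add: y_def)
    ultimately have y_ann: "y \<in> ann \<Omega>"
      unfolding \<Omega>_def by (intro ann_act)
    \<comment> \<open>A vector detecting \<open>y\<close> modulo \<open>f 0\<close>, projected by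
      \<open>P\<close>, is orthogonal to all factors of \<open>act (f 0) \<omega>\<close> and to
      \<open>f i\<close>, \<open>f k\<close>. It therefore contracts \<open>\<Omega>\<close> to 0,
      while wedging with \<open>y\<close> would restore \<open>\<Omega>\<close>.\<close>
    have "y \<in> span {f 0}"
    proof (rule ccontr)
      assume "y \<notin> span {f 0}"
      then obtain d where d: "B d y = 1" "B d (f 0) = 0"
        using exists_dual_vector by blast
      have y_perp: "B (e1 j) y = 0 \<and> B (f j) y = 0" if "j \<in> J" for j
        using z_perp ik that by (simp add: y_def B_commute[of _ "z i"] B_commute[of _ "z k"])
      have Pd: "B (P d) y = 1" "B (P d) (f 0) = 0"
        using P(3)[of y d] P(3)[of "f 0" d] y_perp d e1 fd p by (auto simp: J_def)
      have alt0: "act (f 0) \<omega> \<in> alt p"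
        using alt_\<omega> by (rule alt_act)
      have "contr (P d) (wedges (f 0 # map e1 [1..<p])) = 0"
        using P(1) Pd(2) by (intro contr_wedges_perp) (auto simp: J_def)
      then have "contr (P d) (act (f 0) \<omega>) = 0"
        using W1 by simp
      then have "contr (P d) \<Omega> = 0"
        unfolding \<Omega>_def act\<psi>[OF ikp] using P(2) ik contr_act_perp[OF alt_act[OF alt0]]
          contr_act_perp[OF alt0] by simp
      then have "\<Omega> = 0"
        using wdg_contr_if_ann[OF y_ann, of "P d"] Pd by simp
      then show False
        using nz3 ikp ik(3) by (simp add: \<Omega>_def)
    qed
    then obtain c where c: "y = scale c (f 0)"
      by (auto simp: span_singleton)
    then have "z i = z k + scale c (f 0)"
      by (simp add: y_def algebra_simps)
    \<comment> \<open>Isotropy of both \<open>z i\<close> and \<open>z k\<close> excludes a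
      difference along \<open>f 0\<close>, with which \<open>z k\<close> pairs to 1.\<close>
    then have "B (z i) (z i) = 2 * c"
      using z_iso[OF ik(2)] z(2)[OF ik(2)] fd[of 0 0] p B_commute[of "f 0" "z k"] by simp
    then have "c = 0"
      using z_iso[OF ik(1)] two_nonzero by simp
    then show ?thesis
      using c by (simp add: y_def)
  qed
  define e' where "e' i = (if i = 0 then z 1 else e1 i)" for i
  have J1: "1 \<in> J"
    using p by (simp add: J_def)
  have z1: "z 1 \<in> ann (act (f i) \<omega>)" if "i \<in> J" for i
    using z(1)[OF that] z_eq[OF that J1] by (cases "i = 1") auto
  have z_perp1: "B (z 1) (e1 j) = 0" "B (e1 j) (z 1) = 0" "B (z 1) (f j) = 0" if "0 < j" "j < p" for j
    using z_perp[OF J1] that B_commute[of "e1 j"] by (auto simp: J_def)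
  have fr': "frame p e' f"
    unfolding frame_def
  proof (intro allI impI conjI)
    fix i j assume ij: "i < p" "j < p"
    show "B (e' i) (e' j) = 0"
      using ij e1_e1 z_iso[OF J1] z_perp1 by (simp add: e'_def)
    show "B (f i) (f j) = 0"
      using ij fd by simp
    show "B (e' i) (f j) = (if i = j then 1 else 0)"
      using ij e1_f z(2)[OF J1] z_perp1 by (cases "j = 0") (simp_all add: e'_def)
  qed
  define \<phi>' where "\<phi>' = wedges (map e' [0..<p])"
  have map_eq: "map e' [1..<p] = map e1 [1..<p]"
    by (auto simp: e'_def)
  have "0 < p"
    using p by simp
  have agree0': "act (f 0) \<omega> = act (f 0) \<phi>'"
    unfolding W1 \<phi>'_def frame_act_f0[OF fr' \<open>0 < p\<close>] map_eq
    by (rule refl)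
  have "act (f i) \<omega> = act (f i) \<phi>'" if "i < p" for i
  proof (cases "i = 0")
    case False
    have alt': "\<phi>' \<in> alt p"
      using alt_wedges[of "map e' [0..<p]"] by (simp add: \<phi>'_def)
    have nz': "\<phi>' \<noteq> 0"
      unfolding \<phi>'_def by (rule wedges_frame_nonzero[OF fr']) auto
    note fd' = frameD[OF fr']
    show ?thesis
      unfolding \<phi>'_def
    proof (rule frame_agree_if_ann[OF fr', where a = "f 0" and j = i])
      show "act (f 0) (act (f i) (wedges (map e' [0..<p]))) \<noteq> 0"
        using fd' that False alt' nz' frame_iso_ann[OF fr', of 0] frame_iso_ann[OF fr', of i] p
        by (intro act_act_nonzero[of _ p "e' i" _ "e' 0"]) (auto simp: \<phi>'_def)
      show "act (f 0) \<omega> = act (f 0) (wedges (map e' [0..<p]))"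
        using agree0' by (simp add: \<phi>'_def)
      fix m assume m: "m < p" "m \<noteq> i"
      have "e' m \<in> ann (act (f i) \<omega>)"
        using z1 e1_ann m that False by (auto simp: e'_def J_def)
      then show "e' m - scale (B (f i) (e' m) / B (f i) (e' i)) (e' i) \<in> ann (act (f i) \<omega>)"
        using fd' m that by simp
    qed (use fd' that in auto)
  qed (use agree0' in simp)
  then show ?thesis
    using fr' unfolding \<phi>'_def by blast
qed


section \<open>Agreement on enough isotropic vectors\<close>

lemma exists_index_notin: "finite S \<Longrightarrow> card S < p \<Longrightarrow> \<exists>k<p. k \<notin> S"
  by (metis card_lessThan card_mono lessThan_iff linorder_not_less subsetI)

lemma eq_wedges_if_agree:
  assumes fr: "frame p e f" and p: "p \<ge> 4" and dim: "p = dim (UNIV :: 'v set) div 2"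
    and dim8: "dim (UNIV :: 'v set) > 8"
    and agree_f: "\<And>i. i < p \<Longrightarrow> act (f i) \<omega> = act (f i) (wedges (map e [0..<p]))"
  shows "\<omega> = wedges (map e [0..<p])"
proof -
  define \<phi> where "\<phi> = wedges (map e [0..<p])"
  note fd = frameD[OF fr]
  have agree_f: "act (f i) \<omega> = act (f i) \<phi>" if "i < p" for i
    using agree_f that by (simp add: \<phi>_def)
  have \<phi>: "\<phi> \<in> alt p" "\<phi> \<noteq> 0"
    using alt_wedges[of "map e [0..<p]"] wedges_frame_nonzero[OF fr, of "[0..<p]"]
    by (auto simp: \<phi>_def lessThan_atLeast0)
  have e_iso: "e i \<in> iso_ann \<phi>" if "i < p" for i
    unfolding \<phi>_def using fr that by (rule frame_iso_ann)
  have e_diff_iso: "e i - e j \<in> iso_ann \<phi>" if "i < p" "j < p" for i j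
    using subspace_diff[OF subspace_iso_ann[OF \<phi>(1)]] e_iso that by blast
  have pick: "\<exists>k<p. k \<notin> {i, j, m}" for i j m
  proof (rule exists_index_notin)
    show "card {i, j, m} < p"
      using p card_insert_le_m1[of 3 "{j, m}" i] card_insert_le_m1[of 2 "{m}" j] by simp
  qed simp
  obtain h where h: "\<And>i. i < p \<Longrightarrow> B h (e i) = 0" "\<And>i. i < p \<Longrightarrow> B h (f i) = 0"
    "span (insert h (e ` {..<p} \<union> f ` {..<p})) = UNIV" "dim (UNIV :: 'v set) \<noteq> 2 * p \<Longrightarrow> B h h \<noteq> 0"
    using frame_spans[OF fr dim] by blast
  have h': "B (e i) h = 0" "B (f i) h = 0" if "i < p" for i
    using h(1,2)[OF that] by (simp_all add: B_commute)
  \<comment> \<open>\<open>f k\<close> is the vector along which the scalar is compared. An index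
    \<open>k\<close> with \<open>e k\<close> and \<open>f k\<close> orthogonal to \<open>v\<close>
    also settles nonvanishing, with \<open>e j\<close> and \<open>e k\<close> as witnesses.\<close>
  have agreeI: "act v \<omega> = act v \<phi>"
    if v: "B v v = 0" and j: "j < p" "B v (e j) \<noteq> 0" and k: "k < p" "k \<noteq> j" "B (f k) v = 0" "B (e k) v = 0"
      and ann: "\<And>m. m < p \<Longrightarrow> m \<noteq> j \<Longrightarrow>
        e m - scale (B v (e m) / B v (e j)) (e j) \<in> ann (act v \<omega>)"
    for v j k
    unfolding \<phi>_def
  proof (rule frame_agree_if_ann[OF fr v j _ k(3) _ ann])
    show "act (f k) (act v (wedges (map e [0..<p]))) \<noteq> 0"
      unfolding \<phi>_def[symmetric]
      by (rule act_act_nonzero[OF \<phi> e_iso[of j] _ e_iso[of k]]) (use j k fd B_commute in auto)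
  qed (use agree_f k in \<open>auto simp: \<phi>_def\<close>)
  have agree_ff: "act (f i + f j) \<omega> = act (f i + f j) \<phi>" if ij: "i < p" "j < p" "i \<noteq> j" for i j
  proof -
    obtain k where k: "k < p" "k \<notin> {i, j, j}"
      using pick by blast
    show ?thesis
    proof (rule agreeI[where j = j and k = k])
      fix m assume m: "m < p" "m \<noteq> j"
      show "e m - scale (B (f i + f j) (e m) / B (f i + f j) (e j)) (e j) \<in> ann (act (f i + f j) \<omega>)"
      proof (cases "m = i")
        case True
        obtain l where l: "l < p" "l \<notin> {i, j, k}"
          using pick by blast
        \<comment> \<open>This vector is orthogonal to \<open>f i + f j\<close>. Since
          \<open>p \<ge> 4\<close>, there are two indices outside \<open>i\<close>, \<open>j\<close>
          for the auxiliary pair.\<close>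
        have "e i - e j \<in> ann (act (f i + f j) \<omega>)"
          by (rule ann_if_orthogonal_pair[OF \<phi>, where a = "f k" and b = "f l" and ?y1.0 = "e j"
                and ?y2.0 = "e l" and ?y3.0 = "e k"])
            (use fd ij k l e_iso e_diff_iso agree_f in auto)
        then show ?thesis
          using True fd ij by simp
      next
        case False
        obtain l where l: "l < p" "l \<notin> {i, j, m}"
          using pick by blast
        \<comment> \<open>Only one index outside \<open>i\<close>, \<open>j\<close>,
          \<open>m\<close> is guaranteed. The second auxiliary vector is \<open>f i\<close>, which
          is orthogonal to \<open>f i + f j\<close>; its witness is \<open>e i - e j\<close>, not
          \<open>e i\<close>, because the witness has to be orthogonal to \<open>f i + f j\<close>
          too.\<close>
        have "e m \<in> ann (act (f i + f j) \<omega>)"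
          by (rule ann_if_orthogonal_pair[OF \<phi>, where a = "f l" and b = "f i" and ?y1.0 = "e j"
                and ?y2.0 = "e i - e j" and ?y3.0 = "e l"])
            (use fd ij k l m False e_iso e_diff_iso agree_f in auto)
        then show ?thesis
          using False m fd ij by simp
      qed
    qed (use fd ij k in auto)
  qed
  \<comment> \<open>The scalar \<open>s\<close> is kept for the passage to \<open>e i\<close>: in
    the values for \<open>s = 1\<close> and \<open>s = - 1\<close> the mixed terms have opposite
    signs, which isolates \<open>act (e i)\<close>.\<close>
  have agree_ef: "act (e i + scale s (f j)) \<omega> = act (e i + scale s (f j)) \<phi>"
    if ij: "i < p" "j < p" "i \<noteq> j" and s: "s \<noteq> 0" for i j s
  proof -
    define v where "v = e i + scale s (f j)"
    have Bv: "B v v = 0" "B v (e k) = (if k = j then s else 0)" "B (e k) v = (if k = j then s else 0)"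
      "B (f k) v = (if k = i then 1 else 0)" if "k < p" for k
      using fd ij that by (auto simp: v_def)
    have ann: "e m \<in> ann (act v \<omega>)" if m: "m < p" "m \<noteq> j" for m
    proof -
      obtain k where k: "k < p" "k \<notin> {i, j, m}"
        using pick by blast
      txt \<open>Two further indices \<open>k\<close>, \<open>l\<close> suffice unless \<open>p = 4\<close>. In that case the dimension is 9, and the
        second vector is taken with a component in the direction of \<open>h\<close>.\<close>
      show ?thesis
      proof (cases "p = 4")
        case False
        have "\<exists>l<p. l \<notin> {k, i, j, m}"
        proof (rule exists_index_notin)
          show "card {k, i, j, m} < p"
            using p False card_insert_le_m1[of 4 "{i, j, m}" k] card_insert_le_m1[of 3 "{j, m}" i]
              card_insert_le_m1[of 2 "{m}" j] by simp
        qed simp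
        then obtain l where l: "l < p" "l \<notin> {k, i, j, m}"
          by blast
        show ?thesis
          by (rule ann_if_orthogonal_pair[OF \<phi>, where a = "f k" and b = "f l" and ?y1.0 = "e j"
                and ?y2.0 = "e l" and ?y3.0 = "e k"])
            (use fd Bv ij k l m s e_iso agree_f in auto)
      next
        case True
        then have hh: "B h h \<noteq> 0"
          using h(4) dim8 by simp
        \<comment> \<open>The coefficient of \<open>f k\<close> makes \<open>x\<close> isotropic. As
          \<open>B (f k) x = 1\<close> and \<open>x\<close> is orthogonal to \<open>v\<close> and
          \<open>e m\<close>, the vectors \<open>f k\<close> and \<open>x\<close> can serve as the
          pair in \<open>ann_if_hyperbolic_pair\<close>.\<close>
        define x where "x = e k + h + scale (- (B h h / 2)) (f k)"
        have Bx: "B x x = 0"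
          using fd k h h' two_nonzero by (simp add: x_def field_simps)
        have Bx': "B x (e n) = (if n = k then - (B h h / 2) else 0)"
          "B (e n) x = (if n = k then - (B h h / 2) else 0)"
          "B (f n) x = (if n = k then 1 else 0)" if "n < p" for n
          using fd k h h' that by (auto simp: x_def)
        \<comment> \<open>For \<open>x\<close> in place of \<open>v\<close> only the indices
          \<open>k\<close> and \<open>n\<close> are occupied, so an orthogonal pair
          \<open>f l\<close>, \<open>f q\<close> exists even for \<open>p = 4\<close>.\<close>
        have agree_x: "act x \<omega> = act x \<phi>"
        proof (rule agreeI[where j = k and k = i])
          fix n assume n: "n < p" "n \<noteq> k"
          obtain l where l: "l < p" "l \<notin> {k, n, n}"
            using pick by blast
          obtain q where q: "q < p" "q \<notin> {k, n, l}"
            using pick by blast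
          have "e n \<in> ann (act x \<omega>)"
            by (rule ann_if_orthogonal_pair[OF \<phi>, where a = "f l" and b = "f q" and ?y1.0 = "e k"
                  and ?y2.0 = "e q" and ?y3.0 = "e l"])
              (use fd Bx Bx' k l q n hh two_nonzero e_iso agree_f in auto)
          then show "e n - scale (B x (e n) / B x (e k)) (e k) \<in> ann (act x \<omega>)"
            using Bx' n by simp
        qed (use Bx Bx' k ij hh two_nonzero in auto)
        have "B x v = 0"
          using Bx' k ij by (simp add: v_def B_commute[of x])
        then show ?thesis
          by (intro ann_if_hyperbolic_pair[OF \<phi>, where a = "f k" and b = x and ?y1.0 = "e j"
                and ?y2.0 = "e k"])
            (use fd Bv Bx' ij k m s hh two_nonzero e_iso agree_f agree_x in auto)
      qed
    qed
    obtain k where k: "k < p" "k \<notin> {i, j, j}"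
      using pick by blast
    have "act v \<omega> = act v \<phi>"
    proof (rule agreeI[where j = j and k = k])
      fix m assume "m < p" "m \<noteq> j"
      then show "e m - scale (B v (e m) / B v (e j)) (e j) \<in> ann (act v \<omega>)"
        using ann Bv by simp
    qed (use Bv k ij s in auto)
    then show ?thesis
      by (simp add: v_def)
  qed
  have alt_diff: "\<omega> - \<phi> \<in> alt p"
    using alt_\<omega> \<phi>(1) by (rule alt_diff)
  have act_f: "act (f i) (\<omega> - \<phi>) = 0" if "i < p" for i
    using agree_f[OF that] by simp
  have act_ef: "act (e i + scale s (f j)) (\<omega> - \<phi>) = 0" if "i < p" "j < p" "i \<noteq> j" "s \<noteq> 0" for i j s
    using agree_ef[OF that] by simp
  have act_e: "act (e i) (\<omega> - \<phi>) = 0" if i: "i < p" for i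
  proof -
    obtain j where j: "j < p" "j \<notin> {i, i, i}"
      using pick by blast
    define \<psi> where "\<psi> = wdg (e i) (contr (f j) (\<omega> - \<phi>)) + wdg (f j) (contr (e i) (\<omega> - \<phi>))"
    have exp: "act (e i + scale s (f j)) (\<omega> - \<phi>) = act (e i) (\<omega> - \<phi>) + smult_fun s \<psi>" for s
      unfolding act_add_left[OF alt_diff] act_scale_left[OF alt_diff] act_f[OF j(1)]
        alt_contr_scale[OF alt_diff] \<psi>_def
      by (simp add: fun_eq_iff pointwise algebra_simps)
    have "act (e i) (\<omega> - \<phi>) + smult_fun s \<psi> = 0" if "s \<noteq> 0" for s
      using act_ef[of i j s] exp[of s] that i j by simp
    from this[of 1] this[of "- 1"] have "2 * act (e i) (\<omega> - \<phi>) xs = 0" for xs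
      by (simp add: fun_eq_iff pointwise) (metis add.commute add_cancel_right_right eq_neg_iff_add_eq_0 minus_equation_iff mult_2)
    then show ?thesis
      using two_nonzero by (simp add: fun_eq_iff pointwise)
  qed
  have "\<omega> - \<phi> = 0"
  proof (rule act_eq_0_imp_zero[OF fr _ alt_diff _ h(3) act_e act_f])
    show "act (f i + f j) (\<omega> - \<phi>) = 0" if "i < p" "j < p" "i \<noteq> j" for i j
      using agree_ff[OF that] by simp
    show "act (e i + f j) (\<omega> - \<phi>) = 0" if "i < p" "j < p" "i \<noteq> j" for i j
      using act_ef[of i j 1] that by simp
  qed (use p h in auto)
  then show ?thesis
    by (simp add: \<phi>_def)
qed

text \<open>The list \<open>ls\<close> provides a frame by which a nonzero \<open>\<omega>\<close>
  is shown to have some isotropic \<open>v\<close> with \<open>act v \<omega> \<noteq> 0\<close>.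
  The frame for the reconstruction is then built from the factors of
  \<open>act v \<omega>\<close>.\<close>

lemma pure_isotropic_if_actions:
  assumes dim: "p = dim (UNIV :: 'v set) div 2" and dim8: "dim (UNIV :: 'v set) > 8"
    and L: "distinct ls" "independent (set ls)" "length ls = p"
      "\<And>x y. x \<in> set ls \<Longrightarrow> y \<in> set ls \<Longrightarrow> B x y = 0"
  shows "pure_isotropic p \<omega>"
proof (cases "\<omega> = 0")
  case True
  have "p \<noteq> 0"
    using dim dim8 by simp
  then obtain n where "p = Suc n"
    using not0_implies_Suc by blast
  then have "wedges (replicate p 0) = 0"
    by simp
  then show ?thesis
    unfolding pure_isotropic_def using True by (intro exI[of _ "replicate p 0"]) auto
next
  case False
  have p: "p \<ge> 4"
    using dim dim8 by simp
  have "\<exists>v. B v v = 0 \<and> act v \<omega> \<noteq> 0"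
  proof (rule ccontr)
    assume "\<nexists>v. B v v = 0 \<and> act v \<omega> \<noteq> 0"
    then have act0: "act v \<omega> = 0" if "B v v = 0" for v
      using that by blast
    obtain f where fr: "frame p ((!) ls) f"
      using exists_dual_frame[OF L(1,2,4)] L(3) by auto
    obtain h where "\<forall>i<p. B h (ls ! i) = 0 \<and> B h (f i) = 0"
      "span (insert h ((!) ls ` {..<p} \<union> f ` {..<p})) = UNIV"
      using frame_spans[OF fr dim] by blast
    then have "\<omega> = 0"
      using p frameD[OF fr] by (intro act_eq_0_imp_zero[OF fr _ alt_\<omega>] act0) auto
    then show False
      using False by blast
  qed
  then obtain v where v: "B v v = 0" "act v \<omega> \<noteq> 0"
    by blast
  then have "v \<noteq> 0"
    by auto
  then obtain ys where ys: "length (v # ys) = p" "\<And>x y. x \<in> set (v # ys) \<Longrightarrow> y \<in> set (v # ys) \<Longrightarrow> B x y = 0"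
    "act v \<omega> = wedges (v # ys)"
    using act_\<omega>[OF _ v(1)] by metis
  have "distinct (v # ys) \<and> independent (set (v # ys))"
    using wedges_nonzero_imp_independent[of "v # ys"] v(2) ys(3) by simp
  then obtain g where g: "frame p ((!) (v # ys)) g"
    using exists_dual_frame[of "v # ys"] ys(1,2) by auto
  \<comment> \<open>In the frame from \<open>v # ys\<close> and \<open>g\<close> the pair of index 0
    is swapped, so that \<open>v\<close> becomes \<open>f 0\<close> and \<open>ys\<close> becomes
    \<open>e 1\<close>, \<open>e 2\<close>, and so on.\<close>
  define e f where "e i = (if i = 0 then g 0 else (v # ys) ! i)" and "f i = (if i = 0 then v else g i)" for i
  have fr: "frame p e f"
    unfolding frame_def
  proof (intro allI impI conjI)
    fix i j assume ij: "i < p" "j < p"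
    have p0: "0 < p"
      using p by simp
    note gd = frameD[OF g ij] frameD[OF g ij(1) p0] frameD[OF g p0 ij(2)] frameD[OF g p0 p0]
    show "B (e i) (e j) = 0" "B (f i) (f j) = 0" "B (e i) (f j) = (if i = j then 1 else 0)"
      using gd by (auto simp: e_def f_def)
  qed
  have "map e [1..<p] = ys"
    using ys(1) by (intro nth_equalityI) (auto simp: e_def)
  then have "act (f 0) \<omega> = wdg (f 0) (wedges (map e [1..<p]))"
    using ys(3) by (simp add: f_def)
  then obtain e' where e': "frame p e' f" "\<forall>i<p. act (f i) \<omega> = act (f i) (wedges (map e' [0..<p]))"
    using exists_adapted_frame[OF fr p] by blast
  then have "\<omega> = wedges (map e' [0..<p])"
    by (intro eq_wedges_if_agree[OF e'(1) p dim dim8]) auto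
  then show ?thesis
    unfolding pure_isotropic_def using frameD[OF e'(1)] by (intro exI[of _ "map e' [0..<p]"]) auto
qed

end


section \<open>Comparison with the exterior powers\<close>

interpretation free: vector_space free_scale
  by (rule vector_space_free_scale)

lemma subspace_free_on_tuples: "free.subspace (free_on_tuples k W)"
proof -
  have "Poly_Mapping.keys (free_scale c p) \<subseteq> Poly_Mapping.keys p" for c and p :: "'b list \<Rightarrow>\<^sub>0 'a"
    by (auto simp: in_keys_iff lookup_free_scale)
  then show ?thesis
    by (intro free.subspaceI) (auto simp: free_on_tuples_def dest: subsetD[OF Poly_Mapping.keys_add])
qed

lemma generator_in_free_on_tuples: "xs \<in> tuples k W \<Longrightarrow> generator xs \<in> free_on_tuples k W"
  by (simp add: free_on_tuples_def)

lemma free_extend_generator: "free_extend generator p = p"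
proof (rule poly_mapping_eqI)
  fix x
  have "Poly_Mapping.lookup (free_extend generator p) x =
      (\<Sum>xs\<in>Poly_Mapping.keys p. if xs = x then Poly_Mapping.lookup p x else 0)"
    unfolding free_extend_def lookup_sum lookup_free_scale
    by (intro sum.cong) (auto simp: lookup_single when_def)
  then show "Poly_Mapping.lookup (free_extend generator p) x = Poly_Mapping.lookup p x"
    by (simp add: in_keys_iff)
qed

lemma free_extend_in_subspace:
  assumes "free.subspace X" "p \<in> free_on_tuples k W" "\<And>xs. xs \<in> tuples k W \<Longrightarrow> g xs \<in> X"
  shows "free_extend g p \<in> X"
  unfolding free_extend_def
proof (rule free.subspace_sum[OF assms(1)])
  fix xs assume "xs \<in> Poly_Mapping.keys p"
  then have "g xs \<in> X"
    using assms(2,3) by (auto simp: free_on_tuples_def)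
  then show "free_scale (Poly_Mapping.lookup p xs) (g xs) \<in> X"
    by (rule free.subspace_scale[OF assms(1)])
qed

lemma free_on_tuples_induct:
  assumes "p \<in> free_on_tuples k W" "free.subspace X" "\<And>xs. xs \<in> tuples k W \<Longrightarrow> generator xs \<in> X"
  shows "p \<in> X"
  using free_extend_in_subspace[OF assms(2,1), of generator] assms(3)
  by (simp add: free_extend_generator)

lemma free_extend_superset:
  assumes "finite A" "Poly_Mapping.keys p \<subseteq> A"
  shows "free_extend g p = (\<Sum>xs\<in>A. free_scale (Poly_Mapping.lookup p xs) (g xs))"
  unfolding free_extend_def using assms
  by (intro sum.mono_neutral_left) (auto simp: in_keys_iff)

lemma free_extend_add: "free_extend g (p + q) = free_extend g p + free_extend g q"
proof -
  let ?A = "Poly_Mapping.keys p \<union> Poly_Mapping.keys q"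
  have "free_extend g r = (\<Sum>xs\<in>?A. free_scale (Poly_Mapping.lookup r xs) (g xs))"
    if "r \<in> {p, q, p + q}" for r
    using that Poly_Mapping.keys_add[of p q] by (intro free_extend_superset) auto
  then show ?thesis
    by (simp add: lookup_add free.scale_left_distrib sum.distrib)
qed

lemma free_extend_free_scale: "free_extend g (free_scale c p) = free_scale c (free_extend g p)"
proof -
  have "Poly_Mapping.keys (free_scale c p) \<subseteq> Poly_Mapping.keys p"
    by (auto simp: in_keys_iff lookup_free_scale)
  then show ?thesis
    by (simp add: free_extend_superset[of "Poly_Mapping.keys p"] lookup_free_scale free.scale_sum_right)
qed

lemma free_extend_single: "free_extend g (generator xs) = g xs"
  by (simp add: free_extend_def)

lemma free_extend_zero: "free_extend g 0 = 0"
  by (simp add: free_extend_def)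

lemma free_extend_diff: "free_extend g (p - q) = free_extend g p - free_extend g q"
  using free_extend_add[of g "p - q" q] by simp

text \<open>The counterpart of \<open>free_extend\<close> with values in functions. Its instance
  \<open>lin_ext wedges\<close> compares the exterior power by generators and relations with the
  alternating functions.\<close>

definition lin_ext :: "('w list \<Rightarrow> 'a \<Rightarrow> 'k::field) \<Rightarrow> ('w list \<Rightarrow>\<^sub>0 'k) \<Rightarrow> 'a \<Rightarrow> 'k" where
  "lin_ext g p = (\<Sum>xs\<in>Poly_Mapping.keys p. smult_fun (Poly_Mapping.lookup p xs) (g xs))"

lemma smult_fun_distrib:
  "smult_fun (a + b) \<phi> = smult_fun a \<phi> + smult_fun b \<phi>"
  "smult_fun a (\<phi> + \<psi>) = smult_fun a \<phi> + smult_fun a \<psi>"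
  by (auto simp: fun_eq_iff pointwise algebra_simps)

lemma smult_fun_sum: "smult_fun c (\<Sum>i\<in>A. g i) = (\<Sum>i\<in>A. smult_fun c (g i))"
  by (induction A rule: infinite_finite_induct) (simp_all add: smult_fun_distrib)

lemma lin_ext_superset:
  assumes "finite A" "Poly_Mapping.keys p \<subseteq> A"
  shows "lin_ext g p = (\<Sum>xs\<in>A. smult_fun (Poly_Mapping.lookup p xs) (g xs))"
  unfolding lin_ext_def using assms
  by (intro sum.mono_neutral_left) (auto simp: in_keys_iff)

lemma lin_ext_add: "lin_ext g (p + q) = lin_ext g p + lin_ext g q"
proof -
  let ?A = "Poly_Mapping.keys p \<union> Poly_Mapping.keys q"
  have "lin_ext g r = (\<Sum>xs\<in>?A. smult_fun (Poly_Mapping.lookup r xs) (g xs))"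
    if "r \<in> {p, q, p + q}" for r
    using that Poly_Mapping.keys_add[of p q] by (intro lin_ext_superset) auto
  then show ?thesis
    by (simp add: lookup_add smult_fun_distrib sum.distrib)
qed

lemma lin_ext_free_scale: "lin_ext g (free_scale c p) = smult_fun c (lin_ext g p)"
proof -
  have "Poly_Mapping.keys (free_scale c p) \<subseteq> Poly_Mapping.keys p"
    by (auto simp: in_keys_iff lookup_free_scale)
  then show ?thesis
    by (simp add: lin_ext_superset[of "Poly_Mapping.keys p"] lookup_free_scale smult_fun_sum)
qed

lemma lin_ext_single: "lin_ext g (generator xs) = g xs"
  by (simp add: lin_ext_def)

lemma lin_ext_zero: "lin_ext g 0 = 0"
  by (simp add: lin_ext_def)

lemma lin_ext_diff: "lin_ext g (p - q) = lin_ext g p - lin_ext g q"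
  using lin_ext_add[of g "p - q" q] by simp

lemma lin_ext_sum: "lin_ext g (\<Sum>i\<in>A. h i) = (\<Sum>i\<in>A. lin_ext g (h i))"
  by (induction A rule: infinite_finite_induct) (simp_all add: lin_ext_zero lin_ext_add)

lemma lin_ext_free_extend: "lin_ext g (free_extend h p) = lin_ext (\<lambda>xs. lin_ext g (h xs)) p"
  by (simp add: free_extend_def lin_ext_sum lin_ext_free_scale) (simp add: lin_ext_def)

lemma lin_ext_linear:
  fixes g :: "'w list \<Rightarrow> 'a \<Rightarrow> 'k::field" and L :: "('a \<Rightarrow> 'k) \<Rightarrow> 'b \<Rightarrow> 'k"
  assumes "\<And>\<phi> \<psi>. L (\<phi> + \<psi>) = L \<phi> + L \<psi>" "\<And>c \<phi>. L (smult_fun c \<phi>) = smult_fun c (L \<phi>)"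
  shows "lin_ext (\<lambda>xs. L (g xs)) p = L (lin_ext g p)"
proof -
  have "L 0 = 0"
    using assms(2)[of 0 0] by simp
  then have "L (\<Sum>xs\<in>A. h xs) = (\<Sum>xs\<in>A. L (h xs))" for A :: "'w list set" and h
    by (induction A rule: infinite_finite_induct) (simp_all add: assms(1))
  then show ?thesis
    by (simp add: lin_ext_def assms(2))
qed

text \<open>The well-definedness half of the universal property of the exterior power.\<close>

lemma lin_ext_ext_null:
  assumes "\<And>xs i a b. xs \<in> tuples k W \<Longrightarrow> i < k \<Longrightarrow> a \<in> vecs W \<Longrightarrow> b \<in> vecs W \<Longrightarrow>
      g (xs[i := vadd W a b]) = g (xs[i := a]) + g (xs[i := b])"
    and "\<And>xs i c a. xs \<in> tuples k W \<Longrightarrow> i < k \<Longrightarrow> a \<in> vecs W \<Longrightarrow>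
      g (xs[i := vscale W c a]) = smult_fun c (g (xs[i := a]))"
    and "\<And>xs i j. xs \<in> tuples k W \<Longrightarrow> i < k \<Longrightarrow> j < k \<Longrightarrow> i \<noteq> j \<Longrightarrow> xs ! i = xs ! j \<Longrightarrow> g xs = 0"
    and "p \<in> ext_null k W"
  shows "lin_ext g p = 0"
proof -
  have "lin_ext g r = 0" if "r \<in> ext_relators k W" for r
    using that assms(1-3) unfolding ext_relators_def
    by (auto simp: lin_ext_diff lin_ext_free_scale lin_ext_single)
  moreover have "free.subspace {r. lin_ext g r = 0}"
    by (auto simp: free.subspace_def lin_ext_zero lin_ext_add lin_ext_free_scale)
  ultimately have "ext_null k W \<subseteq> {r. lin_ext g r = 0}"
    unfolding ext_null_def by (intro free.span_minimal) auto
  then show ?thesis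
    using assms(4) by auto
qed

section \<open>Cosets modulo the relations, and wedging on the free space\<close>

lemma subspace_ext_null: "free.subspace (ext_null k W)"
  unfolding ext_null_def by (rule free.subspace_span)

lemma coset_self: "0 \<in> N \<Longrightarrow> x \<in> coset N x"
  unfolding coset_def by (intro CollectI exI[of _ 0]) simp

lemma coset_eq_iff:
  assumes "free.subspace N"
  shows "coset N x = coset N y \<longleftrightarrow> x - y \<in> N"
proof
  assume "coset N x = coset N y"
  moreover have "x \<in> coset N x"
    using free.subspace_0[OF assms] by (rule coset_self)
  ultimately show "x - y \<in> N"
    by (auto simp: coset_def)
next
  have *: "coset N x \<subseteq> coset N y" if "x - y \<in> N" for x y
  proof
    fix z assume "z \<in> coset N x"
    then obtain n where "n \<in> N" "z = x + n"
      by (auto simp: coset_def)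
    then have "z = y + ((x - y) + n)" "(x - y) + n \<in> N"
      using free.subspace_add[OF assms that] by auto
    then show "z \<in> coset N y"
      unfolding coset_def by blast
  qed
  assume "x - y \<in> N"
  then show "coset N x = coset N y"
    using *[of x y] *[of y x] free.subspace_neg[OF assms, of "x - y"] by auto
qed

lemma vecs_ext_power: "vecs (ext_power k W) = coset (ext_null k W) ` free_on_tuples k W"
  by (simp add: ext_power_def quotient_vs_def)

lemma ext_lift_coset:
  assumes "0 \<in> N" "\<And>n. n \<in> N \<Longrightarrow> free_extend g n \<in> ext_null k W"
  shows "ext_lift k W g (coset N p) = coset (ext_null k W) (free_extend g p)"
proof -
  have eq: "coset (ext_null k W) (free_extend g (p + n)) = coset (ext_null k W) (free_extend g p)"
    if "n \<in> N" for n
    using assms(2)[OF that] by (simp add: coset_eq_iff[OF subspace_ext_null] free_extend_add)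
  have "ext_lift k W g (coset N p) = (\<Union>n\<in>N. coset (ext_null k W) (free_extend g (p + n)))"
    unfolding ext_lift_def coset_def[of N p] by blast
  also have "\<dots> = (\<Union>n\<in>N. coset (ext_null k W) (free_extend g p))"
    using eq by simp
  finally show ?thesis
    using assms(1) by auto
qed

lemma ext_null_add:
  assumes "xs \<in> tuples k W" "i < k" "a \<in> vecs W" "b \<in> vecs W"
  shows "generator (xs[i := vadd W a b]) - generator (xs[i := a]) - generator (xs[i := b])
    \<in> ext_null k W"
  unfolding ext_null_def ext_relators_def
  by (rule free.span_base, rule UnI1, rule UnI1, intro CollectI exI conjI) (rule refl assms)+

lemma ext_null_scale:
  assumes "xs \<in> tuples k W" "i < k" "a \<in> vecs W"
  shows "generator (xs[i := vscale W c a]) - free_scale c (generator (xs[i := a])) \<in> ext_null k W"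
  unfolding ext_null_def ext_relators_def
  by (rule free.span_base, rule UnI1, rule UnI2, intro CollectI exI conjI) (rule refl assms)+

lemma ext_null_alt:
  assumes "xs \<in> tuples k W" "i < k" "j < k" "i \<noteq> j" "xs ! i = xs ! j"
  shows "generator xs \<in> ext_null k W"
  unfolding ext_null_def ext_relators_def
  by (rule free.span_base, rule UnI2, intro CollectI exI conjI) (rule refl assms)+

lemma ext_relators_cases [consumes 1, case_names add scale alt]:
  assumes "r \<in> ext_relators k W"
  obtains xs i a b where "xs \<in> tuples k W" "i < k" "a \<in> vecs W" "b \<in> vecs W"
      "r = generator (xs[i := vadd W a b]) - generator (xs[i := a]) - generator (xs[i := b])"
    | xs i c a where "xs \<in> tuples k W" "i < k" "a \<in> vecs W"
      "r = generator (xs[i := vscale W c a]) - free_scale c (generator (xs[i := a]))"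
    | xs i j where "xs \<in> tuples k W" "i < k" "j < k" "i \<noteq> j" "xs ! i = xs ! j" "r = generator xs"
  using assms unfolding ext_relators_def by blast

text \<open>The lift of \<open>wdg y\<close> to formal combinations. It obeys the laws of the wedge
  product only modulo \<open>ext_null\<close>.\<close>

abbreviation prepend :: "'w \<Rightarrow> ('w list \<Rightarrow>\<^sub>0 'k) \<Rightarrow> ('w list \<Rightarrow>\<^sub>0 'k::field)" where
  "prepend y \<equiv> free_extend (\<lambda>xs. generator (y # xs))"

lemma tuples_Suc_iff: "y # xs \<in> tuples (Suc k) W \<longleftrightarrow> y \<in> vecs W \<and> xs \<in> tuples k W"
  by (auto simp: tuples_def)

lemma free_on_tuples_mono: "vecs W \<subseteq> vecs W' \<Longrightarrow> free_on_tuples k W \<subseteq> free_on_tuples k W'"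
  by (auto simp: free_on_tuples_def tuples_def)

lemma prepend_free_on_tuples:
  assumes "y \<in> vecs W" "q \<in> free_on_tuples k W"
  shows "prepend y q \<in> free_on_tuples (Suc k) W"
  by (rule free_extend_in_subspace[OF subspace_free_on_tuples assms(2)])
    (simp add: generator_in_free_on_tuples tuples_Suc_iff assms(1))

lemma prepend_ext_null:
  assumes "y \<in> vecs W" "q \<in> ext_null k W"
  shows "prepend y q \<in> ext_null (Suc k) W"
proof -
  have "prepend y r \<in> ext_null (Suc k) W" if r: "r \<in> ext_relators k W" for r
  proof -
    from r show ?thesis
    proof (cases rule: ext_relators_cases)
      case (add xs i a b)
      have "prepend y r = generator ((y # xs)[Suc i := vadd W a b]) -
          generator ((y # xs)[Suc i := a]) - generator ((y # xs)[Suc i := b])"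
        by (simp add: free_extend_diff free_extend_single add)
      moreover have "y # xs \<in> tuples (Suc k) W" "Suc i < Suc k"
        using add assms(1) by (simp_all add: tuples_Suc_iff)
      ultimately show ?thesis
        using ext_null_add[of "y # xs" "Suc k" W "Suc i" a b] add(3,4) by simp
    next
      case (scale xs i c a)
      have "prepend y r = generator ((y # xs)[Suc i := vscale W c a]) -
          free_scale c (generator ((y # xs)[Suc i := a]))"
        by (simp add: free_extend_diff free_extend_single free_extend_free_scale scale)
      moreover have "y # xs \<in> tuples (Suc k) W" "Suc i < Suc k"
        using scale assms(1) by (simp_all add: tuples_Suc_iff)
      ultimately show ?thesis
        using ext_null_scale[of "y # xs" "Suc k" W "Suc i" a c] scale(3) by simp
    next
      case (alt xs i j)
      then have "prepend y r = generator (y # xs)" "(y # xs) ! Suc i = (y # xs) ! Suc j"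
        "y # xs \<in> tuples (Suc k) W" "Suc i < Suc k" "Suc j < Suc k" "Suc i \<noteq> Suc j"
        using assms(1) by (simp_all add: free_extend_single tuples_Suc_iff)
      then show ?thesis
        using ext_null_alt[of "y # xs" "Suc k" W "Suc i" "Suc j"] by simp
    qed
  qed
  moreover have "free.subspace {r. prepend y r \<in> ext_null (Suc k) W}"
    using subspace_ext_null[of "Suc k" W]
    by (auto simp: free.subspace_def free_extend_zero free_extend_add free_extend_free_scale)
  ultimately have "ext_null k W \<subseteq> {r. prepend y r \<in> ext_null (Suc k) W}"
    unfolding ext_null_def[of k] by (intro free.span_minimal) auto
  then show ?thesis
    using assms(2) by auto
qed


context bilinear_space
begin

abbreviation vs :: "'v set \<Rightarrow> ('k, 'v) vspace" where
  "vs S \<equiv> subspace_vs scale S"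

lemma vs_simps [simp]: "vecs (vs S) = S" "vadd (vs S) = (+)" "vscale (vs S) = scale"
  by (simp_all add: subspace_vs_def)

lemma wedges_update_add:
  "i < length xs \<Longrightarrow> wedges (xs[i := a + b]) = wedges (xs[i := a]) + wedges (xs[i := b])"
  by (induction xs arbitrary: i) (auto split: nat.split)

lemma wedges_update_scale:
  "i < length xs \<Longrightarrow> wedges (xs[i := scale c a]) = smult_fun c (wedges (xs[i := a]))"
  by (induction xs arbitrary: i) (auto split: nat.split)

lemma wedges_repeated:
  "i < length xs \<Longrightarrow> j < length xs \<Longrightarrow> i \<noteq> j \<Longrightarrow> xs ! i = xs ! j \<Longrightarrow> wedges xs = 0"
  using wedges_nonzero_imp_independent nth_eq_iff_index_eq by blast

lemma lin_ext_wedges_ext_null: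
  assumes "p \<in> ext_null k (vs S)"
  shows "lin_ext wedges p = 0"
  by (rule lin_ext_ext_null[OF _ _ _ assms])
    (auto simp: tuples_def wedges_update_add wedges_update_scale intro: wedges_repeated)

lemma lin_ext_wedges_prepend: "lin_ext wedges (prepend y q) = wdg y (lin_ext wedges q)"
  unfolding lin_ext_free_extend lin_ext_single wedges_Cons
  by (rule lin_ext_linear) simp_all

lemma lin_ext_wedges_alt:
  assumes "p \<in> free_on_tuples k W"
  shows "lin_ext wedges p \<in> alt k"
proof -
  have "free.subspace {p. lin_ext wedges p \<in> alt k}"
    by (auto simp: free.subspace_def lin_ext_zero lin_ext_add lin_ext_free_scale)
  moreover have "lin_ext wedges (generator xs) \<in> alt k" if "xs \<in> tuples k W" for xs
    using alt_wedges[of xs] that by (simp add: lin_ext_single tuples_def)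
  ultimately show ?thesis
    using free_on_tuples_induct[OF assms, of "{p. lin_ext wedges p \<in> alt k}"] by blast
qed

lemma contr_lin_ext_perp:
  assumes "p \<in> free_on_tuples k (vs S)" "\<And>s. s \<in> S \<Longrightarrow> B d s = 0"
  shows "contr d (lin_ext wedges p) = 0"
proof -
  have "free.subspace {p. contr d (lin_ext wedges p) = 0}"
    by (auto simp: free.subspace_def lin_ext_zero lin_ext_add lin_ext_free_scale)
  moreover have "contr d (lin_ext wedges (generator xs)) = 0" if "xs \<in> tuples k (vs S)" for xs
    using that assms(2) contr_wedges_perp[of xs d] by (auto simp: lin_ext_single tuples_def)
  ultimately show ?thesis
    using free_on_tuples_induct[OF assms(1), of "{p. contr d (lin_ext wedges p) = 0}"] by blast
qed

lemma ext_null_mono: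
  assumes "S \<subseteq> S'"
  shows "ext_null k (vs S) \<subseteq> ext_null k (vs S')"
proof -
  have "tuples k (vs S) \<subseteq> tuples k (vs S')"
    using assms by (auto simp: tuples_def)
  note tup = subsetD[OF this]
  have "r \<in> ext_null k (vs S')" if "r \<in> ext_relators k (vs S)" for r
    using that
  proof (cases rule: ext_relators_cases)
    case (add xs i a b)
    then show ?thesis
      using ext_null_add[OF tup, of xs i a b] assms by auto
  next
    case (scale xs i c a)
    then show ?thesis
      using ext_null_scale[OF tup, of xs i a c] assms by auto
  next
    case (alt xs i j)
    then show ?thesis
      using ext_null_alt[OF tup] by blast
  qed
  then show ?thesis
    unfolding ext_null_def[of k "vs S"] by (intro free.span_minimal subspace_ext_null subsetI)
qed

lemma tuples_update:
  "xs \<in> tuples k (vs S) \<Longrightarrow> a \<in> S \<Longrightarrow> xs[i := a] \<in> tuples k (vs S)"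
  using set_update_subset_insert[of xs i a] by (auto simp: tuples_def)

lemma ext_null_subset:
  assumes "subspace S"
  shows "ext_null k (vs S) \<subseteq> free_on_tuples k (vs S)"
proof -
  note sub = free.subspace_diff[OF subspace_free_on_tuples] free.subspace_scale[OF subspace_free_on_tuples]
  have "ext_relators k (vs S) \<subseteq> free_on_tuples k (vs S)"
    unfolding ext_relators_def using subspace_add[OF assms] subspace_scale[OF assms]
    by (auto intro!: sub generator_in_free_on_tuples tuples_update)
  then show ?thesis
    unfolding ext_null_def by (rule free.span_minimal[OF _ subspace_free_on_tuples])
qed

lemma prepend_add_ext_null:
  assumes "x \<in> S" "y \<in> S" "q \<in> free_on_tuples k (vs S)"
  shows "prepend (x + y) q - prepend x q - prepend y q \<in> ext_null (Suc k) (vs S)"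
proof -
  let ?X = "{q. prepend (x + y) q - prepend x q - prepend y q \<in> ext_null (Suc k) (vs S)}"
  have "free.subspace ?X"
  proof (rule free.subspaceI)
    show "0 \<in> ?X"
      using free.subspace_0[OF subspace_ext_null] by (simp add: free_extend_zero)
    show "a + b \<in> ?X" if "a \<in> ?X" "b \<in> ?X" for a b
      using that free.subspace_add[OF subspace_ext_null, of "prepend (x + y) a - prepend x a - prepend y a"
          _ _ "prepend (x + y) b - prepend x b - prepend y b"]
      by (simp add: free_extend_add algebra_simps)
    show "free_scale c a \<in> ?X" if "a \<in> ?X" for c a
      using that free.subspace_scale[OF subspace_ext_null, of "prepend (x + y) a - prepend x a - prepend y a"]
      by (simp add: free_extend_free_scale free.scale_right_diff_distrib)
  qed
  moreover have "generator xs \<in> ?X" if "xs \<in> tuples k (vs S)" for xs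
    using ext_null_add[of "x # xs" "Suc k" "vs S" 0 x y] assms that
    by (simp add: free_extend_single tuples_Suc_iff)
  ultimately show ?thesis
    using free_on_tuples_induct[OF assms(3), of ?X] by blast
qed

lemma prepend_scale_ext_null:
  assumes "x \<in> S" "q \<in> free_on_tuples k (vs S)"
  shows "prepend (scale c x) q - free_scale c (prepend x q) \<in> ext_null (Suc k) (vs S)"
proof -
  let ?X = "{q. prepend (scale c x) q - free_scale c (prepend x q) \<in> ext_null (Suc k) (vs S)}"
  have "free.subspace ?X"
  proof (rule free.subspaceI)
    show "0 \<in> ?X"
      using free.subspace_0[OF subspace_ext_null] by (simp add: free_extend_zero)
    show "a + b \<in> ?X" if "a \<in> ?X" "b \<in> ?X" for a b
      using that free.subspace_add[OF subspace_ext_null, of "prepend (scale c x) a - free_scale c (prepend x a)"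
          _ _ "prepend (scale c x) b - free_scale c (prepend x b)"]
      by (simp add: free_extend_add algebra_simps free.scale_right_distrib)
    show "free_scale d a \<in> ?X" if "a \<in> ?X" for d a
      using free.subspace_scale[OF subspace_ext_null that[unfolded mem_Collect_eq], where c = d]
      by (simp add: free_extend_free_scale free.scale_right_diff_distrib mult.commute)
  qed
  moreover have "generator xs \<in> ?X" if "xs \<in> tuples k (vs S)" for xs
    using ext_null_scale[of "x # xs" "Suc k" "vs S" 0 x c] assms that
    by (simp add: free_extend_single tuples_Suc_iff)
  ultimately show ?thesis
    using free_on_tuples_induct[OF assms(2), of ?X] by blast
qed

lemma prepend_prepend_ext_null:
  assumes "x \<in> S" "q \<in> free_on_tuples k (vs S)"
  shows "prepend x (prepend x q) \<in> ext_null (Suc (Suc k)) (vs S)"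
proof -
  let ?X = "{q. prepend x (prepend x q) \<in> ext_null (Suc (Suc k)) (vs S)}"
  have "free.subspace ?X"
    using subspace_ext_null[of "Suc (Suc k)" "vs S"]
    by (auto simp: free.subspace_def free_extend_zero free_extend_add free_extend_free_scale)
  moreover have "generator xs \<in> ?X" if "xs \<in> tuples k (vs S)" for xs
    using ext_null_alt[of "x # x # xs" "Suc (Suc k)" "vs S" 0 1] assms that
    by (simp add: free_extend_single tuples_Suc_iff)
  ultimately show ?thesis
    using free_on_tuples_induct[OF assms(2), of ?X] by blast
qed

text \<open>Polarisation of the square of \<open>x + y\<close>. Prepending is additive in the vector
  only modulo the relations, so each expansion contributes an element of the null space.\<close>

lemma prepend_anticommute_ext_null:
  assumes "subspace S" "x \<in> S" "y \<in> S" "q \<in> free_on_tuples k (vs S)"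
  shows "prepend x (prepend y q) + prepend y (prepend x q) \<in> ext_null (Suc (Suc k)) (vs S)"
proof -
  let ?N = "ext_null (Suc (Suc k)) (vs S)"
  let ?z = "x + y"
  have z: "?z \<in> S"
    using subspace_add[OF assms(1-3)] .
  have F: "prepend w q \<in> free_on_tuples (Suc k) (vs S)" if "w \<in> S" for w
    using prepend_free_on_tuples[of w "vs S"] assms(4) that by simp
  note add = free.subspace_add[OF subspace_ext_null[of "Suc (Suc k)" "vs S"]]
    and diff = free.subspace_diff[OF subspace_ext_null[of "Suc (Suc k)" "vs S"]]
  have 1: "prepend ?z (prepend ?z q) \<in> ?N"
    using prepend_prepend_ext_null z assms(4) .
  have 2: "prepend ?z (prepend ?z q - prepend x q - prepend y q) \<in> ?N"
    using prepend_ext_null[of ?z "vs S", OF _ prepend_add_ext_null] z assms(2-4) by simp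
  have 3: "prepend ?z (prepend x q) - prepend x (prepend x q) - prepend y (prepend x q) \<in> ?N"
    "prepend ?z (prepend y q) - prepend x (prepend y q) - prepend y (prepend y q) \<in> ?N"
    using prepend_add_ext_null F assms(2,3) by auto
  have 4: "prepend x (prepend x q) \<in> ?N" "prepend y (prepend y q) \<in> ?N"
    using prepend_prepend_ext_null assms by auto
  have "prepend x (prepend y q) + prepend y (prepend x q) =
      prepend ?z (prepend ?z q) - prepend ?z (prepend ?z q - prepend x q - prepend y q)
      - (prepend ?z (prepend x q) - prepend x (prepend x q) - prepend y (prepend x q))
      - (prepend ?z (prepend y q) - prepend x (prepend y q) - prepend y (prepend y q))
      - prepend x (prepend x q) - prepend y (prepend y q)"
    by (simp add: free_extend_diff free_extend_add algebra_simps)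
  also have "\<dots> \<in> ?N"
    by (intro diff 1 2 3 4)
  finally show ?thesis .
qed

text \<open>Modulo the relations, a combination of \<open>k\<close>-tuples from \<open>span (insert b S)\<close> is of the form
  \<open>b \<and> q + r\<close>, where \<open>q\<close> and \<open>r\<close> only involve vectors from \<open>S\<close>.\<close>

definition leading :: "'v \<Rightarrow> nat \<Rightarrow> 'v set \<Rightarrow> ('v list \<Rightarrow>\<^sub>0 'k) set" where
  "leading b k S = (case k of 0 \<Rightarrow> {0} | Suc n \<Rightarrow> prepend b ` free_on_tuples n (vs S))"

definition split_form :: "'v \<Rightarrow> nat \<Rightarrow> 'v set \<Rightarrow> ('v list \<Rightarrow>\<^sub>0 'k) set" where
  "split_form b k S = {p. \<exists>u\<in>leading b k S. \<exists>r\<in>free_on_tuples k (vs S).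
     p - (u + r) \<in> ext_null k (vs (span (insert b S)))}"

lemma subspace_leading: "free.subspace (leading b k S)"
proof (cases k)
  case 0
  then show ?thesis
    by (simp add: leading_def free.subspace_single_0)
next
  case (Suc n)
  have "0 \<in> prepend b ` free_on_tuples n (vs S)"
    using free.subspace_0[OF subspace_free_on_tuples] by (force simp: free_extend_zero)
  moreover have "prepend b x + prepend b y \<in> prepend b ` free_on_tuples n (vs S)"
    if "x \<in> free_on_tuples n (vs S)" "y \<in> free_on_tuples n (vs S)" for x y
    using free.subspace_add[OF subspace_free_on_tuples that] by (simp flip: free_extend_add)
  moreover have "free_scale c (prepend b x) \<in> prepend b ` free_on_tuples n (vs S)"
    if "x \<in> free_on_tuples n (vs S)" for x c
    using free.subspace_scale[OF subspace_free_on_tuples that] by (simp flip: free_extend_free_scale)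
  ultimately show ?thesis
    using Suc by (auto simp: free.subspace_def leading_def)
qed

lemma subspace_split_form: "free.subspace (split_form b k S)"
proof (rule free.subspaceI)
  note N = subspace_ext_null[of k "vs (span (insert b S))"]
  note L = subspace_leading[of b k S]
  note F = subspace_free_on_tuples[of k "vs S"]
  show "0 \<in> split_form b k S"
    unfolding split_form_def using free.subspace_0[OF N] free.subspace_0[OF L] free.subspace_0[OF F]
    by force
  show "x + y \<in> split_form b k S" if xy: "x \<in> split_form b k S" "y \<in> split_form b k S" for x y
  proof -
    obtain u r where x: "u \<in> leading b k S" "r \<in> free_on_tuples k (vs S)"
      "x - (u + r) \<in> ext_null k (vs (span (insert b S)))"
      using xy(1) unfolding split_form_def by blast
    obtain u' r' where y: "u' \<in> leading b k S" "r' \<in> free_on_tuples k (vs S)"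
      "y - (u' + r') \<in> ext_null k (vs (span (insert b S)))"
      using xy(2) unfolding split_form_def by blast
    have eq: "(x + y) - ((u + u') + (r + r')) = (x - (u + r)) + (y - (u' + r'))"
      by (simp add: algebra_simps)
    have "(x + y) - ((u + u') + (r + r')) \<in> ext_null k (vs (span (insert b S)))"
      unfolding eq by (rule free.subspace_add[OF N x(3) y(3)])
    then show ?thesis
      unfolding split_form_def using free.subspace_add[OF L x(1) y(1)] free.subspace_add[OF F x(2) y(2)]
      by blast
  qed
  show "free_scale c x \<in> split_form b k S" if xs: "x \<in> split_form b k S" for c x
  proof -
    obtain u r where x: "u \<in> leading b k S" "r \<in> free_on_tuples k (vs S)"
      "x - (u + r) \<in> ext_null k (vs (span (insert b S)))"
      using xs unfolding split_form_def by blast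
    have "free_scale c x - (free_scale c u + free_scale c r) \<in> ext_null k (vs (span (insert b S)))"
      using free.subspace_scale[OF N x(3), of c]
      by (simp add: free.scale_right_diff_distrib free.scale_right_distrib)
    then show ?thesis
      unfolding split_form_def using free.subspace_scale[OF L x(1)] free.subspace_scale[OF F x(2)]
      by blast
  qed
qed

lemma ext_null_subset_split_form: "ext_null k (vs (span (insert b S))) \<subseteq> split_form b k S"
  unfolding split_form_def
  using free.subspace_0[OF subspace_leading[of b k S]] free.subspace_0[OF subspace_free_on_tuples[of k "vs S"]]
  by force

lemma split_formI:
  assumes "p - q \<in> ext_null k (vs (span (insert b S)))" "q \<in> split_form b k S"
  shows "p \<in> split_form b k S"
proof -
  have "p = (p - q) + q"
    by simp
  then show ?thesis
    using free.subspace_add[OF subspace_split_form _ assms(2)] assms(1) ext_null_subset_split_form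
    by (metis subsetD)
qed

text \<open>Write \<open>x = c b + y\<close> with \<open>y\<close> from \<open>S\<close> and split
  \<open>p\<close> into a part with leading \<open>b\<close> and a rest. Prepending \<open>x\<close>
  to the rest is unproblematic. For the part with leading \<open>b\<close>, a second
  \<open>b\<close> gives a null element, and \<open>y\<close> is moved behind \<open>b\<close> with
  a sign.\<close>

lemma prepend_split_form:
  assumes "subspace S" "x \<in> span (insert b S)" "p \<in> split_form b k S"
  shows "prepend x p \<in> split_form b (Suc k) S"
proof -
  let ?S = "span (insert b S)"
  let ?N = "\<lambda>k. ext_null k (vs ?S)"
  note sub = subspace_split_form[of b "Suc k" S]
  obtain c where c: "x - scale c b \<in> S"
    using assms(1,2) by (auto simp: span_insert span_eq_iff[THEN iffD2])
  define y where "y = x - scale c b"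
  have x: "x = scale c b + y" and y: "y \<in> S"
    using c by (simp_all add: y_def)
  have SS: "S \<subseteq> ?S" and b: "b \<in> ?S"
    using span_superset[of "insert b S"] by auto
  have F: "free_on_tuples n (vs S) \<subseteq> free_on_tuples n (vs ?S)" for n
    using SS by (intro free_on_tuples_mono) simp
  have rem: "prepend x q - (free_scale c (prepend b q) + prepend y q) \<in> ?N (Suc n)"
    if "q \<in> free_on_tuples n (vs ?S)" for q n
  proof -
    have "prepend (scale c b + y) q - prepend (scale c b) q - prepend y q \<in> ?N (Suc n)"
      using prepend_add_ext_null[of "scale c b" ?S y q n] b y SS that span_scale by auto
    moreover have "prepend (scale c b) q - free_scale c (prepend b q) \<in> ?N (Suc n)"
      using prepend_scale_ext_null[OF b that] .
    ultimately have "(prepend (scale c b + y) q - prepend (scale c b) q - prepend y q) +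
        (prepend (scale c b) q - free_scale c (prepend b q)) \<in> ?N (Suc n)"
      by (rule free.subspace_add[OF subspace_ext_null])
    then show ?thesis
      by (simp add: x algebra_simps)
  qed
  obtain u r where u: "u \<in> leading b k S" and r: "r \<in> free_on_tuples k (vs S)"
    and ur: "p - (u + r) \<in> ?N k"
    using assms(3) unfolding split_form_def by blast
  have lead: "prepend b q \<in> split_form b (Suc k) S" if "q \<in> free_on_tuples k (vs S)" for q
  proof -
    have "prepend b q \<in> leading b (Suc k) S"
      using that by (simp add: leading_def)
    moreover have "prepend b q - (prepend b q + 0) \<in> ?N (Suc k)"
      using free.subspace_0[OF subspace_ext_null] by simp
    ultimately show ?thesis
      unfolding split_form_def using free.subspace_0[OF subspace_free_on_tuples] by blast
  qed
  have rest: "q \<in> split_form b (Suc k) S" if "q \<in> free_on_tuples (Suc k) (vs S)" for q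
  proof -
    have "q - (0 + q) \<in> ?N (Suc k)"
      using free.subspace_0[OF subspace_ext_null] by simp
    then show ?thesis
      unfolding split_form_def using free.subspace_0[OF subspace_leading] that by blast
  qed
  have prepend_r: "prepend x r \<in> split_form b (Suc k) S"
  proof (rule split_formI[OF rem])
    show "r \<in> free_on_tuples k (vs ?S)"
      using r F by blast
    have "prepend y r \<in> free_on_tuples (Suc k) (vs S)"
      using prepend_free_on_tuples[of y "vs S"] y r by simp
    then show "free_scale c (prepend b r) + prepend y r \<in> split_form b (Suc k) S"
      using free.subspace_add[OF sub free.subspace_scale[OF sub lead[OF r]] rest] by blast
  qed
  have prepend_u: "prepend x u \<in> split_form b (Suc k) S"
  proof (cases k)
    case 0
    then have "prepend x u = 0"
      using u by (simp add: leading_def free_extend_zero)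
    then show ?thesis
      using free.subspace_0[OF sub] by simp
  next
    case (Suc n)
    then obtain q where q: "q \<in> free_on_tuples n (vs S)" "u = prepend b q"
      using u by (auto simp: leading_def)
    have q': "q \<in> free_on_tuples n (vs ?S)"
      using q(1) F by blast
    have u': "u \<in> free_on_tuples k (vs ?S)"
      using prepend_free_on_tuples[of b "vs ?S" q n] b q' q(2) Suc by simp
    show ?thesis
    proof (rule split_formI[OF rem[OF u']])
      have "free_scale c (prepend b u) \<in> split_form b (Suc k) S"
        using free.subspace_scale[OF sub] prepend_prepend_ext_null[OF b q'] q(2) Suc
          ext_null_subset_split_form by blast
      moreover have "prepend y u \<in> split_form b (Suc k) S"
      proof (rule split_formI)
        show "prepend y u - (- prepend b (prepend y q)) \<in> ?N (Suc k)"
          using prepend_anticommute_ext_null[of ?S y b q n] subspace_span b y SS q' q(2) Suc by auto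
        have "prepend y q \<in> free_on_tuples k (vs S)"
          using prepend_free_on_tuples[of y "vs S"] y q(1) Suc by simp
        then show "- prepend b (prepend y q) \<in> split_form b (Suc k) S"
          by (intro free.subspace_neg[OF sub] lead)
      qed
      ultimately show "free_scale c (prepend b u) + prepend y u \<in> split_form b (Suc k) S"
        by (rule free.subspace_add[OF sub])
    qed
  qed
  have "prepend x (p - (u + r)) \<in> ?N (Suc k)"
    using prepend_ext_null[of x "vs ?S"] assms(2) ur by simp
  then have "prepend x p - (prepend x u + prepend x r) \<in> ?N (Suc k)"
    by (simp add: free_extend_diff free_extend_add)
  then show ?thesis
    using split_formI free.subspace_add[OF sub prepend_u prepend_r] by blast
qed

lemma free_on_tuples_subset_split_form:
  assumes "subspace S"
  shows "free_on_tuples k (vs (span (insert b S))) \<subseteq> split_form b k S"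
proof
  fix p assume "p \<in> free_on_tuples k (vs (span (insert b S)))"
  then show "p \<in> split_form b k S"
  proof (rule free_on_tuples_induct[OF _ subspace_split_form])
    fix xs assume "xs \<in> tuples k (vs (span (insert b S)))"
    then show "generator xs \<in> split_form b k S"
    proof (induction xs arbitrary: k)
      case Nil
      then have "k = 0"
        by (simp add: tuples_def)
      moreover have "generator [] \<in> free_on_tuples 0 (vs S)"
        by (intro generator_in_free_on_tuples) (simp add: tuples_def)
      moreover have "generator [] - (0 + generator []) \<in> ext_null 0 (vs (span (insert b S)))"
        using free.subspace_0[OF subspace_ext_null] by simp
      ultimately show ?case
        unfolding split_form_def leading_def by (simp, intro bexI[of _ "generator []"]) simp_all
    next
      case (Cons x xs)
      then obtain n where n: "k = Suc n"
        by (auto simp: tuples_def)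
      have x: "x \<in> span (insert b S)" and xs: "xs \<in> tuples n (vs (span (insert b S)))"
        using Cons.prems n by (simp_all add: tuples_Suc_iff)
      show ?case
        using prepend_split_form[OF assms x Cons.IH[OF xs]] n by (simp add: free_extend_single)
    qed
  qed
qed

section \<open>Injectivity of the comparison with alternating functions\<close>

lemma lin_ext_wedges_0:
  assumes "p \<in> free_on_tuples 0 W" "lin_ext wedges p = 0"
  shows "p = 0"
proof -
  have keys: "Poly_Mapping.keys p \<subseteq> {[]}"
    using assms(1) by (auto simp: free_on_tuples_def tuples_def)
  then have "lin_ext wedges p = smult_fun (Poly_Mapping.lookup p []) vacuum"
    by (simp add: lin_ext_superset[of "{[]}"])
  then have "Poly_Mapping.lookup p [] = 0"
    using assms(2) by (simp add: smult_fun_eq_0_iff vacuum_nonzero)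
  then have "Poly_Mapping.lookup p x = 0" for x
    using keys in_keys_iff[of x p] by (cases "x = []") auto
  then show ?thesis
    by (intro poly_mapping_eqI) simp
qed

text \<open>Modulo relations, \<open>p\<close> is \<open>b\<close> wedged with \<open>q\<close>,
  plus \<open>r\<close>, where \<open>q\<close> and \<open>r\<close> avoid \<open>b\<close>.
  Contraction with a dual vector of \<open>b\<close> orthogonal to \<open>bs\<close> recovers the
  function of \<open>q\<close>. Hence \<open>q\<close> and \<open>r\<close> both have zero functions
  and the induction hypothesis applies to each.\<close>

lemma lin_ext_wedges_inj_span:
  assumes "distinct bs" "independent (set bs)" "p \<in> free_on_tuples k (vs (span (set bs)))"
    and "lin_ext wedges p = 0"
  shows "p \<in> ext_null k (vs (span (set bs)))"
  using assms
proof (induction bs arbitrary: k p)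
  case Nil
  show ?case
  proof (cases k)
    case 0
    then show ?thesis
      using Nil lin_ext_wedges_0 free.subspace_0[OF subspace_ext_null] by metis
  next
    case (Suc n)
    show ?thesis
    proof (rule free_on_tuples_induct[OF Nil.prems(3) subspace_ext_null])
      fix xs assume xs: "xs \<in> tuples k (vs (span (set [])))"
      then have "xs ! 0 \<in> set xs"
        using Suc by (intro nth_mem) (simp add: tuples_def)
      then have "xs ! 0 = 0"
        using xs by (auto simp: tuples_def)
      \<comment> \<open>This presents \<open>xs\<close> as an update by a multiple of 0, so that the
        relation for the scalar 0 shows its generator to be null.\<close>
      then have "xs[0 := 0] = xs"
        by (metis list_update_id)
      then show "generator xs \<in> ext_null k (vs (span (set [])))"
        using ext_null_scale[OF xs, of 0 0 0] Suc by simp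
    qed
  qed
next
  case (Cons b bs)
  let ?S = "span (set bs)"
  have b: "b \<notin> ?S" and ind: "distinct bs" "independent (set bs)"
    using Cons.prems(1,2) independent_insert[of b "set bs"] by (auto split: if_splits)
  have span: "span (insert b ?S) = span (set (b # bs))"
    by (simp add: span_insert span_span)
  show ?case
  proof (cases k)
    case 0
    then show ?thesis
      using Cons.prems lin_ext_wedges_0 free.subspace_0[OF subspace_ext_null] by metis
  next
    case (Suc n)
    have "p \<in> split_form b k ?S"
      using free_on_tuples_subset_split_form[of ?S k b] Cons.prems(3) span by auto
    then obtain q r where q: "q \<in> free_on_tuples n (vs ?S)" and r: "r \<in> free_on_tuples k (vs ?S)"
      and qr: "p - (prepend b q + r) \<in> ext_null k (vs (span (set (b # bs))))"
      using Suc span by (auto simp: split_form_def leading_def)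
    have "lin_ext wedges (p - (prepend b q + r)) = 0"
      using qr by (rule lin_ext_wedges_ext_null)
    then have "0 - (wdg b (lin_ext wedges q) + lin_ext wedges r) = 0"
      by (simp only: lin_ext_diff lin_ext_add lin_ext_wedges_prepend Cons.prems(4))
    then have sum: "wdg b (lin_ext wedges q) + lin_ext wedges r = 0"
      by (metis diff_0 neg_equal_0_iff_equal)
    obtain d where d: "B d b = 1" "\<forall>s\<in>set bs. B d s = 0"
      using exists_dual_vector[OF b] by blast
    then have d': "B d s = 0" if "s \<in> ?S" for s
      using B_span_right that by blast
    have "contr d (wdg b (lin_ext wedges q) + lin_ext wedges r) = lin_ext wedges q"
      using contr_lin_ext_perp[OF q d'] contr_lin_ext_perp[OF r d'] d(1) by (simp add: contr_wdg)
    then have q0: "lin_ext wedges q = 0"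
      using sum by simp
    then have r0: "lin_ext wedges r = 0"
      using sum by simp
    have mono: "ext_null m (vs ?S) \<subseteq> ext_null m (vs (span (set (b # bs))))" for m
      by (intro ext_null_mono span_mono) auto
    have "prepend b q \<in> ext_null k (vs (span (set (b # bs))))"
      using prepend_ext_null[of b "vs (span (set (b # bs)))" q n] Cons.IH[OF ind q q0] mono Suc span_base[of b "set (b # bs)"]
      by auto
    moreover have "r \<in> ext_null k (vs (span (set (b # bs))))"
      using Cons.IH[OF ind r r0] mono by blast
    ultimately have "(p - (prepend b q + r)) + (prepend b q + r) \<in> ext_null k (vs (span (set (b # bs))))"
      by (intro free.subspace_add[OF subspace_ext_null] qr)
    then show ?thesis
      by simp
  qed
qed

lemma lin_ext_wedges_inj:
  assumes "subspace S" "p \<in> free_on_tuples k (vs S)" "lin_ext wedges p = 0"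
  shows "p \<in> ext_null k (vs S)"
proof -
  obtain T where T: "T \<subseteq> S" "independent T" "S \<subseteq> span T"
    using maximal_independent_subset by blast
  then have "span T = S"
    using span_minimal[OF T(1) assms(1)] by blast
  moreover obtain bs where "set bs = T" "distinct bs"
    using finite_distinct_list[OF finiteI_independent[OF T(2)]] by blast
  ultimately show ?thesis
    using lin_ext_wedges_inj_span[of bs p k] T(2) assms(2,3) by simp
qed


lemma wdg_sum: "wdg x (\<Sum>i\<in>A. g i) = (\<Sum>i\<in>A. wdg x (g i))"
  by (induction A rule: infinite_finite_induct) simp_all

subsection \<open>The maps to the quotients\<close>

text \<open>Unrolls the anticommutation relation into the explicit alternating sum by which the
  contraction of the exterior power is defined.\<close>

lemma contr_wedges:
  "contr v (wedges xs) =
     (\<Sum>i<length xs. smult_fun ((- 1) ^ i * B v (xs ! i)) (wedges (take i xs @ drop (Suc i) xs)))"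
proof (induction xs)
  case (Cons x xs)
  have neg: "smult_fun (- c) \<phi> = - smult_fun c \<phi>" for c and \<phi> :: "'v list \<Rightarrow> 'k"
    by (simp add: fun_eq_iff pointwise)
  have "contr v (wedges (x # xs)) = smult_fun (B v x) (wedges xs) - wdg x (contr v (wedges xs))"
    by (simp add: contr_wdg)
  then show ?case
    unfolding Cons.IH
    by (simp add: sum.lessThan_Suc_shift wdg_sum neg sum_negf del: sum.lessThan_Suc)
qed simp

definition contraction_gen :: "'v \<Rightarrow> 'v list \<Rightarrow> ('v list \<Rightarrow>\<^sub>0 'k)" where
  "contraction_gen v xs = (\<Sum>i<length xs.
     free_scale ((- 1) ^ i * B v (xs ! i)) (generator (take i xs @ drop (Suc i) xs)))"

lemma lin_ext_contraction_gen:
  "lin_ext wedges (free_extend (contraction_gen v) p) = contr v (lin_ext wedges p)"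
proof -
  have "lin_ext wedges (contraction_gen v xs) = contr v (wedges xs)" for xs
    by (simp add: contr_wedges contraction_gen_def lin_ext_sum lin_ext_free_scale lin_ext_single)
  then have "lin_ext wedges (free_extend (contraction_gen v) p) = lin_ext (\<lambda>xs. contr v (wedges xs)) p"
    by (simp add: lin_ext_free_extend)
  also have "\<dots> = contr v (lin_ext wedges p)"
    by (rule lin_ext_linear) simp_all
  finally show ?thesis .
qed

lemma contraction_gen_in_free_on_tuples:
  assumes "p \<in> free_on_tuples (Suc n) (vs UNIV)"
  shows "free_extend (contraction_gen v) p \<in> free_on_tuples n (vs UNIV)"
proof (rule free_extend_in_subspace[OF subspace_free_on_tuples assms])
  fix xs assume xs: "xs \<in> tuples (Suc n) (vs UNIV)"
  show "contraction_gen v xs \<in> free_on_tuples n (vs UNIV)"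
    unfolding contraction_gen_def
  proof (intro free.subspace_sum[OF subspace_free_on_tuples]
      free.subspace_scale[OF subspace_free_on_tuples] generator_in_free_on_tuples)
    fix i assume "i \<in> {..<length xs}"
    then show "take i xs @ drop (Suc i) xs \<in> tuples n (vs UNIV)"
      using xs by (auto simp: tuples_def)
  qed
qed

text \<open>Well-definedness needs no case distinction over the relations: the function of a null
  element is 0, hence so is its contraction, and injectivity of the comparison makes the contracted
  element null.\<close>

lemma contraction_coset:
  "contraction scale B v (Suc n) (coset (ext_null (Suc n) (vs UNIV)) p) =
     coset (ext_null n (vs UNIV)) (free_extend (contraction_gen v) p)"
proof -
  have "free_extend (contraction_gen v) q \<in> ext_null n (vs UNIV)" if q: "q \<in> ext_null (Suc n) (vs UNIV)" for q
  proof (rule lin_ext_wedges_inj[OF subspace_UNIV])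
    show "free_extend (contraction_gen v) q \<in> free_on_tuples n (vs UNIV)"
      by (rule contraction_gen_in_free_on_tuples[OF subsetD[OF ext_null_subset[OF subspace_UNIV] q]])
    show "lin_ext wedges (free_extend (contraction_gen v) q) = 0"
      using lin_ext_wedges_ext_null[OF q] by (simp add: lin_ext_contraction_gen)
  qed
  then have "ext_lift n (vs UNIV) (contraction_gen v) (coset (ext_null (Suc n) (vs UNIV)) p) =
      coset (ext_null n (vs UNIV)) (free_extend (contraction_gen v) p)"
    by (intro ext_lift_coset free.subspace_0[OF subspace_ext_null])
  then show ?thesis
    by (simp add: contraction_def contraction_gen_def[abs_def])
qed

lemma subspace_perp_vector: "subspace (perp B v)"
  by (auto simp: perp_def subspace_def)

text \<open>A vector \<open>d\<close> with \<open>B v d = 1\<close> complements the hyperplane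
  orthogonal to \<open>v\<close>. Splitting off \<open>d\<close> writes \<open>p\<close> as
  \<open>d\<close> wedged with \<open>q\<close>, plus \<open>r\<close>, and contraction with
  \<open>v\<close> leaves exactly \<open>q\<close>.\<close>

lemma exists_perp_preimage:
  assumes "v \<noteq> 0" "p \<in> free_on_tuples (Suc n) (vs UNIV)"
  shows "\<exists>q\<in>free_on_tuples n (vs (perp B v)). lin_ext wedges q = contr v (lin_ext wedges p)"
proof -
  obtain y where y: "B v y \<noteq> 0"
    using assms(1) nondegenerate by (auto simp: nondegenerate_form_def)
  define d where "d = scale (1 / B v y) y"
  have d: "B v d = 1"
    using y by (simp add: d_def)
  have "x \<in> span (insert d (perp B v))" for x
  proof -
    have "x - scale (B v x) d \<in> perp B v"
      using d by (simp add: perp_def)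
    from span_base[OF this] show ?thesis
      unfolding span_insert by blast
  qed
  then have "span (insert d (perp B v)) = UNIV"
    by blast
  then have "p \<in> split_form d (Suc n) (perp B v)"
    using free_on_tuples_subset_split_form[OF subspace_perp_vector, of "Suc n" d v] assms(2) by auto
  then obtain q r where q: "q \<in> free_on_tuples n (vs (perp B v))"
    and r: "r \<in> free_on_tuples (Suc n) (vs (perp B v))"
    and qr: "p - (prepend d q + r) \<in> ext_null (Suc n) (vs (span (insert d (perp B v))))"
    by (auto simp: split_form_def leading_def)
  have "lin_ext wedges (p - (prepend d q + r)) = 0"
    using qr by (rule lin_ext_wedges_ext_null)
  then have p: "lin_ext wedges p = wdg d (lin_ext wedges q) + lin_ext wedges r"
    by (simp add: lin_ext_diff lin_ext_add lin_ext_wedges_prepend)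
  have "contr v (lin_ext wedges q) = 0" "contr v (lin_ext wedges r) = 0"
    using contr_lin_ext_perp[OF q, of v] contr_lin_ext_perp[OF r, of v] by (auto simp: perp_def)
  then have "contr v (lin_ext wedges p) = lin_ext wedges q"
    using d by (simp add: p contr_wdg)
  then show ?thesis
    using q by auto
qed

lemma ext_map_inclusion:
  assumes "S \<subseteq> S'"
  shows "ext_map k (vs S') (\<lambda>x. x) (coset (ext_null k (vs S)) q) = coset (ext_null k (vs S')) q"
proof -
  have "ext_map k (vs S') (\<lambda>x. x) (coset (ext_null k (vs S)) q) =
      ext_lift k (vs S') generator (coset (ext_null k (vs S)) q)"
    by (simp add: ext_map_def)
  also have "\<dots> = coset (ext_null k (vs S')) (free_extend generator q)"
    using ext_null_mono[OF assms] free.subspace_0[OF subspace_ext_null]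
    by (intro ext_lift_coset) (auto simp: free_extend_generator)
  finally show ?thesis
    by (simp add: free_extend_generator)
qed

text \<open>The inverse of the inclusion is evaluated through functions: both exterior powers embed
  into the alternating functions on \<open>V\<close>, where the inclusion is the identity and
  therefore injective.\<close>

lemma perp_contraction_coset:
  assumes "v \<noteq> 0" "p \<in> free_on_tuples (Suc n) (vs UNIV)"
  shows "\<exists>q\<in>free_on_tuples n (vs (perp B v)). lin_ext wedges q = contr v (lin_ext wedges p) \<and>
    perp_contraction scale B v (Suc n) (coset (ext_null (Suc n) (vs UNIV)) p) =
      coset (ext_null n (vs (perp B v))) q"
proof -
  let ?S = "perp B v"
  let ?A = "vecs (ext_power n (vs ?S))"
  let ?i = "ext_map n (vs UNIV) (\<lambda>x. x)"
  obtain q where q: "q \<in> free_on_tuples n (vs ?S)" "lin_ext wedges q = contr v (lin_ext wedges p)"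
    using exists_perp_preimage[OF assms] by blast
  have F: "free_on_tuples n (vs ?S) \<subseteq> free_on_tuples n (vs UNIV)"
    by (rule free_on_tuples_mono) simp
  have inj: "inj_on ?i ?A"
  proof (rule inj_onI)
    fix X Y assume "X \<in> ?A" "Y \<in> ?A" "?i X = ?i Y"
    then obtain x y where x: "x \<in> free_on_tuples n (vs ?S)" "X = coset (ext_null n (vs ?S)) x"
      and y: "y \<in> free_on_tuples n (vs ?S)" "Y = coset (ext_null n (vs ?S)) y"
      and eq: "coset (ext_null n (vs UNIV)) x = coset (ext_null n (vs UNIV)) y"
      by (auto simp: vecs_ext_power ext_map_inclusion)
    have "x - y \<in> ext_null n (vs UNIV)"
      using eq by (simp add: coset_eq_iff[OF subspace_ext_null])
    then have "x - y \<in> ext_null n (vs ?S)"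
      using lin_ext_wedges_inj[OF subspace_perp_vector] lin_ext_wedges_ext_null
        free.subspace_diff[OF subspace_free_on_tuples x(1) y(1)] by blast
    then show "X = Y"
      by (simp add: x y coset_eq_iff[OF subspace_ext_null])
  qed
  have "q - free_extend (contraction_gen v) p \<in> ext_null n (vs UNIV)"
  proof (rule lin_ext_wedges_inj[OF subspace_UNIV])
    show "q - free_extend (contraction_gen v) p \<in> free_on_tuples n (vs UNIV)"
      using q(1) F contraction_gen_in_free_on_tuples[OF assms(2)]
      by (intro free.subspace_diff[OF subspace_free_on_tuples]) auto
  qed (simp add: lin_ext_diff lin_ext_contraction_gen q(2))
  then have "?i (coset (ext_null n (vs ?S)) q) =
      contraction scale B v (Suc n) (coset (ext_null (Suc n) (vs UNIV)) p)"
    by (simp add: ext_map_inclusion contraction_coset coset_eq_iff[OF subspace_ext_null])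
  moreover have "coset (ext_null n (vs ?S)) q \<in> ?A"
    using q(1) by (simp add: vecs_ext_power)
  ultimately have "the_inv_into ?A ?i (contraction scale B v (Suc n)
      (coset (ext_null (Suc n) (vs UNIV)) p)) = coset (ext_null n (vs ?S)) q"
    by (rule the_inv_into_f_eq[OF inj])
  then show ?thesis
    using q by (intro bexI[of _ q]) (simp_all add: perp_contraction_def)
qed

definition representative :: "'v set \<Rightarrow> 'v" where
  "representative X = (SOME x. x \<in> X)"

lemma mem_coset_span: "x \<in> coset (span {v}) y \<longleftrightarrow> (\<exists>c. x - y = scale c v)"
proof -
  have "x \<in> coset (span {v}) y \<longleftrightarrow> (\<exists>c. x = y + scale c v)"
    unfolding coset_def span_singleton by blast
  then show ?thesis
    by (simp add: diff_eq_eq add.commute)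
qed

lemma mem_cosetD: "x \<in> coset (span {v}) y \<Longrightarrow> \<exists>c. x = y + scale c v"
  unfolding coset_def span_singleton by blast

lemma representative_coset: "\<exists>c. representative (coset (span {v}) x) - x = scale c v"
proof -
  have "x \<in> coset (span {v}) x"
    by (rule coset_self[OF span_zero])
  then have "representative (coset (span {v}) x) \<in> coset (span {v}) x"
    unfolding representative_def by (rule someI)
  then show ?thesis
    by (simp add: mem_coset_span)
qed

lemma perp_quotient_add:
  "vadd (perp_quotient scale B v) (coset (span {v}) x) (coset (span {v}) y) = coset (span {v}) (x + y)"
proof (intro set_eqI iffI)
  fix z assume "z \<in> vadd (perp_quotient scale B v) (coset (span {v}) x) (coset (span {v}) y)"
  then obtain a b where "a \<in> coset (span {v}) x" "b \<in> coset (span {v}) y" "z = a + b"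
    by (auto simp: perp_quotient_def quotient_vs_def)
  then obtain c d where "z = (x + scale c v) + (y + scale d v)"
    using mem_cosetD by blast
  then have "z - (x + y) = scale (c + d) v"
    by (simp add: algebra_simps)
  then show "z \<in> coset (span {v}) (x + y)"
    unfolding mem_coset_span by blast
next
  fix z assume "z \<in> coset (span {v}) (x + y)"
  then obtain c where "z = (x + scale c v) + y"
    using mem_cosetD[of z v "x + y"] by (auto simp: algebra_simps)
  moreover have "x + scale c v \<in> coset (span {v}) x" "y \<in> coset (span {v}) y"
    by (auto simp: mem_coset_span intro: coset_self[OF span_zero])
  ultimately show "z \<in> vadd (perp_quotient scale B v) (coset (span {v}) x) (coset (span {v}) y)"
    unfolding perp_quotient_def quotient_vs_def by auto
qed

lemma perp_quotient_scale:
  "vscale (perp_quotient scale B v) c (coset (span {v}) x) = coset (span {v}) (scale c x)"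
proof (intro set_eqI iffI)
  fix z assume "z \<in> vscale (perp_quotient scale B v) c (coset (span {v}) x)"
  then obtain a n where "a \<in> coset (span {v}) x" "n \<in> span {v}" "z = scale c a + n"
    by (auto simp: perp_quotient_def quotient_vs_def)
  moreover from this obtain d where "a = x + scale d v"
    using mem_cosetD by blast
  moreover from \<open>n \<in> span {v}\<close> obtain e where "n = scale e v"
    unfolding span_singleton by blast
  ultimately have "z = scale c (x + scale d v) + scale e v"
    by simp
  then have "z - scale c x = scale (c * d + e) v"
    by (simp add: algebra_simps)
  then show "z \<in> coset (span {v}) (scale c x)"
    unfolding mem_coset_span by blast
next
  fix z assume "z \<in> coset (span {v}) (scale c x)"
  then obtain d where "z = scale c x + scale d v"
    using mem_cosetD by blast
  moreover have "x \<in> coset (span {v}) x"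
    by (rule coset_self[OF span_zero])
  moreover have "scale d v \<in> span {v}"
    by (intro span_scale span_base) simp
  ultimately show "z \<in> vscale (perp_quotient scale B v) c (coset (span {v}) x)"
    unfolding perp_quotient_def quotient_vs_def by auto
qed

lemma vecs_perp_quotient: "vecs (perp_quotient scale B v) = coset (span {v}) ` perp B v"
  by (simp add: perp_quotient_def quotient_vs_def)

lemma quotient_form_coset:
  assumes "B v v = 0" "x \<in> perp B v" "y \<in> perp B v"
  shows "quotient_form B (coset (span {v}) x) (coset (span {v}) y) = B x y"
proof -
  have *: "B a b = B x y" if ab: "a \<in> coset (span {v}) x" "b \<in> coset (span {v}) y" for a b
  proof -
    obtain c d where "a = x + scale c v" "b = y + scale d v"
      using mem_cosetD[OF ab(1)] mem_cosetD[OF ab(2)] by blast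
    then show ?thesis
      using assms by (simp add: perp_def B_commute[of x v])
  qed
  have self: "x \<in> coset (span {v}) x" "y \<in> coset (span {v}) y"
    by (rule coset_self[OF span_zero])+
  show ?thesis
    unfolding quotient_form_def
  proof (rule the_equality)
    show "\<forall>a\<in>coset (span {v}) x. \<forall>b\<in>coset (span {v}) y. B a b = B x y"
      using * by blast
    show "c = B x y" if "\<forall>a\<in>coset (span {v}) x. \<forall>b\<in>coset (span {v}) y. B a b = c" for c
      using that[rule_format, OF self] by simp
  qed
qed

text \<open>The choice of representatives does not matter because of the wedge product with \<open>v\<close>.\<close>

definition wedges_quotient :: "'v \<Rightarrow> 'v set list \<Rightarrow> 'v list \<Rightarrow> 'k" where
  "wedges_quotient v Xs = wdg v (wedges (map representative Xs))"

lemma wdg_wedges_update_cong: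
  assumes "i < length xs" "x - y = scale c v"
  shows "wdg v (wedges (xs[i := x])) = wdg v (wedges (xs[i := y]))"
proof (rule wdg_wedges_cong)
  show "list_all2 (\<lambda>x y. \<exists>c. x - y = scale c v) (xs[i := x]) (xs[i := y])"
    using assms by (auto simp: list_all2_conv_all_nth nth_list_update intro: exI[of _ 0])
qed

lemma wedges_quotient_ext_null:
  assumes "p \<in> ext_null k (perp_quotient scale B v)"
  shows "lin_ext (wedges_quotient v) p = 0"
proof (rule lin_ext_ext_null[OF _ _ _ assms])
  let ?W = "perp_quotient scale B v"
  let ?G = "\<lambda>xs. wdg v (wedges xs)"
  fix Xs assume Xs: "Xs \<in> tuples k ?W"
  define xs where "xs = map representative Xs"
  have len: "length xs = k"
    using Xs by (simp add: xs_def tuples_def)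
  \<comment> \<open>The choice of representatives is not linear. Behind the wedge with
    \<open>v\<close> it may be replaced by the given \<open>x\<close>, which reduces all relations
    to those for \<open>wedges\<close>.\<close>
  have upd: "wedges_quotient v (Xs[i := coset (span {v}) x]) = ?G (xs[i := x])" if "i < k" for i x
    using representative_coset[of v x] wdg_wedges_update_cong[of i xs] that len
    by (auto simp: wedges_quotient_def xs_def map_update)
  show "wedges_quotient v (Xs[i := vadd ?W X Y]) = wedges_quotient v (Xs[i := X]) + wedges_quotient v (Xs[i := Y])"
    if "i < k" "X \<in> vecs ?W" "Y \<in> vecs ?W" for i X Y
    using that len by (auto simp: vecs_perp_quotient perp_quotient_add upd wedges_update_add)
  show "wedges_quotient v (Xs[i := vscale ?W c X]) = smult_fun c (wedges_quotient v (Xs[i := X]))"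
    if "i < k" "X \<in> vecs ?W" for i c X
    using that len by (auto simp: vecs_perp_quotient perp_quotient_scale upd wedges_update_scale)
  show "wedges_quotient v Xs = 0" if "i < k" "j < k" "i \<noteq> j" "Xs ! i = Xs ! j" for i j
    using that len wedges_repeated[of i xs j] by (simp add: wedges_quotient_def xs_def)
qed

text \<open>Applying \<open>lin_ext (wedges_quotient v)\<close> to two members of the coset
  \<open>\<Phi>\<^sub>v(\<omega>)\<close> gives the claim: the member from the contraction yields
  \<open>act v\<close> of the function of \<open>p\<close>, and the generator from the Grassmann
  cone yields \<open>v\<close> wedged with representatives.\<close>

lemma act_if_Phi:
  assumes v: "v \<noteq> 0" "B v v = 0" and p: "p \<in> free_on_tuples (Suc n) (vs UNIV)"
    and Phi: "Phi scale B v (Suc n) (coset (ext_null (Suc n) (vs UNIV)) p)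
      \<in> Gr_iso n (perp_quotient scale B v) (quotient_form B)"
  shows "\<exists>ys. length (v # ys) = Suc n \<and> (\<forall>x\<in>set (v # ys). \<forall>y\<in>set (v # ys). B x y = 0) \<and>
    act v (lin_ext wedges p) = wedges (v # ys)"
proof -
  let ?W = "perp_quotient scale B v"
  let ?\<pi> = "perp_proj scale v"
  obtain q where q: "q \<in> free_on_tuples n (vs (perp B v))" "lin_ext wedges q = contr v (lin_ext wedges p)"
    and pc: "perp_contraction scale B v (Suc n) (coset (ext_null (Suc n) (vs UNIV)) p) =
      coset (ext_null n (vs (perp B v))) q"
    using perp_contraction_coset[OF v(1) p] by (elim bexE conjE)
  define r where "r = free_extend (\<lambda>xs. generator (map ?\<pi> xs)) q"
  \<comment> \<open>\<open>Phi\<close> unfolds to a union of cosets. Membership of \<open>r\<close>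
    suffices, because the hypothesis exhibits the union as a single coset.\<close>
  have "r \<in> Phi scale B v (Suc n) (coset (ext_null (Suc n) (vs UNIV)) p)"
    unfolding Phi_def pc r_def diff_Suc_1 ext_map_def ext_lift_def
    by (rule UN_I; rule coset_self[OF free.subspace_0[OF subspace_ext_null]])
  moreover obtain Xs where Xs: "Xs \<in> tuples n ?W" "\<forall>X\<in>set Xs. \<forall>Y\<in>set Xs. quotient_form B X Y = 0"
    "Phi scale B v (Suc n) (coset (ext_null (Suc n) (vs UNIV)) p) = wedge ?W Xs"
    using Phi unfolding Gr_iso_def by blast
  moreover have "length Xs = n"
    using Xs(1) by (simp add: tuples_def)
  ultimately have "r - generator Xs \<in> ext_null n ?W"
    by (auto simp: wedge_def coset_def)
  then have "lin_ext (wedges_quotient v) r = wedges_quotient v Xs"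
    using wedges_quotient_ext_null[of "r - generator Xs" n v] by (simp add: lin_ext_diff lin_ext_single)
  moreover have "lin_ext (wedges_quotient v) r = wdg v (lin_ext wedges q)"
  proof -
    have "wedges_quotient v (map ?\<pi> xs) = wdg v (wedges xs)" for xs
      unfolding wedges_quotient_def
      by (rule wdg_wedges_cong)
        (auto simp: list_all2_conv_all_nth perp_proj_def intro: representative_coset)
    then have "lin_ext (wedges_quotient v) r = lin_ext (\<lambda>xs. wdg v (wedges xs)) q"
      by (simp add: r_def lin_ext_free_extend lin_ext_single)
    also have "\<dots> = wdg v (lin_ext wedges q)"
      by (rule lin_ext_linear) simp_all
    finally show ?thesis .
  qed
  ultimately have act: "act v (lin_ext wedges p) = wedges (v # map representative Xs)"
    by (simp add: act_def q(2) wedges_quotient_def)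
  have rep: "representative X \<in> perp B v \<and> X = coset (span {v}) (representative X)" if X: "X \<in> set Xs" for X
  proof -
    obtain x where x: "x \<in> perp B v" "X = coset (span {v}) x"
      using X Xs(1) by (auto simp: tuples_def vecs_perp_quotient)
    obtain c where c: "representative X - x = scale c v"
      using representative_coset x(2) by blast
    then have "representative X = x + scale c v"
      by (metis add.commute diff_add_cancel)
    then have "representative X \<in> perp B v"
      using x(1) v(2) by (simp add: perp_def)
    moreover have "coset (span {v}) (representative X) = X"
    proof (intro set_eqI)
      fix y
      have "(\<exists>d. y - representative X = scale d v) \<longleftrightarrow> (\<exists>d. y - x = scale d v)"
      proof -
        have "y - x = scale (d + c) v" if "y - representative X = scale d v" for d
          using that c by (simp add: algebra_simps)
        moreover have "y - representative X = scale (d - c) v" if "y - x = scale d v" for d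
          using that c by (simp add: algebra_simps)
        ultimately show ?thesis
          by blast
      qed
      then show "y \<in> coset (span {v}) (representative X) \<longleftrightarrow> y \<in> X"
        by (simp add: mem_coset_span x(2))
    qed
    ultimately show ?thesis
      by simp
  qed
  have "B (representative X) (representative Y) = 0" if "X \<in> set Xs" "Y \<in> set Xs" for X Y
    using quotient_form_coset[OF v(2), of "representative X" "representative Y"] rep that Xs(2) by metis
  moreover have "B v (representative X) = 0" "B (representative X) v = 0" if "X \<in> set Xs" for X
    using rep[OF that] B_commute by (auto simp: perp_def)
  ultimately have "\<forall>x\<in>set (v # map representative Xs). \<forall>y\<in>set (v # map representative Xs). B x y = 0"
    using v(2) by auto
  then show ?thesis
    using act \<open>length Xs = n\<close> by (intro exI[of _ "map representative Xs"]) simp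
qed

end

theorem theorem4p1:
  fixes scale :: "'k::field \<Rightarrow> 'v::ab_group_add \<Rightarrow> 'v"
    and Basis :: "'v set"
    and B :: "'v \<Rightarrow> 'v \<Rightarrow> 'k"
    and p :: nat
    and \<omega> :: "('v list \<Rightarrow>\<^sub>0 'k) set"
  assumes "CHAR('k) \<noteq> 2"
    and "finite_dimensional_vector_space scale Basis"
    and "symmetric_bilinear_form scale B"
    and "nondegenerate_form B"
    and "p = vector_space.dim scale (UNIV :: 'v set) div 2"
    and "has_witt_index scale B p"
    and "vector_space.dim scale (UNIV :: 'v set) > 8"
    and "\<omega> \<in> vecs (ext_power p (subspace_vs scale UNIV))"
    and "\<And>v. v \<noteq> 0 \<Longrightarrow> isotropic_vector B v \<Longrightarrow>
           Phi scale B v p \<omega> \<in> Gr_iso (p - 1) (perp_quotient scale B v) (quotient_form B)"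
  shows "\<omega> \<in> Gr_iso p (subspace_vs scale UNIV) B"
proof -
  interpret finite_dimensional_vector_space scale Basis
    by (rule assms(2))
  have "(2 :: 'k) \<noteq> 0"
  proof
    assume "(2 :: 'k) = 0"
    then have "CHAR('k) dvd 2"
      using of_nat_eq_0_iff_char_dvd[where 'a = 'k, of 2] by simp
    then have "CHAR('k) \<le> 2"
      by (rule dvd_imp_le) simp
    moreover have "CHAR('k) \<noteq> 0"
      using \<open>CHAR('k) dvd 2\<close> by (metis dvd_0_left zero_neq_numeral)
    moreover have "CHAR('k) \<noteq> 1"
      by simp
    ultimately show False
      using assms(1) by linarith
  qed
  then interpret bilinear_space scale Basis B
    using assms(3,4) by unfold_locales
  have "p \<noteq> 0"
    using assms(5,7) by simp
  then obtain n where n: "p = Suc n"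
    using not0_implies_Suc by blast
  obtain P where P: "P \<in> free_on_tuples p (vs UNIV)" "\<omega> = coset (ext_null p (vs UNIV)) P"
    using assms(8) by (auto simp: vecs_ext_power)
  interpret isotropic_actions scale Basis B p "lin_ext wedges P"
  proof unfold_locales
    show "lin_ext wedges P \<in> alt p"
      using P(1) by (rule lin_ext_wedges_alt)
    fix v assume "v \<noteq> 0" "B v v = 0"
    then show "\<exists>ys. length (v # ys) = p \<and> (\<forall>x\<in>set (v # ys). \<forall>y\<in>set (v # ys). B x y = 0) \<and>
        act v (lin_ext wedges P) = wedges (v # ys)"
      using act_if_Phi[of v P n] assms(9)[of v] P unfolding n isotropic_vector_def by simp
  qed
  obtain L where L: "isotropic_subspace scale B L" "dim L = p"
    using assms(6) unfolding has_witt_index_def maximal_isotropic_subspace_def by blast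
  obtain T where T: "T \<subseteq> L" "independent T" "card T = p"
    using basis_exists[of L] L(2) by metis
  obtain ls where ls: "set ls = T" "distinct ls"
    using finite_distinct_list[OF finiteI_independent[OF T(2)]] by blast
  have "pure_isotropic p (lin_ext wedges P)"
    using T ls L(1) distinct_card[OF ls(2)]
    by (intro pure_isotropic_if_actions[of ls] assms(5,7)) (auto simp: isotropic_subspace_def)
  then obtain ys where ys: "length ys = p" "\<forall>x\<in>set ys. \<forall>y\<in>set ys. B x y = 0"
    "lin_ext wedges P = wedges ys"
    unfolding pure_isotropic_def by blast
  have tup: "ys \<in> tuples p (vs UNIV)"
    using ys(1) by (simp add: tuples_def)
  \<comment> \<open>Injectivity of the comparison carries the equality of functions back to the
    exterior power.\<close>
  have "P - generator ys \<in> ext_null p (vs UNIV)"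
    by (intro lin_ext_wedges_inj subspace_UNIV free.subspace_diff[OF subspace_free_on_tuples] P(1)
        generator_in_free_on_tuples tup) (simp add: lin_ext_diff lin_ext_single ys(3))
  then have "\<omega> = wedge (vs UNIV) ys"
    using P(2) ys(1) by (simp add: wedge_def coset_eq_iff[OF subspace_ext_null])
  then show ?thesis
    unfolding Gr_iso_def using tup ys(2) by blast
qed

end
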